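(* Let $p_1,p_2\in(2,4)$ with $p_1<p_2$, $\beta\geq0$ and $\mu>0$ be fixed. For $\sigma\in\mathbb{R}$ let $\sigma_1=\sigma_2=\sigma$ and let $U=(u_1,u_2)$ (depending on $\sigma$) be a ground state of $F$ at mass $\mu$. Let $$\mu^\star:=\left(\frac{\mathcal{E}_{p_1}(1)}{\mathcal{E}_{p_2}(1)}\right)^{\frac{(4-p_1)(4-p_2)}{2(p_2-p_1)}}.$$ Then, as $\sigma\to+\infty$, the following limits hold: (i) if $\mu<\mu^\star$, then $\|u_1\|_{L^2(\mathbb{R}^2)}^2\to\mu$ and $F(U)\to\mathcal{E}_{p_1}(\mu)$; (ii) if $\mu>\mu^\star$, then $\|u_2\|_{L^2(\mathbb{R}^2)}^2\to\mu$ and $F(U)\to\mathcal{E}_{p_2}(\mu)$.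
   Context: All functions are complex-valued. For $\lambda>0$, $\mathcal{G}_\lambda$ denotes the Green's function of $-\Delta+\lambda$ on $\mathbb{R}^2$, i.e. the $L^2(\mathbb{R}^2)$ solution of $(-\Delta+\lambda)\mathcal{G}_\lambda=\delta_0$ (it lies in $L^2(\mathbb{R}^2)\setminus H^1(\mathbb{R}^2)$). Let $\mathcal{D}:=\{u\in L^2(\mathbb{R}^2):\exists\, q\in\mathbb{C},\ u-q\mathcal{G}_1=:\phi\in H^1(\mathbb{R}^2)\}$. The (uniquely determined) number $q$ is called the charge of $u$. For $p>2$, $\sigma\in\mathbb{R}$ and $u=\phi+q\mathcal{G}_1\in\mathcal{D}$ set $$F_{p,\sigma}(u):=\frac12\left(\|\phi\|_{H^1(\mathbb{R}^2)}^2-\|u\|_{L^2(\mathbb{R}^2)}^2\right)+\frac{|q|^2}{2}\left(\sigma+\frac{\gamma-\log 2}{2\pi}\right)-\frac1p\|u\|_{L^p(\mathbb{R}^2)}^p,$$ where $\gamma$ is the Euler–Mascheroni constant and $\|\phi\|_{H^1}^2=\|\nabla\phi\|_{L^2}^2+\|\phi\|_{L^2}^2$. Let $\Lambda:=\mathcal{D}\times\mathcal{D}$. For $U=(u_1,u_2)\in\Lambda$, with $q_i$ the charge of $u_i$, set $$F(U):=F_{p_1,\sigma_1}(u_1)+F_{p_2,\sigma_2}(u_2)-\beta\,\mathrm{Re}\{q_1\overline{q_2}\}.$$ For $\mu>0$ let $\Lambda_\mu:=\{(u_1,u_2)\in\Lambda:\|u_1\|_{L^2(\mathbb{R}^2)}^2+\|u_2\|_{L^2(\mathbb{R}^2)}^2=\mu\}$.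 A ground state of $F$ at mass $\mu$ is a $U\in\Lambda_\mu$ with $F(U)=\inf_{V\in\Lambda_\mu}F(V)$ (ground states exist for every $\mu>0$). For $p\in(2,4)$ and $\mu>0$, $\mathcal{E}_p(\mu):=\inf\{E_p(v):v\in H^1(\mathbb{R}^2),\ \|v\|_{L^2(\mathbb{R}^2)}^2=\mu\}$, where $E_p(v):=\frac12\int_{\mathbb{R}^2}|\nabla v|^2\,dx-\frac1p\int_{\mathbb{R}^2}|v|^p\,dx$; one has $-\infty<\mathcal{E}_p(\mu)<0$. *)

theory Defs
  imports "HOL-Analysis.Analysis"
begin

text \<open>
  Elements of \<open>L\<^sup>p(\<real>\<^sup>2)\<close> are represented by Borel measurable functions (every almost-everywhere class has
  such a representative); functions are not quotiented by almost-everywhere equality. All notions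
  below are invariant under changing the functions on a null set.
\<close>

type_synonym R2 = "real^2"

definition partial :: "2 \<Rightarrow> (R2 \<Rightarrow> complex) \<Rightarrow> R2 \<Rightarrow> complex" where
  "partial i f x = frechet_derivative f (at x) (axis i 1)"

primrec Ck :: "nat \<Rightarrow> (R2 \<Rightarrow> complex) \<Rightarrow> bool" where
  "Ck 0 f \<longleftrightarrow> continuous_on UNIV f"
| "Ck (Suc k) f \<longleftrightarrow> (\<forall>x. f differentiable (at x)) \<and> (\<forall>i. Ck k (partial i f))"

definition test_fun :: "(R2 \<Rightarrow> complex) set" where
  "test_fun = {\<psi>. (\<forall>k. Ck k \<psi>) \<and> compact (closure {x. \<psi> x \<noteq> 0})}"

definition laplacian :: "(R2 \<Rightarrow> complex) \<Rightarrow> R2 \<Rightarrow> complex" where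
  "laplacian f x = (\<Sum>i\<in>UNIV. partial i (partial i f) x)"

definition Lp :: "real \<Rightarrow> (R2 \<Rightarrow> complex) set" where
  "Lp p = {u \<in> borel_measurable lborel. integrable lborel (\<lambda>x. norm (u x) powr p)}"

definition lp_norm :: "real \<Rightarrow> (R2 \<Rightarrow> complex) \<Rightarrow> real" where
  "lp_norm p u = (LINT x|lborel. norm (u x) powr p) powr (1 / p)"

definition has_weak_partial :: "2 \<Rightarrow> (R2 \<Rightarrow> complex) \<Rightarrow> (R2 \<Rightarrow> complex) \<Rightarrow> bool" where
  "has_weak_partial i u g \<longleftrightarrow>
     (\<forall>\<psi>\<in>test_fun. (LINT x|lborel. u x * partial i \<psi> x) = - (LINT x|lborel. g x * \<psi> x))"

definition H1 :: "(R2 \<Rightarrow> complex) set" where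
  "H1 = {u \<in> Lp 2. \<forall>i. \<exists>g\<in>Lp 2. has_weak_partial i u g}"

text \<open>On \<open>H1\<close> the weak partial derivative is unique up to a null set, so that the choice of
  the representative is immaterial.\<close>

definition weak_partial :: "2 \<Rightarrow> (R2 \<Rightarrow> complex) \<Rightarrow> R2 \<Rightarrow> complex" where
  "weak_partial i u = (SOME g. g \<in> Lp 2 \<and> has_weak_partial i u g)"

definition grad_norm :: "(R2 \<Rightarrow> complex) \<Rightarrow> real" where
  "grad_norm u = sqrt (\<Sum>i\<in>UNIV. (lp_norm 2 (weak_partial i u))\<^sup>2)"

definition h1_norm :: "(R2 \<Rightarrow> complex) \<Rightarrow> real" where
  "h1_norm u = sqrt ((grad_norm u)\<^sup>2 + (lp_norm 2 u)\<^sup>2)"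

text \<open>\<open>(-\<Delta> + \<lambda>) G = \<delta>\<^sub>0\<close> in the sense of distributions, with \<open>G\<close> in \<open>L\<^sup>2\<close>; for \<open>\<lambda> > 0\<close> this
  determines \<open>G\<close> up to a null set.\<close>

definition is_green :: "real \<Rightarrow> (R2 \<Rightarrow> complex) \<Rightarrow> bool" where
  "is_green l G \<longleftrightarrow> G \<in> Lp 2 \<and>
     (\<forall>\<psi>\<in>test_fun. (LINT x|lborel. G x * (- laplacian \<psi> x + of_real l * \<psi> x)) = \<psi> 0)"

definition green :: "real \<Rightarrow> R2 \<Rightarrow> complex" where
  "green l = (SOME G. is_green l G)"

definition regular_part :: "complex \<Rightarrow> (R2 \<Rightarrow> complex) \<Rightarrow> R2 \<Rightarrow> complex" where
  "regular_part q u x = u x - q * green 1 x"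

definition Dom :: "(R2 \<Rightarrow> complex) set" where
  "Dom = {u \<in> Lp 2. \<exists>q. regular_part q u \<in> H1}"

definition charge :: "(R2 \<Rightarrow> complex) \<Rightarrow> complex" where
  "charge u = (THE q. regular_part q u \<in> H1)"

definition F_single :: "real \<Rightarrow> real \<Rightarrow> (R2 \<Rightarrow> complex) \<Rightarrow> real" where
  "F_single p \<sigma> u =
     1/2 * ((h1_norm (regular_part (charge u) u))\<^sup>2 - (lp_norm 2 u)\<^sup>2)
     + (cmod (charge u))\<^sup>2 / 2 * (\<sigma> + (euler_mascheroni - ln 2) / (2 * pi))
     - 1/p * lp_norm p u powr p"

definition F_pair :: "real \<Rightarrow> real \<Rightarrow> real \<Rightarrow> real \<Rightarrow> real \<Rightarrow>
    (R2 \<Rightarrow> complex) \<times> (R2 \<Rightarrow> complex) \<Rightarrow> real" where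
  "F_pair p1 p2 \<sigma>1 \<sigma>2 \<beta> U =
     F_single p1 \<sigma>1 (fst U) + F_single p2 \<sigma>2 (snd U)
     - \<beta> * Re (charge (fst U) * cnj (charge (snd U)))"

definition Lam :: "real \<Rightarrow> ((R2 \<Rightarrow> complex) \<times> (R2 \<Rightarrow> complex)) set" where
  "Lam \<mu> = {(u1, u2) \<in> Dom \<times> Dom. (lp_norm 2 u1)\<^sup>2 + (lp_norm 2 u2)\<^sup>2 = \<mu>}"

text \<open>The infimum is taken in the extended reals, where it is meaningful without a lower bound.\<close>

definition ground_state :: "real \<Rightarrow> real \<Rightarrow> real \<Rightarrow> real \<Rightarrow> real \<Rightarrow> real \<Rightarrow>
    (R2 \<Rightarrow> complex) \<times> (R2 \<Rightarrow> complex) \<Rightarrow> bool" where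
  "ground_state p1 p2 \<sigma>1 \<sigma>2 \<beta> \<mu> U \<longleftrightarrow>
     U \<in> Lam \<mu> \<and>
     ereal (F_pair p1 p2 \<sigma>1 \<sigma>2 \<beta> U) = (INF V\<in>Lam \<mu>. ereal (F_pair p1 p2 \<sigma>1 \<sigma>2 \<beta> V))"

definition E_fun :: "real \<Rightarrow> (R2 \<Rightarrow> complex) \<Rightarrow> real" where
  "E_fun p v = 1/2 * (grad_norm v)\<^sup>2 - 1/p * (LINT x|lborel. norm (v x) powr p)"

text \<open>A real infimum: for \<open>2 < p < 4\<close> and \<open>\<mu> > 0\<close> the set is nonempty and bounded below.\<close>

definition E_inf :: "real \<Rightarrow> real \<Rightarrow> real" where
  "E_inf p \<mu> = (INF v\<in>{v \<in> H1. (lp_norm 2 v)\<^sup>2 = \<mu>}. E_fun p v)"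

definition mu_star :: "real \<Rightarrow> real \<Rightarrow> real" where
  "mu_star p1 p2 =
     (E_inf p1 1 / E_inf p2 1) powr ((4 - p1) * (4 - p2) / (2 * (p2 - p1)))"

end

theory Submission
  imports Defs
begin

text \<open>
  Increasing \<open>\<sigma>\<close> by \<open>t\<close> adds \<open>t (\<bar>q\<^sub>1\<bar>\<^sup>2 + \<bar>q\<^sub>2\<bar>\<^sup>2) / 2\<close> to \<open>F\<close>. A ground state at \<open>\<sigma>\<close> has
  negative energy and is a competitor for the ground state at \<open>\<sigma> = 0\<close>, so its charges are
  \<open>O(\<sigma>\<^bsup>-1/2\<^esup>)\<close>. For small charges the energy of each component is at least the standard
  energy level of its mass, up to \<open>o(1)\<close>. By scaling, the level of mass \<open>m\<close> is
  \<open>m\<^bsup>2/(4 - p)\<^esup>\<close> times the negative level of mass 1; as the exponent exceeds 1, splitting the mass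
  is not favourable, and the threshold \<open>\<mu>\<^sup>*\<close> is where the levels of mass \<open>\<mu>\<close> for \<open>p\<^sub>1\<close> and
  \<open>p\<^sub>2\<close> agree. The pairs \<open>(v, 0)\<close> and \<open>(0, v)\<close> with \<open>v \<in> H\<^sup>1\<close> give the upper bound for \<open>F\<close>,
  and they show that the existence of ground states makes the standard energies bounded below, so
  that no Gagliardo-Nirenberg inequality is needed.
\<close>

section \<open>Test functions\<close>

text \<open>The charge is a definite description and the Green's function a choice, so neither says
  anything until a Green's function has been exhibited and shown to lie outside \<open>H1\<close>. A
  second obstacle is the L^p norm: a divergent Bochner integral is 0, so the p-th power term of the
  energy is meaningful on \<open>H1\<close> only after an embedding into L^p. Since p lies strictly
  between 2 and 4, a weak-type estimate at the exponent 4 is enough for it. The concentration rests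
  on linearisation. For 0 \<le> m \<le> \<mu> and \<theta> = 2/(4 - p) > 1, the chord inequality
  m^\<theta> \<le> \<mu>^(\<theta> - 1) m turns the lower bound into a linear function of the two
  masses whose slopes are the standard levels at mass \<mu> divided by \<mu>. On m1 + m2 = \<mu> it
  is least at an endpoint, where it meets the upper bound; a strict inequality between the slopes
  therefore forces all mass into one component. The singular part of a function is split off by
  convexity of t^p with weights 1 - |q| and |q|, which makes every error vanish with the charge
  q.\<close>

lemma partial_eqI: "(f has_derivative f') (at x) \<Longrightarrow> partial i f x = f' (axis i 1)"
  by (metis frechet_derivative_at partial_def)

lemma partial_const: "partial i (\<lambda>_. c) = (\<lambda>_. 0)"
  by (rule ext, rule partial_eqI[of _ "\<lambda>_. 0", THEN trans]) auto

lemma partial_add: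
  assumes "\<And>x. f differentiable at x" "\<And>x. g differentiable at x"
  shows "partial i (\<lambda>x. f x + g x) = (\<lambda>x. partial i f x + partial i g x)"
proof
  fix x
  show "partial i (\<lambda>x. f x + g x) x = partial i f x + partial i g x"
    using partial_eqI[OF has_derivative_add[OF assms[unfolded frechet_derivative_works]]]
    by (simp add: partial_def)
qed

lemma partial_mult:
  assumes "\<And>x. f differentiable at x" "\<And>x. g differentiable at x"
  shows "partial i (\<lambda>x. f x * g x) = (\<lambda>x. f x * partial i g x + partial i f x * g x)"
proof
  fix x
  show "partial i (\<lambda>x. f x * g x) x = f x * partial i g x + partial i f x * g x"
    using partial_eqI[OF has_derivative_mult[OF assms[unfolded frechet_derivative_works]]]
    by (simp add: partial_def)
qed

lemma has_derivative_affine: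
  fixes f :: "R2 \<Rightarrow> complex"
  assumes "f differentiable at (y + c *\<^sub>R x)"
  shows "((\<lambda>x. f (y + c *\<^sub>R x)) has_derivative (\<lambda>h. frechet_derivative f (at (y + c *\<^sub>R x)) (c *\<^sub>R h))) (at x)"
proof -
  have "((\<lambda>x. y + c *\<^sub>R x) has_derivative (\<lambda>h. c *\<^sub>R h)) (at x)"
    by (auto intro!: derivative_eq_intros)
  from diff_chain_at[OF this assms[unfolded frechet_derivative_works]] show ?thesis
    by (simp add: o_def)
qed

lemma differentiable_affine:
  fixes f :: "R2 \<Rightarrow> complex"
  assumes "f differentiable at (y + c *\<^sub>R x)"
  shows "(\<lambda>x. f (y + c *\<^sub>R x)) differentiable at x"
  using has_derivative_affine[OF assms] by (auto simp: differentiable_def)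

lemma partial_affine:
  assumes "\<And>x. f differentiable at x"
  shows "partial i (\<lambda>x. f (y + c *\<^sub>R x)) = (\<lambda>x. c *\<^sub>R partial i f (y + c *\<^sub>R x))"
proof
  fix x
  have "linear (frechet_derivative f (at (y + c *\<^sub>R x)))"
    using assms linear_frechet_derivative by blast
  then show "partial i (\<lambda>x. f (y + c *\<^sub>R x)) x = c *\<^sub>R partial i f (y + c *\<^sub>R x)"
    using partial_eqI[OF has_derivative_affine[OF assms]] by (simp add: partial_def linear_scale)
qed

lemma Ck_const: "Ck k (\<lambda>_. c)"
  by (induction k arbitrary: c) (auto simp: partial_const)

lemma Ck_SucD: "Ck (Suc k) f \<Longrightarrow> Ck k f"
proof (induction k arbitrary: f)
  case 0
  then show ?case
    by (simp add: continuous_on_eq_continuous_within differentiable_imp_continuous_within)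
qed simp

lemma Ck_add: "Ck k f \<Longrightarrow> Ck k g \<Longrightarrow> Ck k (\<lambda>x. f x + g x)"
  by (induction k arbitrary: f g) (auto intro: continuous_intros simp: partial_add)

lemma Ck_mult: "Ck k f \<Longrightarrow> Ck k g \<Longrightarrow> Ck k (\<lambda>x. f x * g x)"
proof (induction k arbitrary: f g)
  case (Suc k)
  then show ?case
    \<comment> \<open>The product rule leaves one factor undifferentiated, and its order has to be
      lowered from \<open>Suc k\<close> to \<open>k\<close>.\<close>
    using Ck_SucD[OF Suc.prems(1)] Ck_SucD[OF Suc.prems(2)]
    by (auto simp: partial_mult intro!: Ck_add)
qed (auto intro: continuous_intros)

lemma Ck_affine: "Ck k f \<Longrightarrow> Ck k (\<lambda>x. f (y + c *\<^sub>R x))"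
proof (induction k arbitrary: f)
  case 0
  then show ?case
    using continuous_on_compose2[of UNIV f UNIV "\<lambda>x. y + c *\<^sub>R x"] by (simp add: continuous_intros)
next
  case (Suc k)
  then have "Ck k (\<lambda>x. of_real c * partial i f (y + c *\<^sub>R x))" for i
    by (intro Ck_mult Ck_const) auto
  with Suc.prems show ?case
    by (simp add: partial_affine differentiable_affine flip: scaleR_conv_of_real)
qed

lemma Ck_prod: "(\<And>i. i \<in> I \<Longrightarrow> Ck k (f i)) \<Longrightarrow> Ck k (\<lambda>x. \<Prod>i\<in>I. f i x)"
  by (induction I rule: infinite_finite_induct) (auto intro: Ck_const Ck_mult)

text \<open>The powers of 1/t make the family stable under differentiation, so that smoothness is an
  induction on the order for all \<open>m\<close> at once. As \<open>c\<close> tends to 0, exp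
  (-c/t) tends to 1 for every t > 0, which later turns bumps into indicators.\<close>

definition flat :: "real \<Rightarrow> nat \<Rightarrow> real \<Rightarrow> real" where
  "flat c m t = (if t > 0 then (1 / t) ^ m * exp (- c / t) else 0)"

lemma flat_has_derivative:
  assumes "c > 0"
  shows "(flat c m has_real_derivative (c * flat c (m + 2) t - m * flat c (m + 1) t)) (at t)"
proof -
  consider "t > 0" | "t < 0" | "t = 0" by linarith
  then show ?thesis
  proof cases
    case 1
    have "((\<lambda>t. (1 / t) ^ m * exp (- c / t)) has_real_derivative
        (c * flat c (m + 2) t - m * flat c (m + 1) t)) (at t)"
    proof (rule DERIV_cong)
      show "((\<lambda>t. (1 / t) ^ m * exp (- c / t)) has_real_derivative
          (1 / t) ^ m * (exp (- c / t) * (c / t\<^sup>2)) + m * (1 / t) ^ (m - 1) * (- 1 / t\<^sup>2) * exp (- c / t)) (at t)"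
        using 1 by (auto intro!: derivative_eq_intros simp: power2_eq_square)
      show "(1 / t) ^ m * (exp (- c / t) * (c / t\<^sup>2)) + m * (1 / t) ^ (m - 1) * (- 1 / t\<^sup>2) * exp (- c / t)
          = c * flat c (m + 2) t - m * flat c (m + 1) t"
        \<comment> \<open>The exponent \<open>m - 1\<close> is truncated at \<open>m = 0\<close>,
          but there the term carries the factor \<open>m\<close>.\<close>
        using 1 by (cases m) (simp_all add: flat_def power2_eq_square mult.assoc)
    qed
    then show ?thesis
      by (rule has_field_derivative_transform_within_open[where S="{0<..}"])
        (use 1 in \<open>auto simp: flat_def\<close>)
  next
    case 2
    have "((\<lambda>t. 0) has_real_derivative (c * flat c (m + 2) t - m * flat c (m + 1) t)) (at t)"
      using 2 by (simp add: flat_def)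
    then show ?thesis
      by (rule has_field_derivative_transform_within_open[where S="{..<0}"])
        (use 2 in \<open>auto simp: flat_def\<close>)
  next
    case 3
    have "((\<lambda>h. (1 / h) ^ m * exp (- c / h) / h) \<longlongrightarrow> 0) (at_right 0)"
    proof -
      have "filterlim (\<lambda>h::real. c / h) at_top (at_right 0)"
        using filterlim_tendsto_pos_mult_at_top[OF tendsto_const assms filterlim_inverse_at_top_right]
        by (simp add: divide_inverse)
      \<comment> \<open>With s = c/h the quotient is c^(-(m + 1)) s^(m + 1) / e^s, and s tends to
        infinity as h decreases to 0.\<close>
      from filterlim_compose[OF tendsto_power_div_exp_0[of "Suc m"] this]
      have "((\<lambda>h. (1 / c) ^ Suc m * ((c / h) ^ Suc m / exp (c / h))) \<longlongrightarrow> 0) (at_right 0)"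
        by (rule tendsto_mult_right_zero)
      then show ?thesis
        using assms by (simp add: power_divide exp_minus field_simps)
    qed
    then have "((\<lambda>h. flat c m h / h) \<longlongrightarrow> 0) (at_right 0)"
      by (rule Lim_transform_eventually) (auto simp: flat_def eventually_at_right_field intro: exI[of _ 1])
    moreover have "((\<lambda>h. flat c m h / h) \<longlongrightarrow> 0) (at_left 0)"
      by (rule Lim_transform_eventually[OF tendsto_const]) (auto simp: flat_def eventually_at_left_field intro: exI[of _ "-1"])
    ultimately have "((\<lambda>h. flat c m h / h) \<longlongrightarrow> 0) (at 0)"
      by (simp add: filterlim_split_at)
    then show ?thesis
      using 3 by (simp add: DERIV_def flat_def)
  qed
qed

text \<open>The values 1 and -1 of \<open>r\<close> give the two factors that a bump has in each
  coordinate.\<close>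

lemma Ck_flat:
  assumes "c > 0"
  shows "Ck k (\<lambda>x. of_real (flat c m (r * x $ i + b)))"
proof (induction k arbitrary: m)
  case 0
  have "isCont (flat c m) t" for t
    using flat_has_derivative[OF assms] DERIV_isCont by blast
  then have "continuous_on UNIV (flat c m)"
    by (simp add: continuous_at_imp_continuous_on)
  then have "continuous_on UNIV (\<lambda>x::R2. flat c m (r * x $ i + b))"
    by (rule continuous_on_compose2) (auto intro!: continuous_intros)
  then show ?case
    by (simp add: continuous_on_of_real)
next
  case (Suc k)
  let ?D = "\<lambda>t. c * flat c (m + 2) t - m * flat c (m + 1) t"
  have D: "((\<lambda>x::R2. complex_of_real (flat c m (r * x $ i + b))) has_derivative
      (\<lambda>h. of_real ((r * h $ i) * ?D (r * x $ i + b)))) (at x)" for x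
  proof -
    have "((\<lambda>x::R2. r * x $ i + b) has_derivative (\<lambda>h. r * h $ i)) (at x)"
      by (auto intro!: derivative_eq_intros bounded_linear.has_derivative[OF bounded_linear_vec_nth])
    from has_derivative_of_real[OF DERIV_compose_FDERIV[OF flat_has_derivative[OF assms] this]]
    show ?thesis .
  qed
  have P: "partial j (\<lambda>x::R2. complex_of_real (flat c m (r * x $ i + b))) =
      (\<lambda>x. of_real (r * axis j 1 $ i * c) * of_real (flat c (m + 2) (r * x $ i + b))
         + of_real (- (r * axis j 1 $ i * m)) * of_real (flat c (m + 1) (r * x $ i + b)))" for j
    by (rule ext, subst partial_eqI[OF D]) (simp add: algebra_simps)
  show ?case
    unfolding Ck.simps P differentiable_def using D by (intro conjI allI Ck_add Ck_mult Ck_const Suc) blast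
qed

lemma test_funI:
  assumes "\<And>k. Ck k f" "bounded {x. f x \<noteq> 0}"
  shows "f \<in> test_fun"
  using assms by (auto simp: test_fun_def compact_closure)

lemma test_funD:
  assumes "f \<in> test_fun"
  shows test_fun_differentiable: "f differentiable at x"
    and test_fun_continuous: "continuous_on A f"
    and test_fun_Ck: "Ck k f"
    and test_fun_bounded: "bounded {x. f x \<noteq> 0}"
proof -
  have "Ck k f" for k using assms by (auto simp: test_fun_def)
  from this[of k] this[of "Suc 0"] this[of 0]
  show "f differentiable at x" "continuous_on A f" "Ck k f"
    using continuous_on_subset[of UNIV f A] by simp_all
  show "bounded {x. f x \<noteq> 0}"
    using assms by (simp add: test_fun_def compact_closure)
qed

lemma test_fun_partial:
  assumes "f \<in> test_fun"
  shows "partial i f \<in> test_fun"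
proof -
  have "partial i f x = 0" if "x \<notin> closure {x. f x \<noteq> 0}" for x
  proof -
    have "(f has_derivative (\<lambda>_. 0)) (at x)"
      by (rule has_derivative_transform_within_open[of "\<lambda>_. 0" _ _ _ "- closure {x. f x \<noteq> 0}"])
        (use that closure_subset[of "{x. f x \<noteq> 0}"] in auto)
    then show ?thesis by (simp add: partial_eqI)
  qed
  then have "{x. partial i f x \<noteq> 0} \<subseteq> closure {x. f x \<noteq> 0}" by auto
  then have "bounded {x. partial i f x \<noteq> 0}"
    using bounded_subset[OF bounded_closure[OF test_fun_bounded[OF assms]]] by blast
  moreover have "Ck k (partial i f)" for k
    using test_fun_Ck[OF assms, of "Suc k"] by simp
  ultimately show ?thesis by (intro test_funI)
qed

lemma test_fun_affine:
  assumes "f \<in> test_fun" "c \<noteq> 0"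
  shows "(\<lambda>x. f (y + c *\<^sub>R x)) \<in> test_fun"
proof (rule test_funI)
  show "Ck k (\<lambda>x. f (y + c *\<^sub>R x))" for k
    using test_fun_Ck[OF assms(1)] by (rule Ck_affine)
  have "{x. f (y + c *\<^sub>R x) \<noteq> 0} \<subseteq> (\<lambda>z. (- (1 / c)) *\<^sub>R y + (1 / c) *\<^sub>R z) ` {x. f x \<noteq> 0}"
  proof
    fix x assume "x \<in> {x. f (y + c *\<^sub>R x) \<noteq> 0}"
    then show "x \<in> (\<lambda>z. (- (1 / c)) *\<^sub>R y + (1 / c) *\<^sub>R z) ` {x. f x \<noteq> 0}"
      using assms(2) by (intro image_eqI[of _ _ "y + c *\<^sub>R x"]) (simp_all add: scaleR_add_right)
  qed
  moreover have "bounded ((\<lambda>z. (- (1 / c)) *\<^sub>R y + (1 / c) *\<^sub>R z) ` {x. f x \<noteq> 0})"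
    using bounded_translation[OF bounded_scaling[OF test_fun_bounded[OF assms(1)], of "1/c"], of "(- (1 / c)) *\<^sub>R y"]
    by (simp add: image_image)
  ultimately show "bounded {x. f (y + c *\<^sub>R x) \<noteq> 0}" using bounded_subset by blast
qed

lemma test_fun_cmult:
  assumes "f \<in> test_fun"
  shows "(\<lambda>x. c * f x) \<in> test_fun"
  by (intro test_funI Ck_mult Ck_const test_fun_Ck[OF assms])
     (rule bounded_subset[OF test_fun_bounded[OF assms]], auto)

lemma test_fun_add:
  assumes "f \<in> test_fun" "g \<in> test_fun"
  shows "(\<lambda>x. f x + g x) \<in> test_fun"
proof (intro test_funI Ck_add assms[THEN test_fun_Ck])
  have "{x. f x + g x \<noteq> 0} \<subseteq> {x. f x \<noteq> 0} \<union> {x. g x \<noteq> 0}" by auto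
  then show "bounded {x. f x + g x \<noteq> 0}"
    using test_fun_bounded[OF assms(1)] test_fun_bounded[OF assms(2)]
    by (meson bounded_Un bounded_subset)
qed

text \<open>A product over the coordinates rather than a radial function: it is nonzero exactly on
  an open box, and open boxes are an intersection-stable generator of the Borel sets.\<close>

definition bump :: "real \<Rightarrow> R2 \<Rightarrow> R2 \<Rightarrow> R2 \<Rightarrow> complex" where
  "bump c a b x = (\<Prod>i\<in>UNIV. of_real (flat c 0 (x $ i - a $ i)) * of_real (flat c 0 (b $ i - x $ i)))"

lemma bump_nz_iff: "bump c a b x \<noteq> 0 \<longleftrightarrow> x \<in> box a b"
  by (auto simp: bump_def flat_def mem_box_cart)

lemma bump_norm_le: "c > 0 \<Longrightarrow> norm (bump c a b x) \<le> indicator (box a b) x"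
proof (cases "x \<in> box a b")
  case False
  then show ?thesis using bump_nz_iff[of c a b x] by auto
next
  case True
  assume "c > 0"
  then have "\<bar>flat c 0 t\<bar> \<le> 1" for t by (auto simp: flat_def)
  then have "norm (bump c a b x) \<le> 1"
    unfolding bump_def prod_norm[symmetric]
    by (intro prod_le_1) (auto simp: norm_mult intro!: mult_le_one)
  with True show ?thesis by simp
qed

lemma bump_test_fun: "c > 0 \<Longrightarrow> bump c a b \<in> test_fun"
proof (rule test_funI)
  assume c: "c > 0"
  show "Ck k (bump c a b)" for k
    unfolding bump_def
    using Ck_flat[OF c, of k 0 1 _ "- a $ i" for i] Ck_flat[OF c, of k 0 "-1" _ "b $ i" for i]
    by (intro Ck_prod Ck_mult) (auto simp: algebra_simps)
  show "bounded {x. bump c a b x \<noteq> 0}"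
    unfolding bump_nz_iff by simp
qed

lemma bump_tendsto:
  "(\<lambda>n. bump (1 / Suc n) a b x) \<longlonglongrightarrow> indicator (box a b) x"
proof (cases "x \<in> box a b")
  case True
  have "(\<lambda>n. flat (1 / Suc n) 0 t) \<longlonglongrightarrow> 1" if "t > 0" for t
  proof -
    have "(\<lambda>n. exp (- (1 / real (Suc n)) / t)) \<longlonglongrightarrow> exp (- 0 / t)"
      by (intro tendsto_exp tendsto_divide tendsto_minus tendsto_const LIMSEQ_Suc[OF lim_1_over_n]) (use that in auto)
    then show ?thesis using that by (simp add: flat_def)
  qed
  then have "(\<lambda>n. bump (1 / Suc n) a b x) \<longlonglongrightarrow> (\<Prod>i\<in>(UNIV::2 set). of_real 1 * of_real 1)"
    unfolding bump_def using True by (intro tendsto_prod tendsto_mult tendsto_of_real) (auto simp: mem_box_cart)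
  with True show ?thesis by simp
next
  case False
  then have "bump (1 / Suc n) a b x = 0" for n using bump_nz_iff by blast
  with False show ?thesis by simp
qed

section \<open>Integration on the plane and the fundamental lemma of the calculus of variations\<close>

lemma nn_integral_lborel_affine:
  fixes f :: "R2 \<Rightarrow> ennreal"
  assumes [measurable]: "f \<in> borel_measurable borel" and c: "c \<noteq> 0"
  shows "(\<integral>\<^sup>+x. f x \<partial>lborel) = ennreal (c\<^sup>2) * (\<integral>\<^sup>+x. f (t + c *\<^sub>R x) \<partial>lborel)"
  by (subst lborel_affine[OF c, of t])
     (simp add: nn_integral_density nn_integral_distr nn_integral_cmult)

lemma integrable_lborel_affine:
  fixes f :: "R2 \<Rightarrow> 'b::{banach, second_countable_topology}"
  assumes f: "integrable lborel f" and c: "c \<noteq> 0"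
  shows "integrable lborel (\<lambda>x. f (t + c *\<^sub>R x))"
proof -
  have [measurable]: "f \<in> borel_measurable borel" using f by auto
  have "(\<integral>\<^sup>+x. norm (f x) \<partial>lborel) = ennreal (c\<^sup>2) * (\<integral>\<^sup>+x. norm (f (t + c *\<^sub>R x)) \<partial>lborel)"
    by (rule nn_integral_lborel_affine) (use c in auto)
  with f c show ?thesis
    unfolding integrable_iff_bounded by (auto simp: ennreal_mult_less_top)
qed

lemma integrable_lborel_affine_iff:
  fixes f :: "R2 \<Rightarrow> 'b::{banach, second_countable_topology}"
  assumes c: "c \<noteq> 0"
  shows "integrable lborel (\<lambda>x. f (t + c *\<^sub>R x)) \<longleftrightarrow> integrable lborel f"
  using integrable_lborel_affine[of f c t] c
    integrable_lborel_affine[of "\<lambda>x. f (t + c *\<^sub>R x)" "1/c" "(- 1 / c) *\<^sub>R t"]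
  by (auto simp: scaleR_add_right scaleR_diff_right)

text \<open>Valid for every \<open>f\<close>: a non-integrable function stays non-integrable under
  the substitution, and both integrals are then 0 by convention.\<close>

lemma integral_lborel_affine:
  fixes f :: "R2 \<Rightarrow> 'b::{banach, second_countable_topology}"
  assumes c: "c \<noteq> 0"
  shows "(LINT x|lborel. f (t + c *\<^sub>R x)) = (1 / c\<^sup>2) *\<^sub>R (LINT x|lborel. f x)"
proof (cases "integrable lborel f")
  case True
  then have [measurable]: "f \<in> borel_measurable borel" by auto
  have "(LINT x|lborel. f x) = c\<^sup>2 *\<^sub>R (LINT x|lborel. f (t + c *\<^sub>R x))"
    by (subst lborel_affine[OF c, of t])
       (use True integrable_lborel_affine[OF True c, of t] in \<open>simp add: integral_density integral_distr\<close>)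
  then show ?thesis using c by simp
next
  case False
  then show ?thesis by (simp add: integrable_lborel_affine_iff[OF c] not_integrable_integral_eq)
qed

lemma integral_lborel_translation:
  fixes f :: "R2 \<Rightarrow> 'b::{banach, second_countable_topology}"
  shows "(LINT x|lborel. f (x + t)) = (LINT x|lborel. f x)"
  using integral_lborel_affine[of 1 f t] by (simp add: add.commute)

lemma integrable_lborel_translation:
  fixes f :: "R2 \<Rightarrow> 'b::{banach, second_countable_topology}"
  shows "integrable lborel (\<lambda>x. f (x + t)) \<longleftrightarrow> integrable lborel f"
  using integrable_lborel_affine_iff[of 1 f t] by (simp add: add.commute)

lemma nn_integral_lborel_translation:
  fixes f :: "R2 \<Rightarrow> ennreal"
  assumes "f \<in> borel_measurable borel"
  shows "(\<integral>\<^sup>+x. f (x + t) \<partial>lborel) = (\<integral>\<^sup>+x. f x \<partial>lborel)"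
  using nn_integral_lborel_affine[OF assms, of 1 t] by (simp add: add.commute)

text \<open>The integrability condition is in iterated form with \<open>t\<close> outermost, because
  in the applications \<open>t\<close> is a shift or a time, and the integral over the plane is easy
  to bound for each fixed \<open>t\<close>.\<close>

lemma Fubini_norm_eq:
  fixes k :: "'a::euclidean_space \<Rightarrow> 'b::euclidean_space \<Rightarrow> 'c::{banach, second_countable_topology}"
  assumes [measurable]: "case_prod k \<in> borel_measurable (lborel \<Otimes>\<^sub>M lborel)"
    and fin: "(\<integral>\<^sup>+t. \<integral>\<^sup>+x. norm (k t x) \<partial>lborel \<partial>lborel) < \<infinity>"
  shows "(LINT x|lborel. LINT t|lborel. k t x) = (LINT t|lborel. LINT x|lborel. k t x)"
proof -
  have "integrable (lborel \<Otimes>\<^sub>M lborel) (case_prod k)"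
  proof (rule integrableI_bounded)
    have "(\<integral>\<^sup>+z. norm (case_prod k z) \<partial>(lborel \<Otimes>\<^sub>M lborel)) = (\<integral>\<^sup>+t. \<integral>\<^sup>+x. norm (k t x) \<partial>lborel \<partial>lborel)"
      by (subst lborel.nn_integral_fst[symmetric]) auto
    with fin show "(\<integral>\<^sup>+z. norm (case_prod k z) \<partial>(lborel \<Otimes>\<^sub>M lborel)) < \<infinity>" by simp
  qed simp
  then show ?thesis by (rule lborel_pair.Fubini_integral)
qed

lemma integrable_continuous_bounded_support:
  fixes f :: "R2 \<Rightarrow> complex"
  assumes "continuous_on UNIV f" "bounded {x. f x \<noteq> 0}"
  shows "integrable lborel f"
proof -
  let ?K = "closure {x. f x \<noteq> 0}"
  have "integrable lborel (\<lambda>x. indicator ?K x *\<^sub>R f x)"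
    using assms by (intro borel_integrable_compact) (auto simp: compact_closure intro: continuous_on_subset)
  moreover have "indicator ?K x *\<^sub>R f x = f x" for x
    using closure_subset[of "{x. f x \<noteq> 0}"] by (auto simp: indicator_def)
  ultimately show ?thesis by simp
qed

lemma partial_has_vector_derivative:
  assumes "f differentiable at (x + t *\<^sub>R axis i 1)"
  shows "((\<lambda>t. f (x + t *\<^sub>R axis i 1)) has_vector_derivative partial i f (x + t *\<^sub>R axis i 1)) (at t within A)"
proof -
  have "((\<lambda>t. x + t *\<^sub>R axis i 1) has_vector_derivative axis i 1) (at t within A)"
    by (auto intro!: derivative_eq_intros)
  from vector_derivative_diff_chain_within[OF this has_derivative_at_withinI[OF assms[unfolded frechet_derivative_works]]]
  show ?thesis by (simp add: o_def partial_def)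
qed

lemma integral_partial_line:
  assumes "\<And>x. f differentiable at x" "continuous_on UNIV (partial i f)" "0 \<le> a"
  shows "(LINT t|lborel. indicator {0..a} t *\<^sub>R partial i f (x + t *\<^sub>R axis i 1))
    = f (x + a *\<^sub>R axis i 1) - f x"
  using assms
  by (subst integral_FTC_atLeastAtMost[where F="\<lambda>t. f (x + t *\<^sub>R axis i 1)"])
     (auto intro!: partial_has_vector_derivative continuous_on_compose2[OF assms(2)] continuous_intros)

text \<open>The integral of \<open>f (x + e\<^sub>i) - f x\<close> vanishes by translation invariance, and this
  difference is the integral of the partial derivative along a segment.\<close>

lemma integral_partial_eq_0:
  assumes diff: "\<And>x. f differentiable at x" and cont: "continuous_on UNIV (partial i f)"
    and bdd: "bounded {x. f x \<noteq> 0}" "bounded {x. partial i f x \<noteq> 0}"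
  shows "(LINT x|lborel. partial i f x) = 0"
proof -
  have f: "integrable lborel f"
    using diff bdd by (intro integrable_continuous_bounded_support)
      (auto simp: continuous_on_eq_continuous_within differentiable_imp_continuous_within)
  have g: "integrable lborel (partial i f)"
    using cont bdd by (intro integrable_continuous_bounded_support)
  have [measurable]: "partial i f \<in> borel_measurable borel" using g by auto
  let ?k = "\<lambda>t x. indicator {0..1::real} t *\<^sub>R partial i f (x + t *\<^sub>R axis i 1)"
  have "(\<integral>\<^sup>+t. \<integral>\<^sup>+x. norm (?k t x) \<partial>lborel \<partial>lborel)
      = (\<integral>\<^sup>+t. indicator {0..1} t * (\<integral>\<^sup>+x. norm (partial i f (x + t *\<^sub>R axis i 1)) \<partial>lborel) \<partial>lborel)"
    by (auto intro!: nn_integral_cong split: split_indicator)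
  also have "\<dots> = (\<integral>\<^sup>+x. norm (partial i f x) \<partial>lborel)"
    by (subst nn_integral_lborel_translation[where f="\<lambda>x. ennreal (norm (partial i f x))"])
       (auto simp: nn_integral_multc)
  also have "\<dots> < \<infinity>" using g by (simp add: integrable_iff_bounded)
  finally have "(LINT x|lborel. LINT t|lborel. ?k t x) = (LINT t|lborel. LINT x|lborel. ?k t x)"
    by (intro Fubini_norm_eq) auto
  also have "(LINT x|lborel. LINT t|lborel. ?k t x) = (LINT x|lborel. f (x + axis i 1) - f x)"
    by (subst integral_partial_line[OF diff cont]) auto
  also have "\<dots> = 0"
    using f by (subst Bochner_Integration.integral_diff)
      (auto simp: integrable_lborel_translation integral_lborel_translation)
  also have "(LINT t|lborel. LINT x|lborel. ?k t x)
      = (LINT t|lborel. indicator {0..1::real} t *\<^sub>R (LINT x|lborel. partial i f x))"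
    by (simp add: integral_lborel_translation)
  finally show ?thesis by simp
qed

section \<open>Square-integrable functions and integration by parts\<close>

lemma Lp2_iff: "u \<in> Lp 2 \<longleftrightarrow> u \<in> borel_measurable borel \<and> integrable lborel (\<lambda>x. (norm (u x))\<^sup>2)"
  by (simp add: Lp_def)

lemma lp_norm_powr: "p > 0 \<Longrightarrow> lp_norm p u powr p = (LINT x|lborel. norm (u x) powr p)"
  by (simp add: lp_norm_def powr_powr)

lemma lp_norm_sq: "(lp_norm 2 u)\<^sup>2 = (LINT x|lborel. (norm (u x))\<^sup>2)"
  using lp_norm_powr[of 2 u] by (simp add: lp_norm_def)

lemma Lp2_measurable [measurable_dest]: "u \<in> Lp 2 \<Longrightarrow> u \<in> borel_measurable borel"
  by (simp add: Lp2_iff)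

lemma Lp2_integrable_mult:
  assumes "u \<in> Lp 2" "v \<in> Lp 2"
  shows "integrable lborel (\<lambda>x. u x * v x)"
proof (rule Bochner_Integration.integrable_bound)
  show "integrable lborel (\<lambda>x. (norm (u x))\<^sup>2 + (norm (v x))\<^sup>2)"
    using assms by (simp add: Lp2_iff)
  have "norm (u x) * norm (v x) \<le> (norm (u x))\<^sup>2 + (norm (v x))\<^sup>2" for x
    using sum_squares_bound[of "norm (u x)" "norm (v x)"] 
      mult_nonneg_nonneg[of "norm (u x)" "norm (v x)"] by (simp del: mult_nonneg_nonneg)
  then show "AE x in lborel. norm (u x * v x) \<le> norm ((norm (u x))\<^sup>2 + (norm (v x))\<^sup>2)"
    by (simp add: norm_mult)
qed (use assms in measurable)

lemma Lp2_cmult: "u \<in> Lp 2 \<Longrightarrow> (\<lambda>x. c * u x) \<in> Lp 2"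
  unfolding Lp2_iff
  by (intro conjI borel_measurable_times) (simp_all add: norm_mult power_mult_distrib)

lemma Lp2_add:
  assumes "u \<in> Lp 2" "v \<in> Lp 2"
  shows "(\<lambda>x. u x + v x) \<in> Lp 2"
  unfolding Lp2_iff
proof
  show "integrable lborel (\<lambda>x. (norm (u x + v x))\<^sup>2)"
  proof (rule Bochner_Integration.integrable_bound)
    show "integrable lborel (\<lambda>x. 2 * (norm (u x))\<^sup>2 + 2 * (norm (v x))\<^sup>2)"
      using assms by (simp add: Lp2_iff)
    have "(norm (u x + v x))\<^sup>2 \<le> 2 * (norm (u x))\<^sup>2 + 2 * (norm (v x))\<^sup>2" for x
      using power_mono[OF norm_triangle_ineq[of "u x" "v x"], of 2]
        sum_squares_bound[of "norm (u x)" "norm (v x)"] by (simp add: power2_sum)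
    then show "AE x in lborel. norm ((norm (u x + v x))\<^sup>2) \<le> norm (2 * (norm (u x))\<^sup>2 + 2 * (norm (v x))\<^sup>2)"
      by simp
  qed (use assms in measurable)
qed (use assms in measurable)

lemma Lp2_diff: "u \<in> Lp 2 \<Longrightarrow> v \<in> Lp 2 \<Longrightarrow> (\<lambda>x. u x - v x) \<in> Lp 2"
  using Lp2_add[OF _ Lp2_cmult[of v "-1"], of u] by simp

lemma Lp2_affine:
  assumes "u \<in> Lp 2" "c \<noteq> 0"
  shows "(\<lambda>x. u (t + c *\<^sub>R x)) \<in> Lp 2"
  using assms integrable_lborel_affine_iff[of c "\<lambda>x. (norm (u x))\<^sup>2" t] by (auto simp: Lp2_iff)

lemma Lp2_bounded_support:
  fixes f :: "R2 \<Rightarrow> complex"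
  assumes "continuous_on UNIV f" "bounded {x. f x \<noteq> 0}"
  shows "f \<in> Lp 2"
proof -
  have "integrable lborel (\<lambda>x. f x * cnj (f x))"
    using assms by (intro integrable_continuous_bounded_support) (auto intro!: continuous_intros)
  then have "integrable lborel (\<lambda>x. norm (f x * cnj (f x)))" by (rule integrable_norm)
  with assms show ?thesis
    by (simp add: Lp2_iff norm_mult power2_eq_square borel_measurable_continuous_onI)
qed

lemma test_fun_Lp2: "\<psi> \<in> test_fun \<Longrightarrow> \<psi> \<in> Lp 2"
  by (intro Lp2_bounded_support test_fun_continuous test_fun_bounded)

lemma test_fun_integrable: "\<psi> \<in> test_fun \<Longrightarrow> integrable lborel \<psi>"
  by (intro integrable_continuous_bounded_support test_fun_continuous test_fun_bounded)

text \<open>The product of \<open>f\<close> and \<open>\<psi>\<close> has bounded support even when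
  \<open>f\<close> has not; this admits the heat kernel as \<open>f\<close>.\<close>

lemma integral_by_parts_test_fun:
  assumes f: "\<And>x. f differentiable at x" "continuous_on UNIV (partial i f)" and \<psi>: "\<psi> \<in> test_fun"
  shows "(LINT x|lborel. f x * partial i \<psi> x) = - (LINT x|lborel. partial i f x * \<psi> x)"
proof -
  have cf: "continuous_on UNIV f"
    using f(1) by (simp add: continuous_on_eq_continuous_within differentiable_imp_continuous_within)
  note p\<psi> = test_fun_partial[OF \<psi>, of i]
  have pm: "partial i (\<lambda>x. f x * \<psi> x) = (\<lambda>x. f x * partial i \<psi> x + partial i f x * \<psi> x)"
    by (rule partial_mult[OF f(1) test_fun_differentiable[OF \<psi>]])
  have b: "bounded {x. g x * \<eta> x \<noteq> 0}" if "\<eta> \<in> test_fun" for g :: "R2 \<Rightarrow> complex" and \<eta>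
    by (rule bounded_subset[OF test_fun_bounded[OF that]]) auto
  have c: "continuous_on UNIV (\<lambda>x. f x * partial i \<psi> x)" "continuous_on UNIV (\<lambda>x. partial i f x * \<psi> x)"
    using cf f(2) test_fun_continuous[OF \<psi>] test_fun_continuous[OF p\<psi>] by (auto intro: continuous_on_mult)
  have "0 = (LINT x|lborel. partial i (\<lambda>x. f x * \<psi> x) x)"
  proof (rule integral_partial_eq_0[symmetric])
    show "continuous_on UNIV (partial i (\<lambda>x. f x * \<psi> x))"
      unfolding pm using c by (rule continuous_on_add)
    have "{x. partial i (\<lambda>x. f x * \<psi> x) x \<noteq> 0} \<subseteq> {x. f x * partial i \<psi> x \<noteq> 0} \<union> {x. partial i f x * \<psi> x \<noteq> 0}"
      unfolding pm by auto
    then show "bounded {x. partial i (\<lambda>x. f x * \<psi> x) x \<noteq> 0}"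
      using b[OF \<psi>] b[OF p\<psi>] bounded_subset bounded_Un by blast
  qed (use f(1) test_fun_differentiable[OF \<psi>] b[OF \<psi>] in \<open>auto intro: differentiable_mult\<close>)
  also have "\<dots> = (LINT x|lborel. f x * partial i \<psi> x) + (LINT x|lborel. partial i f x * \<psi> x)"
    unfolding pm using c b[OF \<psi>] b[OF p\<psi>]
    by (intro Bochner_Integration.integral_add integrable_continuous_bounded_support)
  finally show ?thesis by (simp add: eq_neg_iff_add_eq_0)
qed

lemma test_fun_has_weak_partial: "\<eta> \<in> test_fun \<Longrightarrow> has_weak_partial i \<eta> (partial i \<eta>)"
  unfolding has_weak_partial_def
  by (intro ballI integral_by_parts_test_fun test_fun_differentiable test_fun_continuous[OF test_fun_partial])

text \<open>\<open>ennreal (f x)\<close> sees only the positive part, so the hypothesis says that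
  the finite measures with densities f+ and f- agree on open boxes. An intersection-stable generator
  determines them, hence f+ = f- almost everywhere; as one of the two is always 0, both
  vanish.\<close>

lemma AE_zero_if_box_integrals_zero:
  fixes f :: "R2 \<Rightarrow> real"
  assumes f: "integrable lborel f" and box: "\<And>a b. (LINT x|lborel. f x * indicator (box a b) x) = 0"
  shows "AE x in lborel. f x = 0"
proof -
  have [measurable]: "f \<in> borel_measurable borel" using f by auto
  have fin: "(\<integral>\<^sup>+x. ennreal (f x) \<partial>lborel) \<noteq> \<infinity>" "(\<integral>\<^sup>+x. ennreal (- f x) \<partial>lborel) \<noteq> \<infinity>"
    using f unfolding real_integrable_def by auto
  have "density lborel (\<lambda>x. ennreal (f x)) = density lborel (\<lambda>x. ennreal (- f x))" (is "?M = ?N")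
  proof (rule measure_eqI_generator_eq)
    let ?E = "range (\<lambda>(a, b). box a b::R2 set)"
    let ?A = "\<lambda>n::nat. box (- (real n *\<^sub>R One)) (real n *\<^sub>R One) :: R2 set"
    show "Int_stable ?E"
      by (auto simp: Int_stable_def box_Int_box)
    show "?E \<subseteq> Pow UNIV" "sets ?M = sigma_sets UNIV ?E" "sets ?N = sigma_sets UNIV ?E"
      by (simp_all add: borel_eq_box)
    show "range ?A \<subseteq> ?E" "(\<Union>i. ?A i) = UNIV"
      unfolding UN_box_eq_UNIV by auto
    have "emeasure ?M X \<le> (\<integral>\<^sup>+x. ennreal (f x) \<partial>lborel)" if "X \<in> sets lborel" for X
      using that by (auto simp: emeasure_density intro!: nn_integral_mono split: split_indicator)
    with fin show "emeasure ?M (?A i) \<noteq> \<infinity>" for i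
      by (metis infinity_ennreal_def neq_top_trans sets_lborel borel_open open_box)
    show "emeasure ?M X = emeasure ?N X" if X: "X \<in> ?E" for X
    proof -
      from X have [measurable]: "X \<in> sets borel" by auto
      have int: "integrable lborel (\<lambda>x. f x * indicator X x)"
        using f by (rule integrable_real_mult_indicator[rotated]) simp
      have fin: "(\<integral>\<^sup>+x. ennreal (f x * indicator X x) \<partial>lborel) \<noteq> \<infinity>"
        "(\<integral>\<^sup>+x. ennreal (- (f x * indicator X x)) \<partial>lborel) \<noteq> \<infinity>"
        using int unfolding real_integrable_def by auto
      have "(LINT x|lborel. f x * indicator X x) = 0" using box X by auto
      then have "enn2real (\<integral>\<^sup>+x. ennreal (f x * indicator X x) \<partial>lborel)
          = enn2real (\<integral>\<^sup>+x. ennreal (- (f x * indicator X x)) \<partial>lborel)"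
        unfolding real_lebesgue_integral_def[OF int] by simp
      then have "ennreal (enn2real (\<integral>\<^sup>+x. ennreal (f x * indicator X x) \<partial>lborel))
          = ennreal (enn2real (\<integral>\<^sup>+x. ennreal (- (f x * indicator X x)) \<partial>lborel))"
        by (rule arg_cong)
      then have "(\<integral>\<^sup>+x. ennreal (f x * indicator X x) \<partial>lborel)
          = (\<integral>\<^sup>+x. ennreal (- (f x * indicator X x)) \<partial>lborel)"
        using fin by (simp only: ennreal_enn2real_if infinity_ennreal_def if_False)
      moreover have "(\<integral>\<^sup>+x. ennreal (f x * indicator X x) \<partial>lborel) = emeasure ?M X"
        by (auto simp: emeasure_density intro!: nn_integral_cong split: split_indicator)
      moreover have "(\<integral>\<^sup>+x. ennreal (- (f x * indicator X x)) \<partial>lborel) = emeasure ?N X"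
        by (auto simp: emeasure_density intro!: nn_integral_cong split: split_indicator)
      ultimately show ?thesis by simp
    qed
  qed
  then have "AE x in lborel. ennreal (f x) = ennreal (- f x)"
    using fin by (subst (asm) finite_density_unique) auto
  then show ?thesis
    by eventually_elim (metis ennreal_eq_0_iff ennreal_inj linear neg_0_le_iff_le neg_le_0_iff_le order_antisym)
qed

text \<open>The bumps with parameter 1/(n + 1) converge to the indicator of the box. They are
  dominated by that indicator, and |g| is integrable over the box because g is in L^2 and the box
  has finite measure.\<close>

lemma test_fun_box_integral:
  assumes g: "g \<in> Lp 2" and test: "\<And>\<psi>. \<psi> \<in> test_fun \<Longrightarrow> (LINT x|lborel. g x * \<psi> x) = 0"
  shows "(LINT x|lborel. g x * indicator (box a b) x) = 0"
    and "integrable lborel (\<lambda>x. g x * indicator (box a b) x)"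
proof -
  have [measurable]: "g \<in> borel_measurable borel" using g by measurable
  have "(\<lambda>x. indicator (box a b) x :: complex) \<in> Lp 2"
  proof -
    have "(norm (indicator (box a b) x :: complex))\<^sup>2 = indicator (box a b) x" for x
      by (simp add: indicator_def)
    moreover have "integrable lborel (indicat_real (box a b))"
      by (intro integrable_real_indicator emeasure_lborel_box_finite) simp
    ultimately show ?thesis by (simp add: Lp2_iff)
  qed
  from Lp2_integrable_mult[OF g this]
  show int: "integrable lborel (\<lambda>x. g x * indicator (box a b) x)" .
  have "(\<lambda>n. LINT x|lborel. g x * bump (1 / Suc n) a b x) \<longlonglongrightarrow> (LINT x|lborel. g x * indicator (box a b) x)"
  proof (rule integral_dominated_convergence)
    show "integrable lborel (\<lambda>x. norm (g x * indicator (box a b) x))"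
      using int by (rule integrable_norm)
    have "norm (bump (1 / Suc n) a b x) \<le> norm (indicator (box a b) x :: complex)" for n x
      using bump_norm_le[of "1 / Suc n" a b x] by (cases "x \<in> box a b") simp_all
    then show "AE x in lborel. norm (g x * bump (1 / Suc n) a b x) \<le> norm (g x * indicator (box a b) x)" for n
      unfolding norm_mult by (intro always_eventually allI mult_left_mono norm_ge_zero)
    show "(\<lambda>x. g x * indicator (box a b) x) \<in> borel_measurable lborel"
      using int by (rule borel_measurable_integrable)
    show "(\<lambda>x. g x * bump (1 / Suc n) a b x) \<in> borel_measurable lborel" for n
      using Lp2_integrable_mult[OF g test_fun_Lp2[OF bump_test_fun]] by (intro borel_measurable_integrable) simp
  qed (intro always_eventually allI tendsto_mult tendsto_const bump_tendsto)
  then show "(LINT x|lborel. g x * indicator (box a b) x) = 0"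
    by (simp add: test[OF bump_test_fun] LIMSEQ_const_iff)
qed

lemma AE_zero_if_test_integrals_zero:
  assumes g: "g \<in> Lp 2" and test: "\<And>\<psi>. \<psi> \<in> test_fun \<Longrightarrow> (LINT x|lborel. g x * \<psi> x) = 0"
  shows "AE x in lborel. g x = 0"
proof -
  \<comment> \<open>A function in L^2 may fail to be integrable over the plane, so the criterion is
    applied to its restrictions to boxes that exhaust the plane, separately to real and imaginary
    parts.\<close>
  let ?B = "\<lambda>n::nat. box (- (real n *\<^sub>R One)) (real n *\<^sub>R One) :: R2 set"
  note * = test_fun_box_integral[OF g test]
  have B: "(LINT x|lborel. g x * indicator (?B n) x * indicator (box a b) x) = 0" for n a b
    using *(1)[of ] unfolding mult.assoc indicator_inter_arith[symmetric] box_Int_box by auto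
  have int: "integrable lborel (\<lambda>x. g x * indicator (?B n) x)"
    "integrable lborel (\<lambda>x. g x * indicator (?B n) x * indicator (box a b) x)" for n a b
    using *(2)[of ] unfolding mult.assoc indicator_inter_arith[symmetric] box_Int_box by auto
  have ind: "Re (z * indicator X x) = Re z * indicator X x" "Im (z * indicator X x) = Im z * indicator X x" for z X and x :: R2
    by (auto simp: indicator_def)
  have "AE x in lborel. Re (g x * indicator (?B n) x) = 0" for n
  proof (rule AE_zero_if_box_integrals_zero)
    show "integrable lborel (\<lambda>x. Re (g x * indicator (?B n) x))"
      using int(1) by (rule integrable_Re)
    show "(LINT x|lborel. Re (g x * indicator (?B n) x) * indicator (box a b) x) = 0" for a b
      using integral_Re[OF int(2)[of n a b]] unfolding B ind by simp
  qed
  moreover have "AE x in lborel. Im (g x * indicator (?B n) x) = 0" for n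
  proof (rule AE_zero_if_box_integrals_zero)
    show "integrable lborel (\<lambda>x. Im (g x * indicator (?B n) x))"
      using int(1) by (rule integrable_Im)
    show "(LINT x|lborel. Im (g x * indicator (?B n) x) * indicator (box a b) x) = 0" for a b
      using integral_Im[OF int(2)[of n a b]] unfolding B ind by simp
  qed
  ultimately have "AE x in lborel. \<forall>n. Re (g x * indicator (?B n) x) = 0 \<and> Im (g x * indicator (?B n) x) = 0"
    by (simp add: AE_all_countable)
  then show ?thesis
  proof eventually_elim
    fix x assume *: "\<forall>n. Re (g x * indicator (?B n) x) = 0 \<and> Im (g x * indicator (?B n) x) = 0"
    obtain n where "x \<in> ?B n" using UN_box_eq_UNIV[where ?'a=R2] by blast
    with *[rule_format, of n] show "g x = 0" by (simp add: complex_eq_iff)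
  qed
qed

section \<open>Weak derivatives and the Sobolev space\<close>

lemma weak_partial_unique:
  assumes "g \<in> Lp 2" "h \<in> Lp 2" "has_weak_partial i u g" "has_weak_partial i u h"
  shows "AE x in lborel. g x = h x"
proof -
  have "AE x in lborel. g x - h x = 0"
  proof (rule AE_zero_if_test_integrals_zero)
    show "(\<lambda>x. g x - h x) \<in> Lp 2" using assms by (intro Lp2_diff)
    show "(LINT x|lborel. (g x - h x) * \<psi> x) = 0" if "\<psi> \<in> test_fun" for \<psi>
      using assms that Lp2_integrable_mult[OF _ test_fun_Lp2[OF that]]
      by (auto simp: has_weak_partial_def left_diff_distrib)
  qed
  then show ?thesis by simp
qed

lemma H1_weak_partial:
  assumes "u \<in> H1"
  shows weak_partial_Lp2: "weak_partial i u \<in> Lp 2"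
    and has_weak_partial_weak_partial: "has_weak_partial i u (weak_partial i u)"
proof -
  have "\<exists>g. g \<in> Lp 2 \<and> has_weak_partial i u g" using assms by (auto simp: H1_def)
  from someI_ex[OF this] show "weak_partial i u \<in> Lp 2" "has_weak_partial i u (weak_partial i u)"
    by (auto simp: weak_partial_def)
qed

lemma H1_Lp2: "u \<in> H1 \<Longrightarrow> u \<in> Lp 2"
  by (simp add: H1_def)

lemma H1I: "u \<in> Lp 2 \<Longrightarrow> (\<And>i. g i \<in> Lp 2) \<Longrightarrow> (\<And>i. has_weak_partial i u (g i)) \<Longrightarrow> u \<in> H1"
  by (auto simp: H1_def)

text \<open>\<open>grad_norm\<close> goes through a choice of weak derivatives; by their uniqueness
  almost everywhere, any explicit ones compute it.\<close>

lemma grad_norm_sq: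
  assumes u: "u \<in> Lp 2" and g: "\<And>i. g i \<in> Lp 2" "\<And>i. has_weak_partial i u (g i)"
  shows "(grad_norm u)\<^sup>2 = (\<Sum>i\<in>UNIV. LINT x|lborel. (norm (g i x))\<^sup>2)"
proof -
  have H: "u \<in> H1" using assms by (rule H1I)
  have "(LINT x|lborel. (norm (weak_partial i u x))\<^sup>2) = (LINT x|lborel. (norm (g i x))\<^sup>2)" for i
  proof (rule integral_cong_AE)
    show "AE x in lborel. (norm (weak_partial i u x))\<^sup>2 = (norm (g i x))\<^sup>2"
      using weak_partial_unique[OF weak_partial_Lp2[OF H] g(1) has_weak_partial_weak_partial[OF H] g(2), of i]
      by eventually_elim simp
  qed (use weak_partial_Lp2[OF H, of i] g(1)[of i] in measurable)
  moreover have "0 \<le> (\<Sum>i\<in>UNIV. (lp_norm 2 (weak_partial i u))\<^sup>2)" by (simp add: sum_nonneg)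
  ultimately show ?thesis by (simp add: grad_norm_def lp_norm_sq)
qed

lemma has_weak_partial_lincomb:
  assumes "u \<in> Lp 2" "v \<in> Lp 2" "g \<in> Lp 2" "h \<in> Lp 2"
    "has_weak_partial i u g" "has_weak_partial i v h"
  shows "has_weak_partial i (\<lambda>x. u x + c * v x) (\<lambda>x. g x + c * h x)"
  unfolding has_weak_partial_def
proof
  fix \<psi> assume \<psi>: "\<psi> \<in> test_fun"
  have lin: "(LINT x|lborel. (f x + c * h x) * \<eta> x) = (LINT x|lborel. f x * \<eta> x) + c * (LINT x|lborel. h x * \<eta> x)"
    if "f \<in> Lp 2" "h \<in> Lp 2" "\<eta> \<in> test_fun" for f h \<eta>
  proof -
    have "integrable lborel (\<lambda>x. f x * \<eta> x)" "integrable lborel (\<lambda>x. c * (h x * \<eta> x))"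
      using that by (auto intro!: Lp2_integrable_mult integrable_mult_right test_fun_Lp2)
    then show ?thesis
      by (simp only: distrib_right mult.assoc Bochner_Integration.integral_add integral_mult_right_zero)
  qed
  have "(LINT x|lborel. (u x + c * v x) * partial i \<psi> x)
      = (LINT x|lborel. u x * partial i \<psi> x) + c * (LINT x|lborel. v x * partial i \<psi> x)"
    using assms \<psi> by (intro lin test_fun_partial)
  also have "\<dots> = - ((LINT x|lborel. g x * \<psi> x) + c * (LINT x|lborel. h x * \<psi> x))"
    using assms(5,6) \<psi> by (simp add: has_weak_partial_def)
  also have "(LINT x|lborel. g x * \<psi> x) + c * (LINT x|lborel. h x * \<psi> x) = (LINT x|lborel. (g x + c * h x) * \<psi> x)"
    using assms \<psi> by (intro lin[symmetric])
  finally show "(LINT x|lborel. (u x + c * v x) * partial i \<psi> x) = - (LINT x|lborel. (g x + c * h x) * \<psi> x)" .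
qed

lemma H1_lincomb:
  assumes "u \<in> H1" "v \<in> H1"
  shows "(\<lambda>x. u x + c * v x) \<in> H1"
  using H1_Lp2[OF assms(1)] H1_Lp2[OF assms(2)]
    H1_weak_partial[OF assms(1)] H1_weak_partial[OF assms(2)]
  by (intro H1I[where g="\<lambda>i x. weak_partial i u x + c * weak_partial i v x"] Lp2_add Lp2_cmult
      has_weak_partial_lincomb)

lemma zero_in_H1: "(\<lambda>_. 0) \<in> H1"
  by (rule H1I[where g="\<lambda>_ _. 0"]) (auto simp: Lp2_iff has_weak_partial_def)

lemma H1_cmult: "u \<in> H1 \<Longrightarrow> (\<lambda>x. c * u x) \<in> H1"
  using H1_lincomb[OF zero_in_H1, of u c] by simp

lemma test_fun_H1: "\<psi> \<in> test_fun \<Longrightarrow> \<psi> \<in> H1"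
  by (rule H1I[where g="\<lambda>i. partial i \<psi>"])
    (auto intro: test_fun_Lp2 test_fun_partial test_fun_has_weak_partial)

lemma has_weak_partial_scale:
  fixes a :: complex and b :: real
  assumes "has_weak_partial i u g" "b > 0"
  shows "has_weak_partial i (\<lambda>x. a * u (b *\<^sub>R x)) (\<lambda>x. a * of_real b * g (b *\<^sub>R x))"
  unfolding has_weak_partial_def
proof
  fix \<psi> assume \<psi>: "\<psi> \<in> test_fun"
  \<comment> \<open>The inverse dilation moves the scaling to the test function; the change of
    variables is then undone, so its Jacobian cancels.\<close>
  let ?\<psi> = "\<lambda>x. \<psi> (0 + (1 / b) *\<^sub>R x)"
  have t: "?\<psi> \<in> test_fun" using \<psi> assms(2) by (intro test_fun_affine) auto
  have p: "partial i ?\<psi> = (\<lambda>x. (1 / b) *\<^sub>R partial i \<psi> (0 + (1 / b) *\<^sub>R x))"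
    by (rule partial_affine[OF test_fun_differentiable[OF \<psi>]])
  have "(LINT x|lborel. a * u (b *\<^sub>R x) * partial i \<psi> x)
      = (LINT x|lborel. (\<lambda>y. a * of_real b * (u y * partial i ?\<psi> y)) (0 + b *\<^sub>R x))"
    using assms(2) by (intro Bochner_Integration.integral_cong) (simp_all add: p[simplified] scaleR_conv_of_real[where ?'a = complex])
  also have "\<dots> = (1 / b\<^sup>2) *\<^sub>R (LINT x|lborel. a * of_real b * (u x * partial i ?\<psi> x))"
    using assms(2) by (intro integral_lborel_affine) auto
  also have "\<dots> = - ((1 / b\<^sup>2) *\<^sub>R (LINT x|lborel. a * of_real b * (g x * ?\<psi> x)))"
    using assms(1) t by (simp only: has_weak_partial_def integral_mult_right_zero) simp
  also have "(1 / b\<^sup>2) *\<^sub>R (LINT x|lborel. a * of_real b * (g x * ?\<psi> x))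
      = (LINT x|lborel. (\<lambda>y. a * of_real b * (g y * ?\<psi> y)) (0 + b *\<^sub>R x))"
    using assms(2) by (intro integral_lborel_affine[symmetric]) auto
  also have "\<dots> = (LINT x|lborel. a * of_real b * g (b *\<^sub>R x) * \<psi> x)"
    using assms(2) by (intro Bochner_Integration.integral_cong) auto
  finally show "(LINT x|lborel. a * u (b *\<^sub>R x) * partial i \<psi> x)
      = - (LINT x|lborel. a * of_real b * g (b *\<^sub>R x) * \<psi> x)" .
qed

section \<open>Increments of weakly differentiable functions\<close>

lemma swap_translation_integral:
  fixes e :: R2
  assumes g: "g \<in> Lp 2" and \<psi>: "\<psi> \<in> Lp 2" and a: "a \<ge> 0"
  shows "(LINT x|lborel. (LINT t|lborel. indicator {0..a} t *\<^sub>R g (x + t *\<^sub>R e)) * \<psi> x)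
    = (LINT t|lborel. indicator {0..a} t *\<^sub>R (LINT x|lborel. g (x + t *\<^sub>R e) * \<psi> x))"
proof -
  have [measurable]: "g \<in> borel_measurable borel" "\<psi> \<in> borel_measurable borel"
    using g \<psi> by measurable
  let ?k = "\<lambda>t x. indicator {0..a} t *\<^sub>R (g (x + t *\<^sub>R e) * \<psi> x)"
  let ?G = "\<integral>\<^sup>+x. ennreal ((norm (g x))\<^sup>2) \<partial>lborel"
  let ?P = "\<integral>\<^sup>+x. ennreal ((norm (\<psi> x))\<^sup>2) \<partial>lborel"
  have fin: "?G < \<infinity>" "?P < \<infinity>"
    using g \<psi> by (auto simp: Lp2_iff integrable_iff_bounded)
  \<comment> \<open>The product of |g| and |\<psi>| is at most |g|^2 + |\<psi>|^2, and shifting g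
    does not change the integral of |g|^2.\<close>
  have "(\<integral>\<^sup>+t. \<integral>\<^sup>+x. norm (?k t x) \<partial>lborel \<partial>lborel) \<le> (\<integral>\<^sup>+t. indicator {0..a} t * (?G + ?P) \<partial>lborel)"
  proof (rule nn_integral_mono)
    fix t
    have AMGM: "norm z * norm w \<le> (norm z)\<^sup>2 + (norm w)\<^sup>2" for z w :: complex
      using sum_squares_bound[of "norm z" "norm w"]
      mult_nonneg_nonneg[of "norm z" "norm w"] by (simp del: mult_nonneg_nonneg)
    have "(\<integral>\<^sup>+x. norm (?k t x) \<partial>lborel) \<le>
        (\<integral>\<^sup>+x. indicator {0..a} t * (ennreal ((norm (g (x + t *\<^sub>R e)))\<^sup>2) + ennreal ((norm (\<psi> x))\<^sup>2)) \<partial>lborel)"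
      by (intro nn_integral_mono)
        (auto simp: norm_mult AMGM simp flip: ennreal_plus split: split_indicator)
    also have "\<dots> = indicator {0..a} t * (?G + ?P)"
      using nn_integral_lborel_translation[of "\<lambda>x. ennreal ((norm (g x))\<^sup>2)" "t *\<^sub>R e"]
      by (simp add: nn_integral_cmult nn_integral_add)
    finally show "(\<integral>\<^sup>+x. norm (?k t x) \<partial>lborel) \<le> indicator {0..a} t * (?G + ?P)" .
  qed
  also have "\<dots> < \<infinity>"
    using fin a by (simp add: nn_integral_multc ennreal_mult_less_top)
  finally have "(LINT x|lborel. LINT t|lborel. ?k t x) = (LINT t|lborel. LINT x|lborel. ?k t x)"
    by (intro Fubini_norm_eq) auto
  moreover have "(LINT t|lborel. indicator {0..a} t *\<^sub>R g (x + t *\<^sub>R e)) * \<psi> x = (LINT t|lborel. ?k t x)" for x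
    by (subst integral_mult_left_zero[symmetric]) (simp add: mult_scaleR_left)
  ultimately show ?thesis by simp
qed

lemma norm_integral_le_nn_integral:
  fixes f :: "'a \<Rightarrow> 'b::{banach, second_countable_topology}"
  shows "ennreal (norm (integral\<^sup>L M f)) \<le> (\<integral>\<^sup>+x. norm (f x) \<partial>M)"
  by (cases "integrable M f") (auto intro: integral_norm_bound_ennreal simp: not_integrable_integral_eq)

text \<open>Cauchy-Schwarz in \<open>t\<close> gives one factor \<open>a\<close>; exchanging the
  integrals and using translation invariance gives the other, as the length of the interval.\<close>

lemma translation_average_sq:
  fixes e :: R2
  assumes g: "g \<in> Lp 2" and a: "a \<ge> 0"
  defines "I \<equiv> \<lambda>x. LINT t|lborel. indicator {0..a} t *\<^sub>R g (x + t *\<^sub>R e)"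
  shows "I \<in> Lp 2"
    and "(\<integral>\<^sup>+x. ennreal ((norm (I x))\<^sup>2) \<partial>lborel) \<le> ennreal (a\<^sup>2) * (\<integral>\<^sup>+x. ennreal ((norm (g x))\<^sup>2) \<partial>lborel)"
proof -
  have [measurable]: "g \<in> borel_measurable borel" using g by measurable
  have Im [measurable]: "I \<in> borel_measurable borel" unfolding I_def by measurable
  have "ennreal ((norm (I x))\<^sup>2) \<le> ennreal a * (\<integral>\<^sup>+t. indicator {0..a} t * ennreal ((norm (g (x + t *\<^sub>R e)))\<^sup>2) \<partial>lborel)" for x
  proof -
    have "ennreal ((norm (I x))\<^sup>2) = (ennreal (norm (I x)))\<^sup>2" by (simp add: ennreal_power)
    also have "\<dots> \<le> (\<integral>\<^sup>+t. norm (indicator {0..a} t *\<^sub>R g (x + t *\<^sub>R e)) \<partial>lborel)\<^sup>2"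
      unfolding I_def by (intro power_mono norm_integral_le_nn_integral) simp
    \<comment> \<open>The indicator is idempotent; written twice, it supplies both factors for
      Cauchy-Schwarz.\<close>
    also have "\<dots> = (\<integral>\<^sup>+t. indicator {0..a} t * (indicator {0..a} t * ennreal (norm (g (x + t *\<^sub>R e)))) \<partial>lborel)\<^sup>2"
      by (intro arg_cong[where f="\<lambda>z. z\<^sup>2"] nn_integral_cong) (auto split: split_indicator)
    also have "\<dots> \<le> (\<integral>\<^sup>+t. (indicator {0..a} t)\<^sup>2 \<partial>lborel) *
        (\<integral>\<^sup>+t. (indicator {0..a} t * ennreal (norm (g (x + t *\<^sub>R e))))\<^sup>2 \<partial>lborel)"
      by (rule Cauchy_Schwarz_nn_integral) measurable
    also have "(\<integral>\<^sup>+t. (indicator {0..a} t)\<^sup>2 \<partial>lborel) = (\<integral>\<^sup>+t. indicator {0..a} t \<partial>lborel)"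
      by (intro nn_integral_cong) (auto split: split_indicator)
    also have "\<dots> = ennreal a" using a by simp
    also have "(\<integral>\<^sup>+t. (indicator {0..a} t * ennreal (norm (g (x + t *\<^sub>R e))))\<^sup>2 \<partial>lborel)
      = (\<integral>\<^sup>+t. indicator {0..a} t * ennreal ((norm (g (x + t *\<^sub>R e)))\<^sup>2) \<partial>lborel)"
      by (intro nn_integral_cong) (auto simp: ennreal_power split: split_indicator)
    finally show ?thesis .
  qed
  then have "(\<integral>\<^sup>+x. ennreal ((norm (I x))\<^sup>2) \<partial>lborel) \<le>
      (\<integral>\<^sup>+x. ennreal a * (\<integral>\<^sup>+t. indicator {0..a} t * ennreal ((norm (g (x + t *\<^sub>R e)))\<^sup>2) \<partial>lborel) \<partial>lborel)"
    by (intro nn_integral_mono) auto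
  also have "\<dots> = ennreal a * (\<integral>\<^sup>+x. \<integral>\<^sup>+t. indicator {0..a} t * ennreal ((norm (g (x + t *\<^sub>R e)))\<^sup>2) \<partial>lborel \<partial>lborel)"
    by (intro nn_integral_cmult) measurable
  also have "(\<integral>\<^sup>+x. \<integral>\<^sup>+t. indicator {0..a} t * ennreal ((norm (g (x + t *\<^sub>R e)))\<^sup>2) \<partial>lborel \<partial>lborel)
      = (\<integral>\<^sup>+t. \<integral>\<^sup>+x. indicator {0..a} t * ennreal ((norm (g (x + t *\<^sub>R e)))\<^sup>2) \<partial>lborel \<partial>lborel)"
    by (intro lborel_pair.Fubini') measurable
  also have "\<dots> = (\<integral>\<^sup>+t. indicator {0..a} t * (\<integral>\<^sup>+x. ennreal ((norm (g x))\<^sup>2) \<partial>lborel) \<partial>lborel)"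
    using nn_integral_lborel_translation[of "\<lambda>x. ennreal ((norm (g x))\<^sup>2)"]
    by (intro nn_integral_cong) (simp add: nn_integral_cmult)
  also have "\<dots> = ennreal a * (\<integral>\<^sup>+x. ennreal ((norm (g x))\<^sup>2) \<partial>lborel)"
    using a by (simp add: nn_integral_multc)
  finally show *: "(\<integral>\<^sup>+x. ennreal ((norm (I x))\<^sup>2) \<partial>lborel) \<le> ennreal (a\<^sup>2) * (\<integral>\<^sup>+x. ennreal ((norm (g x))\<^sup>2) \<partial>lborel)"
    using a by (simp add: power2_eq_square ennreal_mult mult.assoc)
  have "(\<integral>\<^sup>+x. ennreal ((norm (g x))\<^sup>2) \<partial>lborel) < \<infinity>"
    using g by (auto simp: Lp2_iff integrable_iff_bounded)
  then have "ennreal (a\<^sup>2) * (\<integral>\<^sup>+x. ennreal ((norm (g x))\<^sup>2) \<partial>lborel) < \<infinity>"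
    by (simp add: ennreal_mult_less_top)
  with * have "(\<integral>\<^sup>+x. ennreal ((norm (I x))\<^sup>2) \<partial>lborel) < \<infinity>" by (rule le_less_trans)
  then show "I \<in> Lp 2" by (simp add: Lp2_iff integrable_iff_bounded)
qed

text \<open>For almost every x, the increment u x - u (x - a e) is the integral of g along the
  segment between the two points. This is seen by testing: the shifts move to the test function, to
  which the classical fundamental theorem applies.\<close>

lemma translation_estimate_axis:
  assumes u: "u \<in> Lp 2" and g: "g \<in> Lp 2" "has_weak_partial i u g" and a: "a \<ge> 0"
  shows "(\<integral>\<^sup>+x. ennreal ((norm (u (x + a *\<^sub>R axis i 1) - u x))\<^sup>2) \<partial>lborel)
    \<le> ennreal (a\<^sup>2) * (\<integral>\<^sup>+x. ennreal ((norm (g x))\<^sup>2) \<partial>lborel)"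
proof -
  let ?e = "axis i 1 :: R2"
  \<comment> \<open>The segment runs backwards from x, so that after the change of variables the
    test function is shifted forwards, as in \<open>integral_partial_line\<close>.\<close>
  define I where "I = (\<lambda>x. LINT t|lborel. indicator {0..a} t *\<^sub>R g (x + t *\<^sub>R (- ?e)))"
  note I = translation_average_sq(1)[OF g(1) a, of "- ?e", folded I_def]
  have [measurable]: "u \<in> borel_measurable borel" using u by measurable
  have u': "(\<lambda>x. u (x + t)) \<in> Lp 2" for t
    using Lp2_affine[OF u, of 1 t] by (simp add: add.commute)
  have "AE x in lborel. u x - u (x + (- a) *\<^sub>R ?e) - I x = 0"
  proof (rule AE_zero_if_test_integrals_zero)
    show "(\<lambda>x. u x - u (x + (- a) *\<^sub>R ?e) - I x) \<in> Lp 2"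
      by (intro Lp2_diff u u' I)
    fix \<psi> assume \<psi>: "\<psi> \<in> test_fun"
    note \<psi>2 = test_fun_Lp2[OF \<psi>]
    have sh: "(\<lambda>x. \<psi> (x + t)) \<in> test_fun" "partial i (\<lambda>x. \<psi> (x + t)) = (\<lambda>x. partial i \<psi> (x + t))" for t
      using test_fun_affine[OF \<psi>, of 1 t] partial_affine[OF test_fun_differentiable[OF \<psi>], of i t 1]
      by (simp_all add: add.commute)
    have "(LINT x|lborel. I x * \<psi> x)
        = (LINT t|lborel. indicator {0..a} t *\<^sub>R (LINT x|lborel. g (x + t *\<^sub>R (- ?e)) * \<psi> x))"
      unfolding I_def by (rule swap_translation_integral[OF g(1) \<psi>2 a])
    also have "\<dots> = (LINT t|lborel. indicator {0..a} t *\<^sub>R (LINT x|lborel. g x * \<psi> (x + t *\<^sub>R ?e)))"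
    proof -
      have "(LINT x|lborel. g (x + t *\<^sub>R (- ?e)) * \<psi> x) = (LINT x|lborel. g x * \<psi> (x + t *\<^sub>R ?e))" for t
        using integral_lborel_translation[of "\<lambda>x. g x * \<psi> (x + t *\<^sub>R ?e)" "t *\<^sub>R (- ?e)"] by simp
      then show ?thesis by (simp only:)
    qed
    also have "\<dots> = (LINT t|lborel. indicator {0..a} t *\<^sub>R (- (LINT x|lborel. partial i \<psi> (x + t *\<^sub>R ?e) * u x)))"
      using g(2)[unfolded has_weak_partial_def, rule_format, OF sh(1)]
      by (simp add: sh(2) mult.commute)
    also have "\<dots> = - (LINT t|lborel. indicator {0..a} t *\<^sub>R (LINT x|lborel. partial i \<psi> (x + t *\<^sub>R ?e) * u x))"
      by simp
    also have "\<dots> = - (LINT x|lborel. (LINT t|lborel. indicator {0..a} t *\<^sub>R partial i \<psi> (x + t *\<^sub>R ?e)) * u x)"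
      by (subst swap_translation_integral[OF test_fun_Lp2[OF test_fun_partial[OF \<psi>]] u a]) (rule refl)
    also have "\<dots> = - (LINT x|lborel. (\<psi> (x + a *\<^sub>R ?e) - \<psi> x) * u x)"
      using \<psi> test_fun_partial[OF \<psi>] a
      by (subst integral_partial_line) (auto intro: test_fun_differentiable test_fun_continuous)
    also have "\<dots> = (LINT x|lborel. u x * \<psi> x) - (LINT x|lborel. u x * \<psi> (x + a *\<^sub>R ?e))"
      using Lp2_integrable_mult[OF \<psi>2 u] Lp2_integrable_mult[OF test_fun_Lp2[OF sh(1)] u, of "a *\<^sub>R ?e"]
      by (simp add: left_diff_distrib mult.commute[of "u _"])
    also have "(LINT x|lborel. u x * \<psi> (x + a *\<^sub>R ?e)) = (LINT x|lborel. u (x + (- a) *\<^sub>R ?e) * \<psi> x)"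
      using integral_lborel_translation[of "\<lambda>x. u x * \<psi> (x + a *\<^sub>R ?e)" "(- a) *\<^sub>R ?e"] by simp
    finally show "(LINT x|lborel. (u x - u (x + (- a) *\<^sub>R ?e) - I x) * \<psi> x) = 0"
      using Lp2_integrable_mult[OF u \<psi>2] Lp2_integrable_mult[OF u'[of "(- a) *\<^sub>R ?e"] \<psi>2]
        Lp2_integrable_mult[OF I \<psi>2]
      by (simp add: left_diff_distrib)
  qed
  then have AE: "AE x in lborel. u x - u (x + (- a) *\<^sub>R ?e) = I x" by simp
  have "(\<integral>\<^sup>+x. ennreal ((norm (u (x + a *\<^sub>R ?e) - u x))\<^sup>2) \<partial>lborel)
      = (\<integral>\<^sup>+x. ennreal ((norm (u x - u (x + (- a) *\<^sub>R ?e)))\<^sup>2) \<partial>lborel)"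
    using nn_integral_lborel_translation[of "\<lambda>x. ennreal ((norm (u x - u (x + (- a) *\<^sub>R ?e)))\<^sup>2)" "a *\<^sub>R ?e"]
    by simp
  also have "\<dots> = (\<integral>\<^sup>+x. ennreal ((norm (I x))\<^sup>2) \<partial>lborel)"
    by (rule nn_integral_cong_AE) (use AE in eventually_elim, simp)
  also have "\<dots> \<le> ennreal (a\<^sup>2) * (\<integral>\<^sup>+x. ennreal ((norm (g x))\<^sup>2) \<partial>lborel)"
    using translation_average_sq(2)[OF g(1) a, of "- ?e"] unfolding I_def .
  finally show ?thesis .
qed

section \<open>Sobolev functions are in every \<open>L\<^sup>p\<close> with \<open>2 < p < 4\<close>\<close>

lemma translation_estimate:
  assumes u: "u \<in> Lp 2" and g: "\<And>i. g i \<in> Lp 2" "\<And>i. has_weak_partial i u (g i)"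
    and y: "\<And>i. 0 \<le> y $ i" "\<And>i. y $ i \<le> h"
  shows "(\<integral>\<^sup>+x. ennreal ((norm (u (x + y) - u x))\<^sup>2) \<partial>lborel)
    \<le> ennreal (2 * h\<^sup>2 * (\<Sum>i\<in>UNIV. LINT x|lborel. (norm (g i x))\<^sup>2))"
proof -
  let ?y1 = "(y $ 1) *\<^sub>R axis 1 1 :: R2" and ?y2 = "(y $ 2) *\<^sub>R axis 2 1 :: R2"
  have [measurable]: "u \<in> borel_measurable borel" using u by measurable
  have y_eq: "y = ?y1 + ?y2" by (simp add: vec_eq_iff forall_2 axis_def)
  have ax: "(\<integral>\<^sup>+x. ennreal ((norm (u (x + y $ i *\<^sub>R axis i 1) - u x))\<^sup>2) \<partial>lborel)
      \<le> ennreal (h\<^sup>2 * (LINT x|lborel. (norm (g i x))\<^sup>2))" for i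
  proof -
    have "ennreal ((y $ i)\<^sup>2) * (\<integral>\<^sup>+x. ennreal ((norm (g i x))\<^sup>2) \<partial>lborel)
        = ennreal ((y $ i)\<^sup>2 * (LINT x|lborel. (norm (g i x))\<^sup>2))"
      using g(1)[of i] by (simp add: Lp2_iff nn_integral_eq_integral ennreal_mult)
    also have "\<dots> \<le> ennreal (h\<^sup>2 * (LINT x|lborel. (norm (g i x))\<^sup>2))"
      using y[of i] by (intro ennreal_leI mult_right_mono power_mono) auto
    finally show ?thesis
      using translation_estimate_axis[OF u g(1)[of i] g(2)[of i] y(1)[of i]] by (rule order_trans[rotated])
  qed
  have "(norm (u (x + y) - u x))\<^sup>2 \<le> 2 * (norm (u (x + ?y1 + ?y2) - u (x + ?y1)))\<^sup>2 + 2 * (norm (u (x + ?y1) - u x))\<^sup>2" for x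
  proof -
    have "norm (u (x + y) - u x) \<le> norm (u (x + ?y1 + ?y2) - u (x + ?y1)) + norm (u (x + ?y1) - u x)"
      using norm_triangle_ineq[of "u (x + ?y1 + ?y2) - u (x + ?y1)" "u (x + ?y1) - u x"]
      by (subst y_eq) (simp add: add.assoc)
    from power_mono[OF this, of 2] show ?thesis
      using sum_squares_bound[of "norm (u (x + ?y1 + ?y2) - u (x + ?y1))" "norm (u (x + ?y1) - u x)"]
      by (simp add: power2_sum)
  qed
  from ennreal_leI[OF this]
  have "(\<integral>\<^sup>+x. ennreal ((norm (u (x + y) - u x))\<^sup>2) \<partial>lborel)
      \<le> (\<integral>\<^sup>+x. 2 * ennreal ((norm (u (x + ?y1 + ?y2) - u (x + ?y1)))\<^sup>2) + 2 * ennreal ((norm (u (x + ?y1) - u x))\<^sup>2) \<partial>lborel)"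
    by (intro nn_integral_mono) (simp add: ennreal_mult)
  also have "\<dots> = 2 * (\<integral>\<^sup>+x. ennreal ((norm (u (x + ?y1 + ?y2) - u (x + ?y1)))\<^sup>2) \<partial>lborel)
      + 2 * (\<integral>\<^sup>+x. ennreal ((norm (u (x + ?y1) - u x))\<^sup>2) \<partial>lborel)"
    by (simp add: nn_integral_add nn_integral_cmult)
  also have "(\<integral>\<^sup>+x. ennreal ((norm (u (x + ?y1 + ?y2) - u (x + ?y1)))\<^sup>2) \<partial>lborel)
      = (\<integral>\<^sup>+x. ennreal ((norm (u (x + ?y2) - u x))\<^sup>2) \<partial>lborel)"
    using nn_integral_lborel_translation[of "\<lambda>x. ennreal ((norm (u (x + ?y2) - u x))\<^sup>2)" ?y1] by simp
  also have "2 * \<dots> + 2 * (\<integral>\<^sup>+x. ennreal ((norm (u (x + ?y1) - u x))\<^sup>2) \<partial>lborel)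
      \<le> 2 * ennreal (h\<^sup>2 * (LINT x|lborel. (norm (g 2 x))\<^sup>2)) + 2 * ennreal (h\<^sup>2 * (LINT x|lborel. (norm (g 1 x))\<^sup>2))"
    by (intro add_mono mult_left_mono ax) auto
  also have "\<dots> = ennreal (2 * (h\<^sup>2 * (LINT x|lborel. (norm (g 2 x))\<^sup>2)) + 2 * (h\<^sup>2 * (LINT x|lborel. (norm (g 1 x))\<^sup>2)))"
    by (subst ennreal_plus) (auto simp: ennreal_mult)
  also have "\<dots> = ennreal (2 * h\<^sup>2 * (\<Sum>i\<in>UNIV. LINT x|lborel. (norm (g i x))\<^sup>2))"
    by (simp add: sum_2 algebra_simps)
  finally show ?thesis .
qed

text \<open>The weak-type (4,4) bound: by Chebyshev, \<open>\<bar>u\<bar> \<le> l\<close> on at least half of any square of area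
  \<open>2 (\<parallel>u\<parallel>\<^sup>2 + 1) / l\<^sup>2\<close>, so that around a point where \<open>\<bar>u\<bar> > 2 l\<close> the increments of \<open>u\<close> are
  large on average.\<close>

lemma H1_weak_L4:
  assumes u: "u \<in> H1"
  obtains C where "C \<ge> 0"
    "\<And>l. l > 0 \<Longrightarrow> emeasure lborel {x. norm (u x) > 2 * l} \<le> ennreal (C / l ^ 4)"
proof
  let ?g = "\<lambda>i. weak_partial i u"
  define N where "N = (LINT x|lborel. (norm (u x))\<^sup>2)"
  define A where "A = (\<Sum>i\<in>UNIV. LINT x|lborel. (norm (?g i x))\<^sup>2)"
  note u2 = H1_Lp2[OF u]
  have [measurable]: "u \<in> borel_measurable borel" using u2 by measurable
  have N: "N \<ge> 0" and A: "A \<ge> 0" by (auto simp: N_def A_def sum_nonneg)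
  have N_eq: "(\<integral>\<^sup>+x. ennreal ((norm (u x))\<^sup>2) \<partial>lborel) = ennreal N"
    using u2 unfolding N_def by (simp add: Lp2_iff nn_integral_eq_integral)
  show "8 * (N + 1) * A \<ge> 0" using N A by simp
  fix l :: real assume l: "l > 0"
  \<comment> \<open>The summand 1 keeps \<open>m\<close> positive even if u vanishes, so that
    \<open>m\<close> can be divided out at the end.\<close>
  define m where "m = (N + 1) / l\<^sup>2"
  define h where "h = sqrt (2 * m)"
  have m: "m > 0" using N l by (simp add: m_def)
  then have h: "h > 0" "h\<^sup>2 = 2 * m" by (auto simp: h_def)
  define Q where "Q = (cbox 0 (vec h) :: R2 set)"
  have Qm [measurable]: "Q \<in> sets borel" by (simp add: Q_def)
  have Q: "y \<in> Q \<longleftrightarrow> (\<forall>i. 0 \<le> y $ i \<and> y $ i \<le> h)" for y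
    by (simp add: Q_def mem_box_cart)
  have "emeasure lborel Q < top"
    using emeasure_lborel_cbox_finite unfolding Q_def infinity_ennreal_def .
  then have "emeasure lborel Q = ennreal (measure lborel Q)"
    by (intro emeasure_eq_ennreal_measure less_imp_neq)
  also have "measure lborel Q = (\<Prod>i\<in>UNIV. (vec h :: R2) $ i - (0 :: R2) $ i)"
    unfolding Q_def by (rule content_cbox_cart) (use h Q[of 0] in \<open>auto simp: Q_def\<close>)
  also have "\<dots> = h\<^sup>2" by (simp add: power2_eq_square)
  finally have emQ: "emeasure lborel Q = ennreal (2 * m)" by (simp add: h)
  let ?S = "{x. norm (u x) > 2 * l}"
  have T: "emeasure lborel {y. norm (u (x + y)) > l} \<le> ennreal m" for x
  proof -
    have "ennreal (l\<^sup>2) * emeasure lborel {y. norm (u (x + y)) > l}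
        = (\<integral>\<^sup>+y. ennreal (l\<^sup>2) * indicator {y. norm (u (x + y)) > l} y \<partial>lborel)"
      by (subst nn_integral_cmult) auto
    also have "\<dots> \<le> (\<integral>\<^sup>+y. ennreal ((norm (u (y + x)))\<^sup>2) \<partial>lborel)"
      using l by (intro nn_integral_mono)
        (auto simp: add.commute split: split_indicator intro!: ennreal_leI power_mono)
    also have "\<dots> = ennreal N"
      using nn_integral_lborel_translation[of "\<lambda>x. ennreal ((norm (u x))\<^sup>2)" x] N_eq by simp
    also have "\<dots> \<le> ennreal (l\<^sup>2) * ennreal m"
      using l m N by (simp add: m_def ennreal_leI flip: ennreal_mult)
    finally show ?thesis
      using l by (subst (asm) ennreal_mult_le_mult_iff) auto
  qed
  have low: "ennreal (l\<^sup>2 * m) \<le> (\<integral>\<^sup>+y. indicator Q y * ennreal ((norm (u (x + y) - u x))\<^sup>2) \<partial>lborel)"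
    if x: "x \<in> ?S" for x
  proof -
    let ?T = "{y. norm (u (x + y)) > l}"
    have "ennreal (2 * m) \<le> emeasure lborel (Q - ?T) + emeasure lborel ?T"
      unfolding emQ[symmetric]
      by (rule order_trans[OF emeasure_mono emeasure_subadditive]) auto
    also have "\<dots> \<le> emeasure lborel (Q - ?T) + ennreal m"
      by (intro add_left_mono T)
    finally have "ennreal m \<le> emeasure lborel (Q - ?T)"
      using m by (cases "emeasure lborel (Q - ?T)") (auto simp flip: ennreal_plus)
    then have "ennreal (l\<^sup>2 * m) \<le> ennreal (l\<^sup>2) * emeasure lborel (Q - ?T)"
      using m by (simp add: ennreal_mult mult_left_mono)
    also have "\<dots> = (\<integral>\<^sup>+y. ennreal (l\<^sup>2) * indicator (Q - ?T) y \<partial>lborel)"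
      by (subst nn_integral_cmult) auto
    also have "\<dots> \<le> (\<integral>\<^sup>+y. indicator Q y * ennreal ((norm (u (x + y) - u x))\<^sup>2) \<partial>lborel)"
    proof (rule nn_integral_mono)
      fix y
      show "ennreal (l\<^sup>2) * indicator (Q - ?T) y \<le> indicator Q y * ennreal ((norm (u (x + y) - u x))\<^sup>2)"
      proof (cases "y \<in> Q - ?T")
        case True
        then have "l \<le> norm (u (x + y) - u x)"
          using x norm_triangle_ineq2[of "u x" "u (x + y)"] by (auto simp: norm_minus_commute)
        then show ?thesis using True l by (auto intro!: ennreal_leI power_mono)
      qed auto
    qed
    finally show ?thesis .
  qed
  have "ennreal (l\<^sup>2 * m) * emeasure lborel ?S = (\<integral>\<^sup>+x. ennreal (l\<^sup>2 * m) * indicator ?S x \<partial>lborel)"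
    by (subst nn_integral_cmult) auto
  also have "\<dots> \<le> (\<integral>\<^sup>+x. \<integral>\<^sup>+y. indicator Q y * ennreal ((norm (u (x + y) - u x))\<^sup>2) \<partial>lborel \<partial>lborel)"
    using low by (intro nn_integral_mono) (auto split: split_indicator)
  also have "\<dots> = (\<integral>\<^sup>+y. \<integral>\<^sup>+x. indicator Q y * ennreal ((norm (u (x + y) - u x))\<^sup>2) \<partial>lborel \<partial>lborel)"
    by (intro lborel_pair.Fubini') measurable
  also have "\<dots> \<le> (\<integral>\<^sup>+y. indicator Q y * ennreal (2 * h\<^sup>2 * A) \<partial>lborel)"
  proof (rule nn_integral_mono)
    fix y
    have "(\<integral>\<^sup>+x. indicator Q y * ennreal ((norm (u (x + y) - u x))\<^sup>2) \<partial>lborel)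
        = indicator Q y * (\<integral>\<^sup>+x. ennreal ((norm (u (x + y) - u x))\<^sup>2) \<partial>lborel)"
      by (rule nn_integral_cmult) measurable
    also have "\<dots> \<le> indicator Q y * ennreal (2 * h\<^sup>2 * A)"
      using translation_estimate[OF u2 weak_partial_Lp2[OF u] has_weak_partial_weak_partial[OF u], of y h] Q[of y]
      by (auto simp: A_def split: split_indicator)
    finally show "(\<integral>\<^sup>+x. indicator Q y * ennreal ((norm (u (x + y) - u x))\<^sup>2) \<partial>lborel)
        \<le> indicator Q y * ennreal (2 * h\<^sup>2 * A)" .
  qed
  also have "\<dots> = ennreal (2 * m) * ennreal (2 * h\<^sup>2 * A)"
    by (simp add: nn_integral_multc emQ)
  also have "\<dots> = ennreal (2 * m * (2 * h\<^sup>2 * A))"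
    using m A by (intro ennreal_mult[symmetric]) auto
  \<comment> \<open>As h^2 = 2 m, the bound is 8 m^2 A; division by l^2 m leaves 8 m A / l^2, which
    is the announced constant over l^4.\<close>
  also have "\<dots> = ennreal (l\<^sup>2 * m) * ennreal (8 * (N + 1) * A / l ^ 4)"
  proof -
    have "N + 1 = m * l\<^sup>2" using l by (simp add: m_def)
    then have "2 * m * (2 * h\<^sup>2 * A) = (l\<^sup>2 * m) * (8 * (N + 1) * A / l ^ 4)"
      unfolding h using l by (simp add: field_simps eval_nat_numeral)
    then have "ennreal (2 * m * (2 * h\<^sup>2 * A)) = ennreal ((l\<^sup>2 * m) * (8 * (N + 1) * A / l ^ 4))"
      by (rule arg_cong)
    also have "\<dots> = ennreal (l\<^sup>2 * m) * ennreal (8 * (N + 1) * A / l ^ 4)"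
      by (rule ennreal_mult) (use m A N in auto)
    finally show ?thesis .
  qed
  finally show "emeasure lborel ?S \<le> ennreal (8 * (N + 1) * A / l ^ 4)"
    using l m by (subst (asm) ennreal_mult_le_mult_iff) auto
qed

text \<open>By the weak-type bound, the layer 2^k < |u| \<le> 2^(k + 1) contributes at most a
  constant times 2^((p - 4) k), a convergent geometric series as p < 4. Where |u| \<le> 1, |u|^p
  \<le> |u|^2 as p > 2.\<close>

lemma H1_imp_integrable_powr:
  assumes u: "u \<in> H1" and p: "2 < p" "p < 4"
  shows "integrable lborel (\<lambda>x. norm (u x) powr p)"
proof -
  obtain C where C: "C \<ge> 0" "\<And>l. l > 0 \<Longrightarrow> emeasure lborel {x. norm (u x) > 2 * l} \<le> ennreal (C / l ^ 4)"
    using H1_weak_L4[OF u] by blast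
  note u2 = H1_Lp2[OF u]
  have [measurable]: "u \<in> borel_measurable borel" using u2 by measurable
  let ?S = "\<lambda>k::nat. {x. norm (u x) > 2 ^ k}"
  let ?c = "\<lambda>k::nat. (2 ^ Suc k) powr p :: real"
  let ?r = "2 powr (p - 4)"
  have pt: "ennreal (norm (u x) powr p) \<le> ennreal ((norm (u x))\<^sup>2) + (\<Sum>k. ennreal (?c k) * indicator (?S k) x)" for x
  proof (cases "norm (u x) \<le> 1")
    case True
    then have "norm (u x) powr p \<le> norm (u x) powr 2"
      using p by (intro powr_mono') auto
    from ennreal_leI[OF this] show ?thesis by (simp add: add_increasing2)
  next
    case False
    define k where "k = (LEAST n. norm (u x) \<le> 2 ^ n)"
    have "\<exists>n. norm (u x) \<le> 2 ^ n" using real_arch_pow[of 2 "norm (u x)"] by (auto intro: less_imp_le)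
    then have k: "norm (u x) \<le> 2 ^ k" unfolding k_def by (rule LeastI_ex)
    with False obtain j where j: "k = Suc j" by (cases k) auto
    have "\<not> norm (u x) \<le> 2 ^ j" using not_less_Least[of j "\<lambda>n. norm (u x) \<le> 2 ^ n"] by (simp add: j flip: k_def)
    moreover have "norm (u x) powr p \<le> ?c j"
      using k p unfolding j by (intro powr_mono2) auto
    ultimately have "ennreal (norm (u x) powr p) \<le> ennreal (?c j) * indicator (?S j) x"
      by (simp add: ennreal_leI)
    also have "\<dots> \<le> (\<Sum>k. ennreal (?c k) * indicator (?S k) x)"
    proof -
      define a where "a k = ennreal (?c k) * indicator (?S k) x" for k
      have "a j \<le> suminf a" using sum_le_suminf[of a "{j}"] by simp
      then show ?thesis unfolding a_def .
    qed
    finally show ?thesis by (simp add: add_increasing)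
  qed
  have term_le: "ennreal (?c k) * emeasure lborel (?S k) \<le> ennreal (2 powr p * 16 * C) * ennreal (?r ^ k)" for k
  proof -
    \<comment> \<open>The weak-type bound concerns the level 2 l, so l is half of 2^k; the fourth
      power of this half is the factor 16.\<close>
    have "emeasure lborel (?S k) \<le> ennreal (C / (2 ^ k / 2) ^ 4)"
      using C(2)[of "2 ^ k / 2"] by simp
    then have "ennreal (?c k) * emeasure lborel (?S k) \<le> ennreal (?c k) * ennreal (C / (2 ^ k / 2) ^ 4)"
      by (rule mult_left_mono) simp
    also have "\<dots> = ennreal (?c k * (C / (2 ^ k / 2) ^ 4))"
      using C(1) by (intro ennreal_mult[symmetric]) auto
    also have "?c k * (C / (2 ^ k / 2) ^ 4) = 2 powr p * 16 * C * ?r ^ k"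
    proof -
      have "?c k = 2 powr p * (2 powr p) ^ k"
        by (simp add: powr_mult powr_power powr_powr mult.commute flip: powr_realpow)
      moreover have "?r ^ k = (2 powr p) ^ k / (2 ^ k) ^ 4"
      proof -
        have "((2::real) ^ k) ^ 4 = (2 ^ 4) ^ k" by (simp only: power_mult[symmetric] mult.commute)
        then show ?thesis by (simp add: powr_diff power_divide)
      qed
      ultimately show ?thesis by (simp add: power_divide)
    qed
    also have "ennreal (2 powr p * 16 * C * ?r ^ k) = ennreal (2 powr p * 16 * C) * ennreal (?r ^ k)"
      using C(1) by (intro ennreal_mult) auto
    finally show ?thesis .
  qed
  have "(\<integral>\<^sup>+x. norm (u x) powr p \<partial>lborel)
      \<le> (\<integral>\<^sup>+x. ennreal ((norm (u x))\<^sup>2) + (\<Sum>k. ennreal (?c k) * indicator (?S k) x) \<partial>lborel)"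
    by (intro nn_integral_mono pt)
  also have "\<dots> = (\<integral>\<^sup>+x. ennreal ((norm (u x))\<^sup>2) \<partial>lborel) + (\<Sum>k. ennreal (?c k) * emeasure lborel (?S k))"
    by (simp add: nn_integral_add nn_integral_suminf nn_integral_cmult)
  also have "\<dots> \<le> (\<integral>\<^sup>+x. ennreal ((norm (u x))\<^sup>2) \<partial>lborel) + (\<Sum>k. ennreal (2 powr p * 16 * C) * ennreal (?r ^ k))"
    by (intro add_left_mono suminf_le term_le) auto
  also have "(\<Sum>k. ennreal (2 powr p * 16 * C) * ennreal (?r ^ k)) = ennreal (2 powr p * 16 * C) * ennreal (\<Sum>k. ?r ^ k)"
    using p by (subst suminf_ennreal2[symmetric]) (auto simp: summable_geometric_iff powr_less_one)
  also have "(\<integral>\<^sup>+x. ennreal ((norm (u x))\<^sup>2) \<partial>lborel) + \<dots> < \<infinity>"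
    using u2 by (auto simp: Lp2_iff integrable_iff_bounded ennreal_mult_less_top)
  finally show ?thesis by (simp add: integrable_iff_bounded)
qed

section \<open>The Green's function\<close>

text \<open>In the plane the L^2 norm of \<eta> (n x) is 1/n times that of \<eta>, so Cauchy-Schwarz
  absorbs the factor n exactly. What remains is the L^2 norm of g over sets that shrink to the
  origin, and this tends to 0.\<close>

lemma concentrating_integral_tendsto_0:
  assumes g: "g \<in> Lp 2" and \<eta>: "\<eta> \<in> test_fun"
  shows "(\<lambda>n. of_nat (Suc n) * (LINT x|lborel. g x * \<eta> (real (Suc n) *\<^sub>R x))) \<longlonglongrightarrow> 0"
proof -
  let ?N = "\<lambda>n. real (Suc n)"
  let ?S = "\<lambda>n. {x. \<eta> (?N n *\<^sub>R x) \<noteq> 0}"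
  note \<eta>2 = test_fun_Lp2[OF \<eta>]
  have [measurable]: "g \<in> borel_measurable borel" "\<eta> \<in> borel_measurable borel"
    using g \<eta>2 by measurable
  define a where "a n = (LINT x|lborel. (norm (g x))\<^sup>2 * indicator (?S n) x)" for n
  define B where "B = (LINT x|lborel. (norm (\<eta> x))\<^sup>2)"
  have g2: "integrable lborel (\<lambda>x. (norm (g x))\<^sup>2)" using g by (simp add: Lp2_iff)
  have "a \<longlonglongrightarrow> (LINT x|(lborel :: R2 measure). 0)"
    unfolding a_def
  proof (rule integral_dominated_convergence[OF _ _ g2])
    obtain R where R: "\<And>x. \<eta> x \<noteq> 0 \<Longrightarrow> norm x \<le> R"
      using test_fun_bounded[OF \<eta>] by (auto simp: bounded_iff)
    have "(\<lambda>n. (norm (g x))\<^sup>2 * indicator (?S n) x) \<longlonglongrightarrow> 0" if "x \<noteq> 0" for x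
    proof (rule tendsto_eventually)
      obtain n0 where "R / norm x < real n0" using reals_Archimedean2 by blast
      with that have n0: "R < real n0 * norm x" by (simp add: field_simps)
      show "\<forall>\<^sub>F n in sequentially. (norm (g x))\<^sup>2 * indicator (?S n) x = 0"
        using eventually_ge_at_top[of n0]
      proof eventually_elim
        fix n assume "n0 \<le> n"
        then have "real n0 * norm x \<le> ?N n * norm x" by (intro mult_right_mono) auto
        with n0 have "\<not> norm (?N n *\<^sub>R x) \<le> R" by simp
        then have "\<eta> (?N n *\<^sub>R x) = 0" using R by blast
        then show "(norm (g x))\<^sup>2 * indicator (?S n) x = 0" by simp
      qed
    qed
    then show "AE x in lborel. (\<lambda>n. (norm (g x))\<^sup>2 * indicator (?S n) x) \<longlonglongrightarrow> 0"
      using AE_lborel_singleton[of 0] by (auto elim: eventually_mono)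
    show "AE x in lborel. norm ((norm (g x))\<^sup>2 * indicator (?S n) x) \<le> (norm (g x))\<^sup>2" for n
      by (auto simp: indicator_def)
  qed (simp_all, measurable)
  then have "(\<lambda>n. sqrt (a n * B)) \<longlonglongrightarrow> sqrt (0 * B)"
    by (intro tendsto_intros) simp
  then have lim: "(\<lambda>n. sqrt (a n * B)) \<longlonglongrightarrow> 0" by simp
  have "norm (of_nat (Suc n) * (LINT x|lborel. g x * \<eta> (?N n *\<^sub>R x))) \<le> sqrt (a n * B)" for n
  proof -
    let ?z = "LINT x|lborel. g x * \<eta> (?N n *\<^sub>R x)"
    have a0: "a n \<ge> 0" and B0: "B \<ge> 0" by (auto simp: a_def B_def intro!: integral_nonneg)
    have "integrable lborel (\<lambda>x. (norm (g x))\<^sup>2 * indicator (?S n) x)"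
      by (rule integrable_real_mult_indicator[OF _ g2]) measurable
    then have ea: "(\<integral>\<^sup>+x. ennreal ((norm (g x))\<^sup>2 * indicator (?S n) x) \<partial>lborel) = ennreal (a n)"
      unfolding a_def by (intro nn_integral_eq_integral) auto
    have eB: "(\<integral>\<^sup>+x. ennreal ((norm (\<eta> x))\<^sup>2) \<partial>lborel) = ennreal B"
      unfolding B_def using \<eta>2 by (intro nn_integral_eq_integral) (auto simp: Lp2_iff)
    have "(ennreal (norm ?z))\<^sup>2 \<le> (\<integral>\<^sup>+x. ennreal (norm (g x) * indicator (?S n) x) * ennreal (norm (\<eta> (?N n *\<^sub>R x))) \<partial>lborel)\<^sup>2"
    proof (intro power_mono)
      have "ennreal (norm ?z) \<le> (\<integral>\<^sup>+x. norm (g x * \<eta> (?N n *\<^sub>R x)) \<partial>lborel)"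
        by (rule norm_integral_le_nn_integral)
      also have "\<dots> = (\<integral>\<^sup>+x. ennreal (norm (g x) * indicator (?S n) x) * ennreal (norm (\<eta> (?N n *\<^sub>R x))) \<partial>lborel)"
        by (intro nn_integral_cong) (auto simp: norm_mult indicator_def ennreal_mult)
      finally show "ennreal (norm ?z) \<le> \<dots>" .
    qed simp
    also have "\<dots> \<le> (\<integral>\<^sup>+x. (ennreal (norm (g x) * indicator (?S n) x))\<^sup>2 \<partial>lborel) *
        (\<integral>\<^sup>+x. (ennreal (norm (\<eta> (?N n *\<^sub>R x))))\<^sup>2 \<partial>lborel)"
      by (intro Cauchy_Schwarz_nn_integral) measurable
    also have "(\<integral>\<^sup>+x. (ennreal (norm (g x) * indicator (?S n) x))\<^sup>2 \<partial>lborel)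
        = (\<integral>\<^sup>+x. ennreal ((norm (g x))\<^sup>2 * indicator (?S n) x) \<partial>lborel)"
      by (intro nn_integral_cong) (auto simp: ennreal_power indicator_def)
    also note ea
    \<comment> \<open>From here the chain carries the factor (n + 1)^2, which turns the square
      integral of the dilated \<eta> into \<open>B\<close>. The last step discharges the
      monotonicity of this multiplication.\<close>
    also have "ennreal ((?N n)\<^sup>2) * (ennreal (a n) * (\<integral>\<^sup>+x. (ennreal (norm (\<eta> (?N n *\<^sub>R x))))\<^sup>2 \<partial>lborel))
        = ennreal (a n) * (ennreal ((?N n)\<^sup>2) * (\<integral>\<^sup>+x. ennreal ((norm (\<eta> (0 + ?N n *\<^sub>R x)))\<^sup>2) \<partial>lborel))"
      by (simp add: ennreal_power mult_ac)
    also have "ennreal ((?N n)\<^sup>2) * (\<integral>\<^sup>+x. ennreal ((norm (\<eta> (0 + ?N n *\<^sub>R x)))\<^sup>2) \<partial>lborel) = ennreal B"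
      using nn_integral_lborel_affine[of "\<lambda>x. ennreal ((norm (\<eta> x))\<^sup>2)" "?N n" 0] eB by simp
    finally have "ennreal ((?N n)\<^sup>2) * (ennreal (norm ?z))\<^sup>2 \<le> ennreal (a n) * ennreal B"
      by (simp add: mult_left_mono)
    then have "ennreal ((?N n * norm ?z)\<^sup>2) \<le> ennreal (a n * B)"
      using a0 B0 by (simp add: ennreal_power power_mult_distrib flip: ennreal_mult)
    then have "(?N n * norm ?z)\<^sup>2 \<le> a n * B"
      using a0 B0 by (simp add: ennreal_le_iff)
    then show ?thesis
      by (intro real_le_rsqrt) (simp add: norm_mult del: of_nat_Suc)
  qed
  then show ?thesis
    by (intro Lim_null_comparison[OF _ lim] always_eventually allI)
qed

lemma bump_at_0: "bump 1 (vec (- 1)) (vec 1) 0 \<noteq> 0"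
  by (simp add: bump_nz_iff mem_box_cart)

text \<open>A point has zero \<open>H\<^sup>1\<close>-capacity in the plane: testing with \<open>\<eta> (n x)\<close> would give
  \<open>\<eta> 0 = 0\<close> in the limit.\<close>

lemma green_not_H1:
  assumes G: "is_green 1 G"
  shows "G \<notin> H1"
proof
  assume H: "G \<in> H1"
  define \<eta> where "\<eta> = bump 1 (vec (- 1)) (vec 1)"
  have \<eta>: "\<eta> \<in> test_fun" unfolding \<eta>_def by (rule bump_test_fun) simp
  let ?g = "\<lambda>i. weak_partial i G"
  let ?\<psi> = "\<lambda>n x. \<eta> (real (Suc n) *\<^sub>R x)"
  have G2: "G \<in> Lp 2" using H by (rule H1_Lp2)
  have \<psi>: "?\<psi> n \<in> test_fun" for n
    using test_fun_affine[OF \<eta>, of "real (Suc n)" 0] by simp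
  have p\<psi>: "partial i (?\<psi> n) = (\<lambda>x. of_nat (Suc n) * partial i \<eta> (real (Suc n) *\<^sub>R x))" for i n
    using partial_affine[OF test_fun_differentiable[OF \<eta>], of i 0 "real (Suc n)"]
    by (simp add: scaleR_conv_of_real[where ?'a = complex])
  \<comment> \<open>The gradient terms carry a factor n from differentiating the dilated function,
    which is the critical scaling. The zero-order term has no such factor, so 1/n is split off to
    bring it into the same form.\<close>
  have eq: "\<eta> 0 = (\<Sum>i\<in>UNIV. of_nat (Suc n) * (LINT x|lborel. ?g i x * partial i \<eta> (real (Suc n) *\<^sub>R x)))
      + of_nat (Suc n) * (LINT x|lborel. G x * \<eta> (real (Suc n) *\<^sub>R x)) * (1 / of_nat (Suc n))" for n
  proof -
    have pp: "partial i (partial i (?\<psi> n)) \<in> test_fun" for i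
      using \<psi> by (intro test_fun_partial)
    have int: "integrable lborel (\<lambda>x. G x * partial i (partial i (?\<psi> n)) x)" for i
      by (rule Lp2_integrable_mult[OF G2 test_fun_Lp2[OF pp]])
    have int0: "integrable lborel (\<lambda>x. G x * ?\<psi> n x)"
      by (rule Lp2_integrable_mult[OF G2 test_fun_Lp2[OF \<psi>]])
    have "\<eta> 0 = ?\<psi> n 0" by simp
    also have "\<dots> = (LINT x|lborel. G x * (- laplacian (?\<psi> n) x + of_real 1 * ?\<psi> n x))"
      using G \<psi>[of n] unfolding is_green_def by simp
    also have "\<dots> = (LINT x|lborel. - (\<Sum>i\<in>UNIV. G x * partial i (partial i (?\<psi> n)) x) + G x * ?\<psi> n x)"
      by (intro Bochner_Integration.integral_cong) (simp_all add: laplacian_def right_diff_distrib sum_distrib_left)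
    also have "\<dots> = - (\<Sum>i\<in>UNIV. LINT x|lborel. G x * partial i (partial i (?\<psi> n)) x) + (LINT x|lborel. G x * ?\<psi> n x)"
      using int int0 by simp
    also have "(\<lambda>i. LINT x|lborel. G x * partial i (partial i (?\<psi> n)) x)
        = (\<lambda>i. - (of_nat (Suc n) * (LINT x|lborel. ?g i x * partial i \<eta> (real (Suc n) *\<^sub>R x))))"
    proof
      fix i
      have "(LINT x|lborel. G x * partial i (partial i (?\<psi> n)) x) = - (LINT x|lborel. ?g i x * partial i (?\<psi> n) x)"
        using has_weak_partial_weak_partial[OF H, of i] test_fun_partial[OF \<psi>] unfolding has_weak_partial_def by blast
      also have "(LINT x|lborel. ?g i x * partial i (?\<psi> n) x) = of_nat (Suc n) * (LINT x|lborel. ?g i x * partial i \<eta> (real (Suc n) *\<^sub>R x))"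
        unfolding p\<psi> by (subst integral_mult_right_zero[symmetric]) (simp only: mult_ac)
      finally show "(LINT x|lborel. G x * partial i (partial i (?\<psi> n)) x)
          = - (of_nat (Suc n) * (LINT x|lborel. ?g i x * partial i \<eta> (real (Suc n) *\<^sub>R x)))" .
    qed
    finally show ?thesis by (simp add: sum_negf del: of_nat_Suc)
  qed
  have "(\<lambda>n. (\<Sum>i\<in>UNIV. of_nat (Suc n) * (LINT x|lborel. ?g i x * partial i \<eta> (real (Suc n) *\<^sub>R x)))
      + of_nat (Suc n) * (LINT x|lborel. G x * \<eta> (real (Suc n) *\<^sub>R x)) * (1 / of_nat (Suc n))) \<longlonglongrightarrow> (\<Sum>i\<in>(UNIV :: 2 set). 0) + 0 * 0"
    by (intro tendsto_add tendsto_sum tendsto_mult concentrating_integral_tendsto_0 weak_partial_Lp2 H G2 \<eta>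
        test_fun_partial LIMSEQ_Suc[OF lim_1_over_n])
  then have "(\<lambda>n::nat. \<eta> 0) \<longlonglongrightarrow> 0" unfolding eq[symmetric] by simp
  then have "\<eta> 0 = 0" by (simp add: LIMSEQ_const_iff)
  then show False using bump_at_0 by (simp add: \<eta>_def)
qed

section \<open>The heat kernel and the existence of a Green's function\<close>

text \<open>The heat kernel without its normalizing factor \<open>1 / (4 \<pi>)\<close>; its integral is \<open>heat_mass\<close> for every \<open>t > 0\<close>.\<close>

definition heat :: "real \<Rightarrow> R2 \<Rightarrow> real" where
  "heat t x = exp (- (norm x)\<^sup>2 / (4 * t)) / t"

definition heat_mass :: real where
  "heat_mass = (LINT x|lborel. heat 1 x)"

lemma measurable_heat [measurable]: "(\<lambda>(t, x). heat t x) \<in> borel_measurable (lborel \<Otimes>\<^sub>M lborel)"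
  unfolding heat_def by measurable

lemma measurable_heat_space [measurable]: "heat t \<in> borel_measurable borel"
  unfolding heat_def by measurable

lemma heat_nonneg: "t \<ge> 0 \<Longrightarrow> heat t x \<ge> 0"
  by (simp add: heat_def)

lemma heat_scale: "t > 0 \<Longrightarrow> heat t (sqrt t *\<^sub>R x) = heat 1 x / t"
  by (simp add: heat_def power_mult_distrib)

lemma nn_integral_inverse_1_plus_square: "(\<integral>\<^sup>+x. ennreal (1 / (1 + x\<^sup>2)) \<partial>lborel) < \<infinity>"
proof -
  let ?f = "\<lambda>x::real. 1 / (1 + x\<^sup>2)"
  have half: "(\<integral>\<^sup>+x. ennreal (?f x) * indicator {0..} x \<partial>lborel) = pi / 2 - arctan 0"
  proof (rule nn_integral_FTC_atLeast)
    show "DERIV arctan x :> ?f x" for x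
      using DERIV_arctan[of x] by (simp add: field_simps)
  qed (auto simp: tendsto_arctan_at_top)
  have "(\<integral>\<^sup>+x. ennreal (?f x) \<partial>lborel)
      \<le> (\<integral>\<^sup>+x. ennreal (?f x) * indicator {0..} x + ennreal (?f (- x)) * indicator {0..} (- x) \<partial>lborel)"
    by (intro nn_integral_mono) (auto split: split_indicator)
  also have "\<dots> = (\<integral>\<^sup>+x. ennreal (?f x) * indicator {0..} x \<partial>lborel)
      + (\<integral>\<^sup>+x. ennreal (?f (- x)) * indicator {0..} (- x) \<partial>lborel)"
    by (rule nn_integral_add) auto
  also have "(\<integral>\<^sup>+x. ennreal (?f (- x)) * indicator {0..} (- x) \<partial>lborel)
      = (\<integral>\<^sup>+x. ennreal (?f x) * indicator {0..} x \<partial>lborel)"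
    by (subst (2) nn_integral_real_affine[where c="- 1" and t=0]) auto
  finally show ?thesis
    unfolding half by (rule le_less_trans) (simp flip: ennreal_plus)
qed

text \<open>By e^s \<ge> 1 + s each Gaussian factor is at most 4 / (1 + x_b^2), whose integral over
  the line is finite; 16 is the product of the constants of the two coordinates.\<close>

lemma heat_1_integrable: "integrable lborel (heat 1)"
proof -
  have "exp (- (norm x)\<^sup>2 / 4) \<le> 16 * (\<Prod>b\<in>Basis. 1 / (1 + (x \<bullet> b)\<^sup>2))" for x :: R2
  proof -
    have "exp (- (norm x)\<^sup>2 / 4) = (\<Prod>b\<in>Basis. exp (- (x \<bullet> b)\<^sup>2 / 4))"
    proof -
      have "(norm x)\<^sup>2 = (\<Sum>b\<in>Basis. (x \<bullet> b)\<^sup>2)"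
        unfolding power2_norm_eq_inner by (subst euclidean_inner) (simp add: power2_eq_square)
      then show ?thesis
        by (simp add: exp_sum[symmetric] sum_negf sum_divide_distrib)
    qed
    also have "\<dots> \<le> (\<Prod>b\<in>Basis. 4 * (1 / (1 + (x \<bullet> b)\<^sup>2)))"
    proof (intro prod_mono conjI)
      fix b :: R2
      have "1 + (x \<bullet> b)\<^sup>2 / 4 \<le> exp ((x \<bullet> b)\<^sup>2 / 4)" by (rule exp_ge_add_one_self)
      then have "(1 + (x \<bullet> b)\<^sup>2) / 4 \<le> exp ((x \<bullet> b)\<^sup>2 / 4)" by (simp add: field_simps)
      then have "inverse (exp ((x \<bullet> b)\<^sup>2 / 4)) \<le> inverse ((1 + (x \<bullet> b)\<^sup>2) / 4)"
        by (intro le_imp_inverse_le) (auto intro: add_pos_nonneg)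
      then show "exp (- (x \<bullet> b)\<^sup>2 / 4) \<le> 4 * (1 / (1 + (x \<bullet> b)\<^sup>2))"
        by (simp add: exp_minus field_simps)
    qed simp
    also have "\<dots> = 16 * (\<Prod>b\<in>Basis. 1 / (1 + (x \<bullet> b)\<^sup>2))"
      by (simp only: prod.distrib prod_constant) simp
    finally show ?thesis .
  qed
  from ennreal_leI[OF this]
  have "(\<integral>\<^sup>+x. norm (heat 1 x) \<partial>lborel) \<le> (\<integral>\<^sup>+(x :: R2). 16 * (\<Prod>b\<in>Basis. ennreal (1 / (1 + (x \<bullet> b)\<^sup>2))) \<partial>lborel)"
    by (intro nn_integral_mono)
      (simp add: heat_def prod_ennreal ennreal_mult prod_nonneg)
  also have "\<dots> = 16 * (\<Prod>b\<in>(Basis :: R2 set). \<integral>\<^sup>+x. ennreal (1 / (1 + x\<^sup>2)) \<partial>lborel)"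
    using nn_integral_lborel_prod[where f="\<lambda>(_ :: R2) x. ennreal (1 / (1 + x\<^sup>2))"]
    by (simp add: nn_integral_cmult)
  also have "\<dots> < \<infinity>"
    using nn_integral_inverse_1_plus_square
    by (simp add: ennreal_mult_less_top power_less_top_ennreal)
  finally show ?thesis by (simp add: integrable_iff_bounded)
qed

lemma nn_integral_heat: "t > 0 \<Longrightarrow> (\<integral>\<^sup>+x. ennreal (heat t x) \<partial>lborel) = ennreal heat_mass"
proof -
  assume t: "t > 0"
  have "(\<integral>\<^sup>+x. ennreal (heat t x) \<partial>lborel) = ennreal ((sqrt t)\<^sup>2) * (\<integral>\<^sup>+x. ennreal (heat t (0 + sqrt t *\<^sub>R x)) \<partial>lborel)"
    using t by (intro nn_integral_lborel_affine) auto
  also have "\<dots> = (\<integral>\<^sup>+x. ennreal t * ennreal (heat t (sqrt t *\<^sub>R x)) \<partial>lborel)"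
    using t by (subst nn_integral_cmult) auto
  also have "\<dots> = (\<integral>\<^sup>+x. ennreal (heat 1 x) \<partial>lborel)"
    using t by (intro nn_integral_cong) (simp add: heat_scale heat_nonneg flip: ennreal_mult)
  also have "\<dots> = ennreal heat_mass"
    unfolding heat_mass_def by (intro nn_integral_eq_integral heat_1_integrable) (auto simp: heat_nonneg)
  finally show ?thesis .
qed

lemma heat_mass_pos: "heat_mass > 0"
proof -
  have "heat_mass \<noteq> 0"
  proof
    assume "heat_mass = 0"
    then have "AE x in lborel. heat 1 (x :: R2) = 0"
      using integral_nonneg_eq_0_iff_AE[OF heat_1_integrable] by (simp add: heat_mass_def heat_nonneg)
    then have "AE x in (lborel :: R2 measure). False"
      by (simp add: heat_def)
    then show False by (simp add: eventually_False ae_filter_eq_bot_iff)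
  qed
  moreover have "heat_mass \<ge> 0" by (simp add: heat_mass_def heat_nonneg integral_nonneg)
  ultimately show ?thesis by simp
qed

text \<open>The square of a Gaussian is a multiple of the Gaussian at half the time.\<close>

lemma nn_integral_heat_sq:
  assumes "t > 0"
  shows "(\<integral>\<^sup>+x. ennreal ((heat t x)\<^sup>2) \<partial>lborel) = ennreal (heat_mass / (2 * t))"
proof -
  have "(heat t x)\<^sup>2 = (1 / (2 * t)) * heat (t / 2) x" for x
  proof -
    have "(exp (- (norm x)\<^sup>2 / (4 * t)))\<^sup>2 = exp (- (norm x)\<^sup>2 / (4 * (t / 2)))"
      using assms by (simp add: power2_eq_square field_simps flip: exp_add)
    then show ?thesis
      using assms by (simp add: heat_def power_divide power2_eq_square)
  qed
  then have "(\<integral>\<^sup>+x. ennreal ((heat t x)\<^sup>2) \<partial>lborel) = (\<integral>\<^sup>+x. ennreal (1 / (2 * t)) * ennreal (heat (t / 2) x) \<partial>lborel)"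
    using assms by (intro nn_integral_cong, simp only:) (rule ennreal_mult, auto simp: heat_nonneg)
  also have "\<dots> = ennreal (1 / (2 * t)) * ennreal heat_mass"
    using assms by (simp add: nn_integral_cmult nn_integral_heat)
  also have "\<dots> = ennreal (heat_mass / (2 * t))"
    using assms heat_mass_pos by (simp flip: ennreal_mult)
  finally show ?thesis .
qed

lemma nn_integral_exp_powr: "(\<integral>\<^sup>+t. ennreal (indicator {0<..} t * (t powr (- 1/2) * exp (- t))) \<partial>lborel) < \<infinity>"
proof -
  have *: "((\<lambda>t. t powr (1/2 - 1) / exp t) has_integral Gamma (1/2 :: real)) {0..}"
    by (rule Gamma_integral_real) simp
  have "(\<integral>\<^sup>+t. ennreal (indicator {0<..} t * (t powr (- 1/2) * exp (- t))) \<partial>lborel)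
    \<le> (\<integral>\<^sup>+t. ennreal (t powr (1/2 - 1) / exp t) * indicator {0..} t \<partial>lborel)"
    by (intro nn_integral_mono) (auto simp: exp_minus inverse_eq_divide split: split_indicator)
  also have "\<dots> = ennreal (Gamma (1/2 :: real))"
    by (rule nn_integral_has_integral_lebesgue'[OF _ *]) simp
  also have "\<dots> < \<infinity>" by simp
  finally show ?thesis .
qed

text \<open>The Laplace transform of the heat semigroup at 1. At \<open>x = 0\<close> the integral diverges and the
  Bochner integral returns 0; the kernel still has to be divided by \<open>heat_mass\<close>.\<close>

definition resolvent_kernel :: "R2 \<Rightarrow> complex" where
  "resolvent_kernel x = (LINT t|lborel. of_real (indicator {0<..} t * exp (- t) * heat t x))"

text \<open>The squared L^2 norm of \<open>heat t\<close> is of order 1/t, so plain Cauchy-Schwarz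
  in \<open>t\<close> would end in the divergent integral of e^(-t)/t. The weights t^(-1/4) and
  t^(1/4) spread the singularity: after integration over the plane, both factors are multiples of
  the Gamma integral of t^(-1/2) e^(-t).\<close>

lemma resolvent_kernel_Lp2: "resolvent_kernel \<in> Lp 2"
proof -
  have [measurable]: "resolvent_kernel \<in> borel_measurable borel"
    unfolding resolvent_kernel_def by measurable
  let ?w = "\<lambda>t::real. ennreal (indicator {0<..} t * (t powr (- 1/2) * exp (- t)))"
  let ?v = "\<lambda>t::real. ennreal (indicator {0<..} t * (t powr (1/2) * exp (- t)))"
  have pt: "ennreal ((norm (resolvent_kernel x))\<^sup>2) \<le> (\<integral>\<^sup>+t. ?w t \<partial>lborel) * (\<integral>\<^sup>+t. ?v t * ennreal ((heat t x)\<^sup>2) \<partial>lborel)" for x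
  proof -
    let ?a = "\<lambda>t::real. ennreal (indicator {0<..} t * (t powr (- 1/4) * exp (- t / 2)))"
    let ?b = "\<lambda>t::real. ennreal (indicator {0<..} t * (t powr (1/4) * exp (- t / 2) * heat t x))"
    have "ennreal ((norm (resolvent_kernel x))\<^sup>2) = (ennreal (norm (resolvent_kernel x)))\<^sup>2"
      by (simp add: ennreal_power)
    also have "\<dots> \<le> (\<integral>\<^sup>+t. norm (complex_of_real (indicator {0<..} t * exp (- t) * heat t x)) \<partial>lborel)\<^sup>2"
      unfolding resolvent_kernel_def by (intro power_mono norm_integral_le_nn_integral) simp
    also have "(\<integral>\<^sup>+t. norm (complex_of_real (indicator {0<..} t * exp (- t) * heat t x)) \<partial>lborel)
        = (\<integral>\<^sup>+t. ?a t * ?b t \<partial>lborel)"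
    proof (intro nn_integral_cong)
      fix t :: real
      show "ennreal (norm (complex_of_real (indicator {0<..} t * exp (- t) * heat t x))) = ?a t * ?b t"
      proof (cases "t > 0")
        case True
        have "(t powr (- 1/4) * exp (- t / 2)) * (t powr (1/4) * exp (- t / 2) * heat t x)
            = (t powr (- 1/4) * t powr (1/4)) * (exp (- t / 2) * exp (- t / 2)) * heat t x"
          by (simp only: mult_ac)
        also have "\<dots> = exp (- t) * heat t x"
          using True by (simp flip: powr_add exp_add)
        finally have eq: "exp (- t) * heat t x
            = (t powr (- 1/4) * exp (- t / 2)) * (t powr (1/4) * exp (- t / 2) * heat t x)" ..
        have "norm (complex_of_real (indicator {0<..} t * exp (- t) * heat t x)) = exp (- t) * heat t x"
          using True by (simp add: heat_nonneg norm_mult)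
        then show ?thesis
          unfolding eq using True by (subst ennreal_mult[symmetric]) (auto simp: heat_nonneg)
      qed simp
    qed
    also have "(\<integral>\<^sup>+t. ?a t * ?b t \<partial>lborel)\<^sup>2 \<le> (\<integral>\<^sup>+t. (?a t)\<^sup>2 \<partial>lborel) * (\<integral>\<^sup>+t. (?b t)\<^sup>2 \<partial>lborel)"
      by (intro Cauchy_Schwarz_nn_integral) measurable
    also have "(\<integral>\<^sup>+t. (?a t)\<^sup>2 \<partial>lborel) = (\<integral>\<^sup>+t. ?w t \<partial>lborel)"
    proof (intro nn_integral_cong)
      fix t :: real
      have "(t powr (- 1/4) * exp (- t / 2))\<^sup>2 = t powr (- 1/2) * exp (- t)" if "t > 0"
        using that by (simp add: power_mult_distrib powr_power flip: exp_double)
      then show "(?a t)\<^sup>2 = ?w t" by (simp add: ennreal_power indicator_def)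
    qed
    also have "(\<integral>\<^sup>+t. (?b t)\<^sup>2 \<partial>lborel) = (\<integral>\<^sup>+t. ?v t * ennreal ((heat t x)\<^sup>2) \<partial>lborel)"
    proof (intro nn_integral_cong)
      fix t :: real
      have "(t powr (1/4) * exp (- t / 2) * heat t x)\<^sup>2 = t powr (1/2) * exp (- t) * (heat t x)\<^sup>2" if "t > 0"
        using that by (simp add: power_mult_distrib powr_power flip: exp_double)
      then show "(?b t)\<^sup>2 = ?v t * ennreal ((heat t x)\<^sup>2)"
        by (simp add: ennreal_power heat_nonneg indicator_def flip: ennreal_mult)
    qed
    finally show ?thesis .
  qed
  have "(\<integral>\<^sup>+x. ennreal ((norm (resolvent_kernel x))\<^sup>2) \<partial>lborel)
      \<le> (\<integral>\<^sup>+x. (\<integral>\<^sup>+t. ?w t \<partial>lborel) * (\<integral>\<^sup>+t. ?v t * ennreal ((heat t x)\<^sup>2) \<partial>lborel) \<partial>lborel)"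
    by (intro nn_integral_mono pt)
  also have "\<dots> = (\<integral>\<^sup>+t. ?w t \<partial>lborel) * (\<integral>\<^sup>+x. \<integral>\<^sup>+t. ?v t * ennreal ((heat t x)\<^sup>2) \<partial>lborel \<partial>lborel)"
    by (rule nn_integral_cmult) measurable
  also have "(\<integral>\<^sup>+x. \<integral>\<^sup>+t. ?v t * ennreal ((heat t x)\<^sup>2) \<partial>lborel \<partial>(lborel :: R2 measure))
      = (\<integral>\<^sup>+t. \<integral>\<^sup>+x. ?v t * ennreal ((heat t x)\<^sup>2) \<partial>lborel \<partial>lborel)"
    by (rule lborel_pair.Fubini') measurable
  also have "\<dots> = (\<integral>\<^sup>+t. ennreal (heat_mass / 2) * ?w t \<partial>lborel)"
  proof (intro nn_integral_cong)
    fix t :: real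
    show "(\<integral>\<^sup>+x. ?v t * ennreal ((heat t x)\<^sup>2) \<partial>lborel) = ennreal (heat_mass / 2) * ?w t"
    proof (cases "t > 0")
      case True
      have "t powr (1/2) / t = t powr (- 1/2)"
        using True powr_diff[of t "1/2" 1] by simp
      then have eq: "(t powr (1/2) * exp (- t)) * (heat_mass / (2 * t)) = heat_mass / 2 * (t powr (- 1/2) * exp (- t))"
        by (metis (no_types, opaque_lifting) mult.commute mult.left_commute times_divide_eq_left times_divide_times_eq)
      have "(\<integral>\<^sup>+x. ?v t * ennreal ((heat t x)\<^sup>2) \<partial>lborel) = ?v t * ennreal (heat_mass / (2 * t))"
        using True by (subst nn_integral_cmult) (auto simp: nn_integral_heat_sq)
      also have "\<dots> = ennreal ((t powr (1/2) * exp (- t)) * (heat_mass / (2 * t)))"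
        using True heat_mass_pos by (subst ennreal_mult) auto
      also have "\<dots> = ennreal (heat_mass / 2) * ?w t"
        unfolding eq using True heat_mass_pos by (subst ennreal_mult) auto
      finally show ?thesis .
    qed simp
  qed
  also have "\<dots> = ennreal (heat_mass / 2) * (\<integral>\<^sup>+t. ?w t \<partial>lborel)"
    by (rule nn_integral_cmult) measurable
  also have "(\<integral>\<^sup>+t. ?w t \<partial>lborel) * \<dots> < \<infinity>"
    using nn_integral_exp_powr by (simp add: ennreal_mult_less_top)
  finally show ?thesis by (simp add: Lp2_iff integrable_iff_bounded)
qed

lemma test_fun_norm_bound:
  assumes "\<psi> \<in> test_fun"
  obtains K where "\<And>x. norm (\<psi> x) \<le> K" "K \<ge> 0"
proof -
  have "compact (closure {x. \<psi> x \<noteq> 0})" using assms by (simp add: test_fun_def)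
  then have "compact (\<psi> ` closure {x. \<psi> x \<noteq> 0})"
    by (rule compact_continuous_image[OF test_fun_continuous[OF assms]])
  then obtain K where K: "\<And>y. y \<in> \<psi> ` closure {x. \<psi> x \<noteq> 0} \<Longrightarrow> norm y \<le> K"
    using compact_imp_bounded bounded_iff by metis
  have "norm (\<psi> x) \<le> max K 0" for x
    using K[of "\<psi> x"] closure_subset[of "{x. \<psi> x \<noteq> 0}"] by (cases "\<psi> x = 0") auto
  then show ?thesis using that[of "max K 0"] by simp
qed

lemma test_fun_laplacian: "\<psi> \<in> test_fun \<Longrightarrow> laplacian \<psi> \<in> test_fun"
  using test_fun_add[of "partial 1 (partial 1 \<psi>)" "partial 2 (partial 2 \<psi>)"]
  by (simp add: laplacian_def[abs_def] sum_2 test_fun_partial)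

lemma integrable_continuous_mult_test_fun:
  fixes f :: "R2 \<Rightarrow> complex"
  assumes "continuous_on UNIV f" "\<psi> \<in> test_fun"
  shows "integrable lborel (\<lambda>x. f x * \<psi> x)"
  by (rule integrable_continuous_bounded_support[OF continuous_on_mult[OF assms(1) test_fun_continuous[OF assms(2)]]],
      rule bounded_subset[OF test_fun_bounded[OF assms(2)]]) auto

lemma heat_has_derivative:
  assumes "t > 0"
  shows "(heat t has_derivative (\<lambda>h. - (x \<bullet> h) / (2 * t) * heat t x)) (at x)"
proof -
  have "((\<lambda>x. exp (- (x \<bullet> x) / (4 * t)) / t) has_derivative (\<lambda>h. - (x \<bullet> h) / (2 * t) * heat t x)) (at x)"
    using assms
    by (auto intro!: derivative_eq_intros ext simp: heat_def power2_norm_eq_inner inner_commute field_simps)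
  then show ?thesis
    by (simp add: heat_def[abs_def] power2_norm_eq_inner)
qed

lemma partial_heat:
  assumes "t > 0"
  shows "(\<lambda>x. complex_of_real (heat t x)) differentiable at x"
    and "partial i (\<lambda>x. complex_of_real (heat t x)) = (\<lambda>x. of_real (- (x $ i) / (2 * t) * heat t x))"
proof -
  have *: "((\<lambda>x. complex_of_real (heat t x)) has_derivative (\<lambda>h. of_real (- (x \<bullet> h) / (2 * t) * heat t x))) (at x)" for x
    by (rule has_derivative_of_real[OF heat_has_derivative[OF assms]])
  show "(\<lambda>x. complex_of_real (heat t x)) differentiable at x"
    using * by (auto simp: differentiable_def)
  show "partial i (\<lambda>x. complex_of_real (heat t x)) = (\<lambda>x. of_real (- (x $ i) / (2 * t) * heat t x))"
    by (rule ext, subst partial_eqI[OF *]) (simp add: inner_axis)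
qed

lemma partial_partial_heat:
  assumes "t > 0"
  shows "(\<lambda>x. complex_of_real (- (x $ i) / (2 * t) * heat t x)) differentiable at x"
    and "partial i (\<lambda>x. complex_of_real (- (x $ i) / (2 * t) * heat t x))
      = (\<lambda>x. of_real (((x $ i)\<^sup>2 / (4 * t\<^sup>2) - 1 / (2 * t)) * heat t x))"
proof -
  have "((\<lambda>x. - (x $ i) / (2 * t)) has_derivative (\<lambda>h. - (h $ i) / (2 * t))) (at x)" for x :: R2
    using assms by (auto intro!: derivative_eq_intros bounded_linear.has_derivative[OF bounded_linear_vec_nth])
  from has_derivative_of_real[OF has_derivative_mult[OF this heat_has_derivative[OF assms]]]
  have *: "((\<lambda>x. complex_of_real (- (x $ i) / (2 * t) * heat t x)) has_derivative
      (\<lambda>h. of_real (- (x $ i) / (2 * t) * (- (x \<bullet> h) / (2 * t) * heat t x) + - (h $ i) / (2 * t) * heat t x))) (at x)" for x .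
  show "(\<lambda>x. complex_of_real (- (x $ i) / (2 * t) * heat t x)) differentiable at x"
    unfolding differentiable_def using * by blast
  show "partial i (\<lambda>x. complex_of_real (- (x $ i) / (2 * t) * heat t x))
      = (\<lambda>x. of_real (((x $ i)\<^sup>2 / (4 * t\<^sup>2) - 1 / (2 * t)) * heat t x))"
  proof
    fix x
    show "partial i (\<lambda>x. complex_of_real (- (x $ i) / (2 * t) * heat t x)) x
      = of_real (((x $ i)\<^sup>2 / (4 * t\<^sup>2) - 1 / (2 * t)) * heat t x)"
      unfolding partial_eqI[OF *] of_real_eq_iff using assms
      by (simp add: inner_axis) (simp add: field_simps power2_eq_square)
  qed
qed

text \<open>The common value of the time derivative and the Laplacian of the kernel; each coordinate
  contributes x_i^2/(4 t^2) - 1/(2 t) times \<open>heat t x\<close> to the latter.\<close>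

definition heat_dt :: "real \<Rightarrow> R2 \<Rightarrow> real" where
  "heat_dt t x = ((norm x)\<^sup>2 / (4 * t\<^sup>2) - 1 / t) * heat t x"

lemma measurable_heat_dt [measurable]: "(\<lambda>(t, x). heat_dt t x) \<in> borel_measurable (lborel \<Otimes>\<^sub>M lborel)"
  unfolding heat_dt_def by measurable

lemma continuous_heat: "t > 0 \<Longrightarrow> continuous_on A (heat t)"
  unfolding heat_def by (intro continuous_intros) auto

lemma heat_deriv_time:
  assumes "t > 0"
  shows "((\<lambda>t. heat t x) has_real_derivative heat_dt t x) (at t)"
  unfolding heat_def heat_dt_def using assms
  by (auto intro!: derivative_eq_intros simp: field_simps power2_eq_square)

lemma heat_solves_heat_equation:
  assumes t: "t > 0" and \<psi>: "\<psi> \<in> test_fun"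
  shows "(LINT x|lborel. of_real (heat t x) * laplacian \<psi> x) = (LINT x|lborel. of_real (heat_dt t x) * \<psi> x)"
proof -
  let ?H = "\<lambda>x. complex_of_real (heat t x)"
  let ?H1 = "\<lambda>i x. complex_of_real (- (x $ i) / (2 * t) * heat t x)"
  let ?H2 = "\<lambda>i x. complex_of_real (((x $ i)\<^sup>2 / (4 * t\<^sup>2) - 1 / (2 * t)) * heat t x)"
  have c: "continuous_on UNIV ?H" "continuous_on UNIV (?H1 i)" "continuous_on UNIV (?H2 i)" for i
    using t by (auto intro!: continuous_intros continuous_heat)
  have "(LINT x|lborel. ?H x * laplacian \<psi> x) = (LINT x|lborel. (\<Sum>i\<in>UNIV. ?H x * partial i (partial i \<psi>) x))"
    by (simp add: laplacian_def sum_distrib_left)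
  also have "\<dots> = (\<Sum>i\<in>UNIV. LINT x|lborel. ?H x * partial i (partial i \<psi>) x)"
    by (intro Bochner_Integration.integral_sum integrable_continuous_mult_test_fun c test_fun_partial \<psi>)
  also have "\<dots> = (\<Sum>i\<in>UNIV. LINT x|lborel. ?H2 i x * \<psi> x)"
  proof (rule sum.cong[OF refl])
    fix i
    have "(LINT x|lborel. ?H x * partial i (partial i \<psi>) x) = - (LINT x|lborel. partial i ?H x * partial i \<psi> x)"
      using c(2) by (intro integral_by_parts_test_fun partial_heat(1) t test_fun_partial \<psi>)
        (simp only: partial_heat(2)[OF t])
    also have "\<dots> = (LINT x|lborel. partial i (?H1 i) x * \<psi> x)"
      unfolding partial_heat(2)[OF t] using c(3)
      by (subst integral_by_parts_test_fun[OF partial_partial_heat(1)[OF t] _ \<psi>])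
        (simp_all only: partial_partial_heat(2)[OF t] minus_minus)
    finally show "(LINT x|lborel. ?H x * partial i (partial i \<psi>) x) = (LINT x|lborel. ?H2 i x * \<psi> x)"
      unfolding partial_partial_heat(2)[OF t] .
  qed
  also have "\<dots> = (LINT x|lborel. (\<Sum>i\<in>UNIV. ?H2 i x * \<psi> x))"
    by (intro Bochner_Integration.integral_sum[symmetric] integrable_continuous_mult_test_fun c \<psi>)
  also have "\<dots> = (LINT x|lborel. of_real (heat_dt t x) * \<psi> x)"
  proof (intro Bochner_Integration.integral_cong refl)
    fix x :: R2
    have n: "(norm x)\<^sup>2 = (x $ 1)\<^sup>2 + (x $ 2)\<^sup>2"
      unfolding power2_norm_eq_inner inner_vec_def sum_2 by (simp add: power2_eq_square)
    have "(\<Sum>i\<in>UNIV. ((x $ i)\<^sup>2 / (4 * t\<^sup>2) - 1 / (2 * t)) * heat t x) = heat_dt t x"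
      using t by (simp add: sum_2 heat_dt_def n field_simps)
    then have "(\<Sum>i\<in>UNIV. ?H2 i x) = of_real (heat_dt t x)"
      by (simp only: of_real_sum[symmetric])
    then show "(\<Sum>i\<in>UNIV. ?H2 i x * \<psi> x) = of_real (heat_dt t x) * \<psi> x"
      by (simp only: sum_distrib_right[symmetric])
  qed
  finally show ?thesis .
qed

text \<open>Exchanging the integrals reduces this to the fundamental theorem in \<open>t\<close> for
  fixed x. The time stays away from 0 and \<psi> has bounded support, which keeps the terms 1/t and
  |x|^2/t^2 of the integrand bounded.\<close>

lemma heat_time_integral:
  assumes ab: "0 < a" "a \<le> b" and \<psi>: "\<psi> \<in> test_fun"
  shows "(LINT t|lborel. of_real (indicator {a..b} t * exp (- t)) *
      (LINT x|lborel. of_real (heat t x) * (- laplacian \<psi> x + \<psi> x)))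
    = of_real (exp (- a)) * (LINT x|lborel. of_real (heat a x) * \<psi> x)
      - of_real (exp (- b)) * (LINT x|lborel. of_real (heat b x) * \<psi> x)"
proof -
  let ?h = "\<lambda>t x. exp (- t) * (heat t x - heat_dt t x)"
  let ?k = "\<lambda>t x. complex_of_real (indicator {a..b} t * ?h t x) * \<psi> x"
  have [measurable]: "\<psi> \<in> borel_measurable borel"
    using test_fun_Lp2[OF \<psi>] by measurable
  have ic: "integrable lborel (\<lambda>x. of_real (heat t x) * \<eta> x)" if "t > 0" "\<eta> \<in> test_fun" for t \<eta>
    using that by (intro integrable_continuous_mult_test_fun continuous_intros continuous_heat)
  obtain R where R: "R \<ge> 0" "\<And>x. \<psi> x \<noteq> 0 \<Longrightarrow> norm x \<le> R"
    using test_fun_bounded[OF \<psi>] unfolding bounded_iff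
    by (metis (mono_tags, lifting) linorder_linear mem_Collect_eq order_trans)
  \<comment> \<open>A bound for \<open>heat t x\<close> times a bound for the factor that multiplies
    it in \<open>heat t x - heat_dt t x\<close>.\<close>
  define M where "M = (1 / a) * (1 + (R\<^sup>2 / (4 * a\<^sup>2) + 1 / a))"
  have M0: "M \<ge> 0" using ab by (simp add: M_def)
  have kb: "norm (?k t x) \<le> indicator {a..b} t * M * norm (\<psi> x)" for t x
  proof (cases "t \<in> {a..b} \<and> \<psi> x \<noteq> 0")
    case True
    then have t: "a \<le> t" "t > 0" using ab by auto
    have nx: "(norm x)\<^sup>2 \<le> R\<^sup>2" using R True by (intro power_mono) auto
    have h1: "heat t x \<le> 1 / a"
      unfolding heat_def using t ab by (intro frac_le) auto
    have "\<bar>1 - ((norm x)\<^sup>2 / (4 * t\<^sup>2) - 1 / t)\<bar> \<le> 1 + ((norm x)\<^sup>2 / (4 * t\<^sup>2) + 1 / t)"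
      using t by (simp add: abs_if)
    also have "\<dots> \<le> 1 + (R\<^sup>2 / (4 * a\<^sup>2) + 1 / a)"
      using t ab nx by (intro add_left_mono add_mono frac_le) (auto intro: power_mono)
    finally have h2: "\<bar>1 - ((norm x)\<^sup>2 / (4 * t\<^sup>2) - 1 / t)\<bar> \<le> 1 + (R\<^sup>2 / (4 * a\<^sup>2) + 1 / a)" .
    have "\<bar>?h t x\<bar> = exp (- t) * (heat t x * \<bar>1 - ((norm x)\<^sup>2 / (4 * t\<^sup>2) - 1 / t)\<bar>)"
    proof -
      have "heat t x - heat_dt t x = heat t x * (1 - ((norm x)\<^sup>2 / (4 * t\<^sup>2) - 1 / t))"
        by (simp add: heat_dt_def algebra_simps)
      then show ?thesis using t by (simp only: abs_mult abs_exp_cancel) (simp add: heat_nonneg)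
    qed
    also have "\<dots> \<le> 1 * M"
      unfolding M_def using t ab h1 h2 by (intro mult_mono) (auto simp: heat_nonneg)
    finally have "\<bar>?h t x\<bar> \<le> M" by simp
    then have "\<bar>?h t x\<bar> * norm (\<psi> x) \<le> M * norm (\<psi> x)" by (rule mult_right_mono) simp
    moreover have "norm (?k t x) = \<bar>?h t x\<bar> * norm (\<psi> x)"
      using True by (simp only: norm_mult norm_of_real) simp
    ultimately show ?thesis using True by simp
  qed (use M0 in auto)
  have "(\<integral>\<^sup>+t. \<integral>\<^sup>+x. norm (?k t x) \<partial>lborel \<partial>lborel)
      \<le> (\<integral>\<^sup>+t. \<integral>\<^sup>+x. ennreal (indicator {a..b} t * M) * ennreal (norm (\<psi> x)) \<partial>lborel \<partial>lborel)"
    using kb M0 by (intro nn_integral_mono) (simp add: ennreal_leI flip: ennreal_mult)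
  also have "\<dots> = (\<integral>\<^sup>+t. ennreal (indicator {a..b} t * M) * (\<integral>\<^sup>+x. norm (\<psi> x) \<partial>lborel) \<partial>lborel)"
    by (simp add: nn_integral_cmult)
  also have "\<dots> = (\<integral>\<^sup>+t. ennreal M * indicator {a..b} t \<partial>lborel) * (\<integral>\<^sup>+x. norm (\<psi> x) \<partial>lborel)"
    by (subst nn_integral_multc) (auto intro!: arg_cong2[where f="(*)"] nn_integral_cong split: split_indicator)
  also have "\<dots> < \<infinity>"
    using ab test_fun_integrable[OF \<psi>]
    by (simp add: nn_integral_cmult ennreal_mult_less_top integrable_iff_bounded)
  finally have "(LINT x|lborel. LINT t|lborel. ?k t x) = (LINT t|lborel. LINT x|lborel. ?k t x)"
    by (intro Fubini_norm_eq) measurable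
  moreover have "(LINT t|lborel. ?k t x) = of_real (exp (- a) * heat a x - exp (- b) * heat b x) * \<psi> x" for x
  proof -
    have "(LINT t|lborel. indicator {a..b} t *\<^sub>R ?h t x) = (- exp (- b) * heat b x) - (- exp (- a) * heat a x)"
    proof (rule integral_FTC_atLeastAtMost)
      show "((\<lambda>t. - exp (- t) * heat t x) has_vector_derivative ?h t x) (at t within {a..b})" if "a \<le> t" "t \<le> b" for t
      proof -
        have "((\<lambda>t. - exp (- t) * heat t x) has_real_derivative ?h t x) (at t)"
          using that ab by (auto intro!: derivative_eq_intros heat_deriv_time simp: algebra_simps)
        then show ?thesis
          by (simp add: has_real_derivative_iff_has_vector_derivative has_vector_derivative_at_within)
      qed
      show "continuous_on {a..b} (\<lambda>t. ?h t x)"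
        unfolding heat_def heat_dt_def using ab by (intro continuous_intros) auto
    qed (use ab in auto)
    then have "(LINT t|lborel. indicator {a..b} t * ?h t x) = exp (- a) * heat a x - exp (- b) * heat b x"
      by simp
    then show ?thesis
      by (simp only: integral_mult_left_zero integral_complex_of_real)
  qed
  moreover have "(LINT x|lborel. ?k t x) = of_real (indicator {a..b} t * exp (- t)) *
      (LINT x|lborel. of_real (heat t x) * (- laplacian \<psi> x + \<psi> x))" for t
  proof (cases "t \<in> {a..b}")
    case True
    then have t: "t > 0" using ab by auto
    have "(LINT x|lborel. of_real (heat t x) * (- laplacian \<psi> x + \<psi> x))
      = (LINT x|lborel. of_real (heat t x) * \<psi> x - of_real (heat t x) * laplacian \<psi> x)"
      by (intro Bochner_Integration.integral_cong) (simp_all add: algebra_simps)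
    also have "\<dots> = (LINT x|lborel. of_real (heat t x) * \<psi> x) - (LINT x|lborel. of_real (heat_dt t x) * \<psi> x)"
      using ic[OF t] \<psi> test_fun_laplacian[OF \<psi>]
      by (simp add: heat_solves_heat_equation[OF t \<psi>])
    also have "\<dots> = (LINT x|lborel. of_real (heat t x) * \<psi> x - of_real (heat_dt t x) * \<psi> x)"
    proof (rule Bochner_Integration.integral_diff[symmetric])
      show "integrable lborel (\<lambda>x. of_real (heat_dt t x) * \<psi> x)"
        unfolding heat_dt_def using t \<psi>
        by (intro integrable_continuous_mult_test_fun continuous_intros continuous_heat) auto
    qed (rule ic[OF t \<psi>])
    also have "of_real (indicator {a..b} t * exp (- t)) * \<dots> = (LINT x|lborel. ?k t x)"
      using True by (subst integral_mult_right_zero[symmetric]) (simp add: algebra_simps)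
    finally show ?thesis ..
  qed simp
  ultimately have "(LINT t|lborel. of_real (indicator {a..b} t * exp (- t)) *
      (LINT x|lborel. of_real (heat t x) * (- laplacian \<psi> x + \<psi> x)))
    = (LINT x|lborel. of_real (exp (- a) * heat a x - exp (- b) * heat b x) * \<psi> x)"
    by (simp only:)
  also have "\<dots> = (LINT x|lborel. of_real (exp (- a)) * (of_real (heat a x) * \<psi> x) - of_real (exp (- b)) * (of_real (heat b x) * \<psi> x))"
    by (intro Bochner_Integration.integral_cong) (simp_all add: algebra_simps)
  also have "\<dots> = of_real (exp (- a)) * (LINT x|lborel. of_real (heat a x) * \<psi> x)
      - of_real (exp (- b)) * (LINT x|lborel. of_real (heat b x) * \<psi> x)"
    using ic[OF _ \<psi>] ab by (subst Bochner_Integration.integral_diff) (auto simp del: of_real_exp)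
  finally show ?thesis .
qed

text \<open>Time c^2 corresponds to length c: substituting x = c y turns the kernel into
  \<open>heat 1 y\<close>, and \<psi> (c y) tends to \<psi> 0 boundedly. Taking the times as squares
  keeps roots out of the substitution.\<close>

lemma heat_delta_limit:
  assumes \<psi>: "\<psi> \<in> test_fun"
  shows "(\<lambda>n. LINT x|lborel. of_real (heat ((1 / Suc n)\<^sup>2) x) * \<psi> x) \<longlonglongrightarrow> of_real heat_mass * \<psi> 0"
proof -
  obtain K where K: "\<And>x. norm (\<psi> x) \<le> K" "K \<ge> 0" using test_fun_norm_bound[OF \<psi>] by blast
  have [measurable]: "\<psi> \<in> borel_measurable borel"
    using test_fun_Lp2[OF \<psi>] by measurable
  have "(LINT x|lborel. of_real (heat (c\<^sup>2) x) * \<psi> x) = (LINT x|lborel. of_real (heat 1 x) * \<psi> (c *\<^sub>R x))"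
    if c: "c > 0" for c
  proof -
    have "(LINT x|lborel. of_real (heat (c\<^sup>2) x) * \<psi> x)
        = c\<^sup>2 *\<^sub>R (LINT x|lborel. of_real (heat (c\<^sup>2) (0 + c *\<^sub>R x)) * \<psi> (0 + c *\<^sub>R x))"
      using c integral_lborel_affine[of c "\<lambda>x. of_real (heat (c\<^sup>2) x) * \<psi> x" 0] by simp
    also have "\<dots> = (LINT x|lborel. c\<^sup>2 *\<^sub>R (of_real (heat (c\<^sup>2) (c *\<^sub>R x)) * \<psi> (c *\<^sub>R x)))"
      by simp
    also have "\<dots> = (LINT x|lborel. of_real (heat 1 x) * \<psi> (c *\<^sub>R x))"
      using c heat_scale[of "c\<^sup>2"]
      by (intro Bochner_Integration.integral_cong) (simp_all add: scaleR_conv_of_real[where 'a = complex])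
    finally show ?thesis .
  qed
  then have eq: "(LINT x|lborel. of_real (heat ((1 / Suc n)\<^sup>2) x) * \<psi> x)
      = (LINT x|lborel. of_real (heat 1 x) * \<psi> ((1 / Suc n) *\<^sub>R x))" for n
    by simp
  have "(\<lambda>n. LINT x|lborel. of_real (heat 1 x) * \<psi> ((1 / Suc n) *\<^sub>R x)) \<longlonglongrightarrow> (LINT x|lborel. of_real (heat 1 x) * \<psi> 0)"
  proof (rule integral_dominated_convergence)
    show "integrable lborel (\<lambda>x. heat 1 x * K)" using heat_1_integrable by simp
    show "AE x in lborel. norm (of_real (heat 1 x) * \<psi> ((1 / Suc n) *\<^sub>R x)) \<le> heat 1 x * K" for n
      using K by (simp add: norm_mult heat_nonneg mult_left_mono)
    have "(\<lambda>n. \<psi> ((1 / Suc n) *\<^sub>R x)) \<longlonglongrightarrow> \<psi> (0 *\<^sub>R x)" for x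
      by (intro isCont_tendsto_compose[of _ \<psi>] tendsto_scaleR tendsto_const LIMSEQ_Suc[OF lim_1_over_n]
          differentiable_imp_continuous_within test_fun_differentiable[OF \<psi>])
    then show "AE x in lborel. (\<lambda>n. of_real (heat 1 x) * \<psi> ((1 / Suc n) *\<^sub>R x)) \<longlonglongrightarrow> of_real (heat 1 x) * \<psi> 0"
      by (intro always_eventually allI tendsto_mult tendsto_const) simp
  qed measurable
  then show ?thesis
    unfolding eq by (simp add: heat_mass_def)
qed

text \<open>By the heat equation, \<open>e\<^bsup>-t\<^esup> \<integral> h\<^sub>t (\<psi> - \<Delta>\<psi>)\<close> is the time derivative of \<open>- e\<^bsup>-t\<^esup> \<integral> h\<^sub>t \<psi>\<close>,
  which is integrated over \<open>[1/n\<^sup>2, n]\<close>.\<close>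

lemma resolvent_kernel_equation:
  assumes \<psi>: "\<psi> \<in> test_fun"
  shows "(LINT x|lborel. resolvent_kernel x * (- laplacian \<psi> x + \<psi> x)) = of_real heat_mass * \<psi> 0"
proof -
  define \<eta> where "\<eta> = (\<lambda>x. - laplacian \<psi> x + \<psi> x)"
  define f where "f t = of_real (indicator {0<..} t * exp (- t)) * (LINT x|lborel. of_real (heat t x) * \<eta> x)" for t :: real
  have \<eta>: "\<eta> \<in> test_fun"
    using test_fun_add[OF test_fun_cmult[OF test_fun_laplacian[OF \<psi>], of "- 1"] \<psi>] by (simp add: \<eta>_def)
  have [measurable]: "\<eta> \<in> borel_measurable borel" using test_fun_Lp2[OF \<eta>] by measurable
  obtain K where K: "\<And>x. norm (\<eta> x) \<le> K" "K \<ge> 0" using test_fun_norm_bound[OF \<eta>] by blast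
  obtain K' where K': "\<And>x. norm (\<psi> x) \<le> K'" "K' \<ge> 0" using test_fun_norm_bound[OF \<psi>] by blast
  have hb: "(\<integral>\<^sup>+x. norm (complex_of_real (heat t x) * g x) \<partial>lborel) \<le> ennreal (heat_mass * C)"
    if "t > 0" "\<And>x. norm (g x) \<le> C" "C \<ge> 0" for t g C
  proof -
    have "(\<integral>\<^sup>+x. norm (complex_of_real (heat t x) * g x) \<partial>lborel) \<le> (\<integral>\<^sup>+x. ennreal (heat t x) * ennreal C \<partial>lborel)"
      using that by (intro nn_integral_mono)
        (simp add: norm_mult heat_nonneg ennreal_leI mult_left_mono flip: ennreal_mult)
    also have "\<dots> = ennreal (heat_mass * C)"
      using that heat_mass_pos by (simp add: nn_integral_multc nn_integral_heat ennreal_mult)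
    finally show ?thesis .
  qed
  have mb: "norm (LINT x|lborel. of_real (heat t x) * g x) \<le> heat_mass * C"
    if "t > 0" "\<And>x. norm (g x) \<le> C" "C \<ge> 0" for t C and g :: "R2 \<Rightarrow> complex"
  proof -
    have "ennreal (norm (LINT x|lborel. of_real (heat t x) * g x)) \<le> ennreal (heat_mass * C)"
      using norm_integral_le_nn_integral hb[OF that] by (rule order_trans)
    then show ?thesis using that(3) heat_mass_pos by (simp add: ennreal_le_iff)
  qed
  have exp_int: "(\<integral>\<^sup>+t. ennreal (exp (- t)) * indicator {0..} t \<partial>lborel) = ennreal (0 - (- exp (- 0)))"
  proof (rule nn_integral_FTC_atLeast)
    show "((\<lambda>t. - exp (- t)) \<longlongrightarrow> (0::real)) at_top"
      by (intro tendsto_minus_cancel_left[THEN iffD1]) (simp add: filterlim_compose[OF exp_at_bot filterlim_uminus_at_bot_at_top])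
  qed (auto intro!: derivative_eq_intros)
  have "(\<integral>\<^sup>+t. ennreal (indicator {0<..} t * exp (- t)) \<partial>lborel)
      \<le> (\<integral>\<^sup>+t. ennreal (exp (- t)) * indicator {0..} t \<partial>lborel)"
    by (intro nn_integral_mono) (auto split: split_indicator)
  then have efin: "(\<integral>\<^sup>+t. ennreal (indicator {0<..} t * exp (- t)) \<partial>lborel) < \<infinity>"
    unfolding exp_int by (rule le_less_trans) simp
  have eint: "integrable lborel (\<lambda>t. indicator {0<..} t * exp (- t) :: real)"
    using efin by (simp add: integrable_iff_bounded abs_mult)
  let ?k = "\<lambda>t x. complex_of_real (indicator {0<..} t * exp (- t) * heat t x) * \<eta> x"
  have "(\<integral>\<^sup>+t. \<integral>\<^sup>+x. norm (?k t x) \<partial>lborel \<partial>lborel)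
      \<le> (\<integral>\<^sup>+t. ennreal (indicator {0<..} t * exp (- t)) * ennreal (heat_mass * K) \<partial>lborel)"
  proof (rule nn_integral_mono)
    fix t :: real
    have "(\<integral>\<^sup>+x. norm (?k t x) \<partial>lborel) = (\<integral>\<^sup>+x. ennreal (indicator {0<..} t * exp (- t)) * ennreal (norm (complex_of_real (heat t x) * \<eta> x)) \<partial>lborel)"
      by (intro nn_integral_cong) (simp add: norm_mult abs_mult mult.assoc flip: ennreal_mult)
    also have "\<dots> = ennreal (indicator {0<..} t * exp (- t)) * (\<integral>\<^sup>+x. norm (complex_of_real (heat t x) * \<eta> x) \<partial>lborel)"
      by (rule nn_integral_cmult) measurable
    also have "\<dots> \<le> ennreal (indicator {0<..} t * exp (- t)) * ennreal (heat_mass * K)"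
      using hb[of t \<eta> K] K by (cases "t > 0") (auto intro!: mult_left_mono)
    finally show "(\<integral>\<^sup>+x. norm (?k t x) \<partial>lborel) \<le> ennreal (indicator {0<..} t * exp (- t)) * ennreal (heat_mass * K)" .
  qed
  also have "\<dots> < \<infinity>"
    using efin by (simp add: nn_integral_multc ennreal_mult_less_top)
  finally have "(LINT x|lborel. LINT t|lborel. ?k t x) = (LINT t|lborel. LINT x|lborel. ?k t x)"
    by (intro Fubini_norm_eq) measurable
  moreover have "(LINT t|lborel. ?k t x) = resolvent_kernel x * \<eta> x" for x
    unfolding resolvent_kernel_def by (rule integral_mult_left_zero)
  moreover have "(LINT x|lborel. ?k t x) = f t" for t
    unfolding f_def by (subst integral_mult_right_zero[symmetric]) (simp only: of_real_mult mult.assoc)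
  ultimately have eq: "(LINT x|lborel. resolvent_kernel x * \<eta> x) = (LINT t|lborel. f t)" by (simp only:)
  \<comment> \<open>The intervals exhaust the positive half-line; the lower end is a square to match
    \<open>heat_delta_limit\<close>.\<close>
  let ?a = "\<lambda>n. (1 / real (Suc n))\<^sup>2" and ?b = "\<lambda>n. real (Suc n)"
  let ?m = "\<lambda>t. LINT x|lborel. complex_of_real (heat t x) * \<psi> x"
  have fm [measurable]: "f \<in> borel_measurable borel"
    unfolding f_def by measurable
  have fb: "norm (f t) \<le> indicator {0<..} t * exp (- t) * (heat_mass * K)" for t
    using mb[of t \<eta> K] K by (cases "t > 0") (auto simp: f_def norm_mult mult_left_mono)
  have lim1: "(\<lambda>n. LINT t|lborel. of_real (indicator {?a n..?b n} t) * f t) \<longlonglongrightarrow> (LINT t|lborel. f t)"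
  proof (rule integral_dominated_convergence)
    show "integrable lborel (\<lambda>t. indicator {0<..} t * exp (- t) * (heat_mass * K))"
      using eint by (rule integrable_mult_left)
    show "AE t in lborel. norm (of_real (indicator {?a n..?b n} t) * f t) \<le> indicator {0<..} t * exp (- t) * (heat_mass * K)" for n
    proof (intro always_eventually allI)
      fix t
      have "norm (of_real (indicator {?a n..?b n} t) * f t) \<le> norm (f t)"
        by (auto simp: norm_mult split: split_indicator)
      with fb[of t] show "norm (of_real (indicator {?a n..?b n} t) * f t) \<le> indicator {0<..} t * exp (- t) * (heat_mass * K)"
        by linarith
    qed
    show "AE t in lborel. (\<lambda>n. of_real (indicator {?a n..?b n} t) * f t) \<longlonglongrightarrow> f t"
    proof (intro always_eventually allI)
      fix t
      show "(\<lambda>n. of_real (indicator {?a n..?b n} t) * f t) \<longlonglongrightarrow> f t"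
      proof (cases "t > 0")
        case True
        have "(\<lambda>n. (1 / real (Suc n))\<^sup>2) \<longlonglongrightarrow> 0\<^sup>2"
          by (intro tendsto_power LIMSEQ_Suc[OF lim_1_over_n])
        with True have "\<forall>\<^sub>F n in sequentially. ?a n < t"
          by (intro order_tendstoD(2)[where y=0]) simp_all
        moreover have "\<forall>\<^sub>F n in sequentially. t \<le> ?b n"
        proof -
          obtain n0 where "t \<le> real n0" using real_arch_simple by blast
          then show ?thesis
            by (intro eventually_mono[OF eventually_ge_at_top[of n0]]) simp
        qed
        ultimately have "\<forall>\<^sub>F n in sequentially. of_real (indicator {?a n..?b n} t) * f t = f t"
          by eventually_elim (simp add: indicator_def)
        then show ?thesis by (rule tendsto_eventually)
      qed (simp add: f_def)
    qed
  qed measurable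
  have trunc: "(LINT t|lborel. of_real (indicator {?a n..?b n} t) * f t)
      = of_real (exp (- ?a n)) * ?m (?a n) - of_real (exp (- ?b n)) * ?m (?b n)" for n
  proof -
    have "(1 / real (Suc n))\<^sup>2 \<le> 1" by (simp add: power_le_one)
    then have ab: "0 < ?a n" "?a n \<le> ?b n" by auto
    have "of_real (indicator {?a n..?b n} t) * f t = of_real (indicator {?a n..?b n} t * exp (- t)) *
      (LINT x|lborel. of_real (heat t x) * (- laplacian \<psi> x + \<psi> x))" for t
    proof (cases "t \<in> {?a n..?b n}")
      case True
      then have "t > 0" using ab(1) by (meson atLeastAtMost_iff less_le_trans)
      with True show ?thesis by (simp add: f_def \<eta>_def)
    qed simp
    then show ?thesis
      using heat_time_integral[OF ab \<psi>] by (simp only:)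
  qed
  have lim_a: "(\<lambda>n. of_real (exp (- ?a n)) * ?m (?a n)) \<longlonglongrightarrow> of_real (exp (- 0\<^sup>2)) * (of_real heat_mass * \<psi> 0)"
    by (intro tendsto_mult heat_delta_limit \<psi> tendsto_of_real tendsto_exp tendsto_minus tendsto_power
        LIMSEQ_Suc[OF lim_1_over_n])
  \<comment> \<open>The integrals against \<psi> stay bounded, since the kernels all have the same
    total mass, so the factor e^(-b) decides.\<close>
  have lim_b: "(\<lambda>n. of_real (exp (- ?b n)) * ?m (?b n)) \<longlonglongrightarrow> 0"
  proof (rule Lim_null_comparison)
    show "\<forall>\<^sub>F n in sequentially. norm (of_real (exp (- ?b n)) * ?m (?b n)) \<le> exp (- ?b n) * (heat_mass * K')"
      using mb[of _ \<psi> K'] K' by (intro always_eventually allI) (simp add: norm_mult)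
    have "filterlim (\<lambda>n. - real (Suc n)) at_bot sequentially"
      by (intro filterlim_uminus_at_top[THEN iffD1]) (rule filterlim_compose[OF filterlim_real_sequentially filterlim_Suc])
    from filterlim_compose[OF exp_at_bot this]
    show "(\<lambda>n. exp (- ?b n) * (heat_mass * K')) \<longlonglongrightarrow> 0"
      by (rule tendsto_mult_left_zero)
  qed
  have "(\<lambda>n. LINT t|lborel. of_real (indicator {?a n..?b n} t) * f t) \<longlonglongrightarrow> of_real (exp (- 0\<^sup>2)) * (of_real heat_mass * \<psi> 0) - 0"
    unfolding trunc by (intro tendsto_diff lim_a lim_b)
  with lim1 have "(LINT t|lborel. f t) = of_real (exp (- 0\<^sup>2)) * (of_real heat_mass * \<psi> 0) - 0"
    by (rule LIMSEQ_unique)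
  then show ?thesis unfolding eq[symmetric] by (simp add: \<eta>_def)
qed

lemma is_green_green: "is_green 1 (green 1)"
proof -
  have "is_green 1 (\<lambda>x. (1 / of_real heat_mass) * resolvent_kernel x)"
    unfolding is_green_def
  proof (intro conjI ballI)
    show "(\<lambda>x. (1 / of_real heat_mass) * resolvent_kernel x) \<in> Lp 2"
      by (intro Lp2_cmult resolvent_kernel_Lp2)
    show "(LINT x|lborel. (1 / of_real heat_mass) * resolvent_kernel x * (- laplacian \<psi> x + of_real 1 * \<psi> x)) = \<psi> 0"
      if "\<psi> \<in> test_fun" for \<psi>
      using resolvent_kernel_equation[OF that] heat_mass_pos
      by (simp only: mult.assoc integral_mult_right_zero) simp
  qed
  then show ?thesis unfolding green_def by (rule someI[of "is_green 1"])
qed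

section \<open>Scaling of the standard energy\<close>

lemma grad_norm_weak_partial:
  assumes "u \<in> H1"
  shows "(grad_norm u)\<^sup>2 = (\<Sum>i\<in>UNIV. LINT x|lborel. (norm (weak_partial i u x))\<^sup>2)"
  using assms by (intro grad_norm_sq H1_Lp2 weak_partial_Lp2 has_weak_partial_weak_partial)

text \<open>In the plane the Dirichlet integral is invariant under dilations: the factor b^2 from
  differentiation cancels the Jacobian.\<close>

lemma H1_scale:
  assumes v: "v \<in> H1" and b: "b > 0"
  shows "(\<lambda>x. a * v (b *\<^sub>R x)) \<in> H1"
    and "(grad_norm (\<lambda>x. a * v (b *\<^sub>R x)))\<^sup>2 = (norm a)\<^sup>2 * (grad_norm v)\<^sup>2"
proof -
  let ?g = "\<lambda>i x. a * of_real b * weak_partial i v (b *\<^sub>R x)"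
  have L: "(\<lambda>x. a * v (b *\<^sub>R x)) \<in> Lp 2"
    using Lp2_affine[OF H1_Lp2[OF v], of b 0] b by (intro Lp2_cmult) simp
  have g: "?g i \<in> Lp 2" for i
    using Lp2_affine[OF weak_partial_Lp2[OF v], of b i 0] b by (intro Lp2_cmult) simp
  have w: "has_weak_partial i (\<lambda>x. a * v (b *\<^sub>R x)) (?g i)" for i
    by (rule has_weak_partial_scale[OF has_weak_partial_weak_partial[OF v] b])
  show "(\<lambda>x. a * v (b *\<^sub>R x)) \<in> H1" using L g w by (rule H1I)
  have "(LINT x|lborel. (norm (?g i x))\<^sup>2) = (norm a)\<^sup>2 * (LINT x|lborel. (norm (weak_partial i v x))\<^sup>2)" for i
  proof -
    have "(LINT x|lborel. (norm (?g i x))\<^sup>2) = (LINT x|lborel. ((norm a)\<^sup>2 * b\<^sup>2) * (norm (weak_partial i v (0 + b *\<^sub>R x)))\<^sup>2)"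
      by (intro Bochner_Integration.integral_cong) (simp_all add: norm_mult power_mult_distrib)
    also have "\<dots> = ((norm a)\<^sup>2 * b\<^sup>2) * (LINT x|lborel. (norm (weak_partial i v (0 + b *\<^sub>R x)))\<^sup>2)"
      by (rule integral_mult_right_zero)
    also have "(LINT x|lborel. (norm (weak_partial i v (0 + b *\<^sub>R x)))\<^sup>2) = (1 / b\<^sup>2) *\<^sub>R (LINT x|lborel. (norm (weak_partial i v x))\<^sup>2)"
      using b by (intro integral_lborel_affine) auto
    finally show ?thesis using b by simp
  qed
  then show "(grad_norm (\<lambda>x. a * v (b *\<^sub>R x)))\<^sup>2 = (norm a)\<^sup>2 * (grad_norm v)\<^sup>2"
    unfolding grad_norm_weak_partial[OF v] grad_norm_sq[OF L g w]
    by (simp add: sum_distrib_left)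
qed

lemma integral_powr_scale:
  fixes v :: "R2 \<Rightarrow> complex"
  assumes "b > 0"
  shows "(LINT x|lborel. norm (a * v (b *\<^sub>R x)) powr p) = (norm a powr p / b\<^sup>2) * (LINT x|lborel. norm (v x) powr p)"
proof -
  have "(LINT x|lborel. norm (a * v (b *\<^sub>R x)) powr p) = (LINT x|lborel. norm a powr p * norm (v (0 + b *\<^sub>R x)) powr p)"
    by (intro Bochner_Integration.integral_cong) (simp_all add: norm_mult powr_mult)
  also have "\<dots> = norm a powr p * (LINT x|lborel. norm (v (0 + b *\<^sub>R x)) powr p)"
    by (rule integral_mult_right_zero)
  also have "(LINT x|lborel. norm (v (0 + b *\<^sub>R x)) powr p) = (1 / b\<^sup>2) *\<^sub>R (LINT x|lborel. norm (v x) powr p)"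
    using assms integral_lborel_affine[of b "\<lambda>x. norm (v x) powr p" 0] by simp
  finally show ?thesis by simp
qed

lemma lp_norm_sq_scale:
  assumes "b > 0"
  shows "(lp_norm 2 (\<lambda>x. a * v (b *\<^sub>R x)))\<^sup>2 = ((norm a)\<^sup>2 / b\<^sup>2) * (lp_norm 2 v)\<^sup>2"
  using integral_powr_scale[OF assms, of a v 2] by (simp add: lp_norm_sq)

text \<open>The scaling \<open>v \<mapsto> a v (b \<cdot>)\<close> with \<open>b\<^sup>2 = k a\<^bsup>p - 2\<^esup>\<close> multiplies both terms of the energy by \<open>a\<^sup>2\<close>, up to a
  factor \<open>k\<close> in the second one; \<open>a\<close> is chosen such that the mass becomes \<open>M\<close>.\<close>

lemma energy_rescale:
  assumes p: "2 < p" "p < 4" and k: "k > 0" and v: "v \<in> H1" and m: "(lp_norm 2 v)\<^sup>2 > 0" and M: "M > 0"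
  obtains w where "w \<in> H1" "(lp_norm 2 w)\<^sup>2 = M"
    "1/2 * (grad_norm v)\<^sup>2 - k / p * (LINT x|lborel. norm (v x) powr p)
      = (k * (lp_norm 2 v)\<^sup>2 / M) powr (2 / (4 - p)) * E_fun p w"
proof
  define m where "m = (lp_norm 2 v)\<^sup>2"
  \<comment> \<open>The mass after scaling is (a^2/b^2) m = k a^(4 - p) m, which is M for this
    value.\<close>
  define a where "a = (M / (k * m)) powr (1 / (4 - p))"
  define b where "b = sqrt (a powr (p - 2) / k)"
  have mp: "m > 0" using m by (simp add: m_def)
  have a: "a > 0" using M k mp by (simp add: a_def)
  have b: "b > 0" "b\<^sup>2 = a powr (p - 2) / k" using a k by (auto simp: b_def)
  let ?w = "\<lambda>x. of_real a * v (b *\<^sub>R x)"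
  show "?w \<in> H1" by (rule H1_scale[OF v b(1)])
  have a4: "a powr (4 - p) = M / (k * m)"
    using p M k mp by (simp add: a_def powr_powr)
  have aa: "a\<^sup>2 = a powr (4 - p) * a powr (p - 2)"
    using a by (simp flip: powr_add)
  have "(lp_norm 2 ?w)\<^sup>2 = a\<^sup>2 / b\<^sup>2 * m"
    unfolding lp_norm_sq_scale[OF b(1)] by (simp add: m_def)
  also have "\<dots> = M"
    unfolding aa b(2) a4 using a k mp by simp
  finally show "(lp_norm 2 ?w)\<^sup>2 = M" .
  have "(LINT x|lborel. norm (?w x) powr p) = a powr p / b\<^sup>2 * (LINT x|lborel. norm (v x) powr p)"
    using integral_powr_scale[OF b(1), of "of_real a" v p] a by simp
  also have "a powr p / b\<^sup>2 = a\<^sup>2 * k"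
  proof -
    have "a powr p = a\<^sup>2 * a powr (p - 2)" using a by (simp add: powr_diff)
    then show ?thesis unfolding b(2) using a k by simp
  qed
  finally have "E_fun p ?w = a\<^sup>2 * (1/2 * (grad_norm v)\<^sup>2 - k / p * (LINT x|lborel. norm (v x) powr p))"
    unfolding E_fun_def H1_scale(2)[OF v b(1)] by (simp add: algebra_simps)
  moreover have "(k * m / M) powr (2 / (4 - p)) * a\<^sup>2 = 1"
  proof -
    have "a\<^sup>2 = (M / (k * m)) powr (2 / (4 - p))"
      using M k mp by (simp add: a_def powr_power)
    moreover have "(k * m / M) * (M / (k * m)) = 1" using M k mp by simp
    ultimately show ?thesis
      using M k mp by (simp only: powr_mult[symmetric]) simp
  qed
  ultimately show "1/2 * (grad_norm v)\<^sup>2 - k / p * (LINT x|lborel. norm (v x) powr p)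
      = (k * (lp_norm 2 v)\<^sup>2 / M) powr (2 / (4 - p)) * E_fun p ?w"
    unfolding m_def[symmetric] by (simp add: mult.assoc[symmetric])
qed

lemma E_inf_le:
  assumes "bdd_below (E_fun p ` {v \<in> H1. (lp_norm 2 v)\<^sup>2 = M})" "v \<in> H1" "(lp_norm 2 v)\<^sup>2 = M"
  shows "E_inf p M \<le> E_fun p v"
  unfolding E_inf_def using assms by (intro cINF_lower) auto

lemma bump_powr_integral_pos:
  assumes "integrable lborel (\<lambda>x. norm (bump 1 (vec (- 1)) (vec 1) x) powr p)"
  shows "(LINT x|lborel. norm (bump 1 (vec (- 1)) (vec 1) x) powr p) > 0"
proof -
  let ?B = "box (vec (- 1)) (vec 1) :: R2 set"
  have "(LINT x|lborel. norm (bump 1 (vec (- 1)) (vec 1) x) powr p) \<noteq> 0"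
  proof
    assume "(LINT x|lborel. norm (bump 1 (vec (- 1)) (vec 1) x) powr p) = 0"
    with assms have "AE x in lborel. norm (bump 1 (vec (- 1)) (vec 1) x) powr p = 0"
      by (subst (asm) integral_nonneg_eq_0_iff_AE) auto
    then have "AE x in lborel. x \<notin> ?B"
      by eventually_elim (use bump_nz_iff in auto)
    then have "emeasure lborel ?B = 0"
      by (subst (asm) AE_iff_measurable[OF _ refl]) auto
    moreover have b2: "(vec 1 - vec (- 1) :: R2) \<bullet> b = 2" if "b \<in> Basis" for b
      using that by (auto simp: Basis_vec_def inner_axis)
    moreover have "emeasure lborel ?B = ennreal (\<Prod>b\<in>Basis. (vec 1 - vec (- 1) :: R2) \<bullet> b)"
      by (intro emeasure_lborel_box) (use b2 in \<open>force simp: inner_diff_left\<close>)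
    ultimately show False by simp
  qed
  then show ?thesis by (simp add: less_le integral_nonneg)
qed

text \<open>Multiplying the second term of the energy of a fixed function by a large \<open>k\<close> makes the energy
  negative, and \<open>k\<close> is scaled away.\<close>

lemma H1_negative_energy:
  assumes p: "2 < p" "p < 4" and M: "M > 0"
  obtains w where "w \<in> H1" "(lp_norm 2 w)\<^sup>2 = M" "E_fun p w < 0"
proof -
  define \<eta> where "\<eta> = bump 1 (vec (- 1)) (vec 1)"
  have \<eta>: "\<eta> \<in> H1" unfolding \<eta>_def by (intro test_fun_H1 bump_test_fun) simp
  have m: "(lp_norm 2 \<eta>)\<^sup>2 > 0"
    using bump_powr_integral_pos[of 2] H1_Lp2[OF \<eta>] by (simp add: lp_norm_sq \<eta>_def Lp2_iff)
  define A where "A = (grad_norm \<eta>)\<^sup>2"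
  define B where "B = (LINT x|lborel. norm (\<eta> x) powr p)"
  have B: "B > 0"
    using bump_powr_integral_pos H1_imp_integrable_powr[OF \<eta> p] unfolding B_def \<eta>_def .
  have A: "A \<ge> 0" by (simp add: A_def)
  \<comment> \<open>With this factor the energy becomes A/2 - (A + 1)/2 = -1/2.\<close>
  have k: "p * (A + 1) / (2 * B) > 0" using p A B by simp
  obtain w where w: "w \<in> H1" "(lp_norm 2 w)\<^sup>2 = M"
    "1/2 * A - (p * (A + 1) / (2 * B)) / p * B
      = ((p * (A + 1) / (2 * B)) * (lp_norm 2 \<eta>)\<^sup>2 / M) powr (2 / (4 - p)) * E_fun p w"
    using energy_rescale[OF p k \<eta> m M] unfolding A_def B_def by blast
  have "1/2 * A - (p * (A + 1) / (2 * B)) / p * B = - (1/2)"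
    using p B by (simp add: field_simps)
  then have "((p * (A + 1) / (2 * B)) * (lp_norm 2 \<eta>)\<^sup>2 / M) powr (2 / (4 - p)) * E_fun p w < 0"
    unfolding w(3) by simp
  then have "E_fun p w < 0" by (simp add: mult_less_0_iff not_less powr_ge_zero)
  with w that show ?thesis by blast
qed

text \<open>A ground state bounds the energy below at the mass \<mu> only; rescaling carries the
  bound to mass 1, the reference for all levels.\<close>

lemma bdd_below_energy:
  assumes p: "2 < p" "p < 4" and M0: "M0 > 0" and M: "M > 0"
    and bdd: "bdd_below (E_fun p ` {v \<in> H1. (lp_norm 2 v)\<^sup>2 = M0})"
  shows "bdd_below (E_fun p ` {v \<in> H1. (lp_norm 2 v)\<^sup>2 = M})"
proof (rule bdd_belowI2)
  fix v assume v: "v \<in> {v \<in> H1. (lp_norm 2 v)\<^sup>2 = M}"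
  then obtain w where w: "w \<in> H1" "(lp_norm 2 w)\<^sup>2 = M0"
    "1/2 * (grad_norm v)\<^sup>2 - 1 / p * (LINT x|lborel. norm (v x) powr p) = (1 * (lp_norm 2 v)\<^sup>2 / M0) powr (2 / (4 - p)) * E_fun p w"
    using energy_rescale[OF p zero_less_one _ _ M0, of v] M by auto
  then have "E_fun p v = (M / M0) powr (2 / (4 - p)) * E_fun p w"
    using v by (simp add: E_fun_def)
  also have "\<dots> \<ge> (M / M0) powr (2 / (4 - p)) * E_inf p M0"
    using E_inf_le[OF bdd w(1,2)] by (intro mult_left_mono) auto
  finally show "(M / M0) powr (2 / (4 - p)) * E_inf p M0 \<le> E_fun p v" .
qed

lemma E_inf_neg:
  assumes "2 < p" "p < 4" "M > 0" "bdd_below (E_fun p ` {v \<in> H1. (lp_norm 2 v)\<^sup>2 = M})"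
  shows "E_inf p M < 0"
  using H1_negative_energy[OF assms(1-3)] E_inf_le[OF assms(4)] by (metis order.strict_trans1)

text \<open>The factor \<open>k\<close> anticipates the loss in comparing the L^p integrals of a
  function and of its regular part; rescaling absorbs it into the mass.\<close>

lemma energy_lower_bound:
  assumes p: "2 < p" "p < 4" and k: "k > 0" and v: "v \<in> H1"
    and bdd: "bdd_below (E_fun p ` {v \<in> H1. (lp_norm 2 v)\<^sup>2 = 1})"
  shows "(k * (lp_norm 2 v)\<^sup>2) powr (2 / (4 - p)) * E_inf p 1
    \<le> 1/2 * (grad_norm v)\<^sup>2 - k / p * (LINT x|lborel. norm (v x) powr p)"
proof (cases "(lp_norm 2 v)\<^sup>2 > 0")
  case True
  obtain w where w: "w \<in> H1" "(lp_norm 2 w)\<^sup>2 = 1"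
    "1/2 * (grad_norm v)\<^sup>2 - k / p * (LINT x|lborel. norm (v x) powr p)
      = (k * (lp_norm 2 v)\<^sup>2 / 1) powr (2 / (4 - p)) * E_fun p w"
    using energy_rescale[OF p k v True zero_less_one] by blast
  show ?thesis
    unfolding w(3) using E_inf_le[OF bdd w(1,2)] by (simp add: mult_left_mono)
next
  case False
  \<comment> \<open>Mass 0 cannot be rescaled to mass 1. Such a function vanishes almost everywhere,
    so the left side and the integral of the p-th power are both 0.\<close>
  then have 0: "(lp_norm 2 v)\<^sup>2 = 0" by simp
  then have "(LINT x|lborel. (norm (v x))\<^sup>2) = 0" by (simp only: lp_norm_sq)
  then have "AE x in lborel. (norm (v x))\<^sup>2 = 0"
    using H1_Lp2[OF v] by (subst (asm) integral_nonneg_eq_0_iff_AE) (auto simp: Lp2_iff)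
  then have "AE x in lborel. norm (v x) powr p = 0" by eventually_elim simp
  then have "(LINT x|lborel. norm (v x) powr p) = 0" by (rule integral_eq_zero_AE)
  with 0 show ?thesis by simp
qed

lemma E_inf_scale:
  assumes p: "2 < p" "p < 4" and M: "M > 0"
    and bdd: "bdd_below (E_fun p ` {v \<in> H1. (lp_norm 2 v)\<^sup>2 = M})"
  shows "E_inf p M = M powr (2 / (4 - p)) * E_inf p 1"
proof (rule antisym)
  note bdd1 = bdd_below_energy[OF p M zero_less_one bdd]
  show "M powr (2 / (4 - p)) * E_inf p 1 \<le> E_inf p M"
    unfolding E_inf_def[of p M]
  proof (rule cINF_greatest)
    show "{v \<in> H1. (lp_norm 2 v)\<^sup>2 = M} \<noteq> {}" using H1_negative_energy[OF p M] by blast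
    show "M powr (2 / (4 - p)) * E_inf p 1 \<le> E_fun p v" if "v \<in> {v \<in> H1. (lp_norm 2 v)\<^sup>2 = M}" for v
      using energy_lower_bound[OF p zero_less_one _ bdd1, of v] that by (simp add: E_fun_def)
  qed
  have "M powr - (2 / (4 - p)) * E_inf p M \<le> E_inf p 1"
    unfolding E_inf_def[of p 1]
  proof (rule cINF_greatest)
    show "{v \<in> H1. (lp_norm 2 v)\<^sup>2 = 1} \<noteq> {}" using H1_negative_energy[OF p zero_less_one] by blast
    fix v assume v: "v \<in> {v \<in> H1. (lp_norm 2 v)\<^sup>2 = 1}"
    then obtain w where w: "w \<in> H1" "(lp_norm 2 w)\<^sup>2 = M"
      "1/2 * (grad_norm v)\<^sup>2 - 1 / p * (LINT x|lborel. norm (v x) powr p) = (1 * (lp_norm 2 v)\<^sup>2 / M) powr (2 / (4 - p)) * E_fun p w"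
      using energy_rescale[OF p zero_less_one _ _ M, of v] by auto
    then have "E_fun p v = M powr - (2 / (4 - p)) * E_fun p w"
      using v M by (simp add: E_fun_def powr_minus powr_divide inverse_eq_divide)
    also have "\<dots> \<ge> M powr - (2 / (4 - p)) * E_inf p M"
      using E_inf_le[OF bdd w(1,2)] by (intro mult_left_mono) auto
    finally show "M powr - (2 / (4 - p)) * E_inf p M \<le> E_fun p v" .
  qed
  then have "M powr (2 / (4 - p)) * (M powr - (2 / (4 - p)) * E_inf p M) \<le> M powr (2 / (4 - p)) * E_inf p 1"
    by (rule mult_left_mono) simp
  then show "E_inf p M \<le> M powr (2 / (4 - p)) * E_inf p 1"
    using M by (simp add: mult.assoc[symmetric] flip: powr_add)
qed

section \<open>Small charges\<close>

lemma powr_convex_combination: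
  fixes x y s p :: real
  assumes "0 \<le> x" "0 \<le> y" "0 \<le> s" "s \<le> 1" "1 \<le> p"
  shows "((1 - s) * x + s * y) powr p \<le> (1 - s) * x powr p + s * y powr p"
proof -
  have le: "(t * z) powr p \<le> t * z powr p" if "0 \<le> t" "t \<le> 1" "0 \<le> z" for t z :: real
  proof -
    have "t powr p \<le> t powr 1" using that assms by (intro powr_mono') auto
    then show ?thesis using that by (simp add: powr_mult mult_right_mono)
  qed
  show ?thesis
  \<comment> \<open>If an argument vanishes, t^p \<le> t for the weights suffices; convexity is
    applied to positive arguments.\<close>
  proof (cases "x = 0 \<or> y = 0")
    case True
    then show ?thesis using le[of s y] le[of "1 - s" x] assms by auto
  next
    case False
    then show ?thesis
      using convex_onD[OF powr_convex[OF assms(5)], of s x y] assms by simp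
  qed
qed

text \<open>Convexity with the weights \<open>1 - \<bar>c\<bar>\<close> and \<open>\<bar>c\<bar>\<close>: the coefficient of \<open>\<bar>w\<bar>\<^sup>p\<close> vanishes with \<open>c\<close>.\<close>

lemma norm_add_powr_le:
  fixes z w c :: complex
  assumes "norm c < 1" "1 \<le> p"
  shows "norm (z + c * w) powr p \<le> (1 - norm c) powr (1 - p) * norm z powr p + norm c * norm w powr p"
proof -
  let ?s = "norm c"
  have "norm (z + c * w) \<le> (1 - ?s) * (norm z / (1 - ?s)) + ?s * norm w"
    using norm_triangle_ineq[of z "c * w"] assms by (simp add: norm_mult)
  then have "norm (z + c * w) powr p \<le> ((1 - ?s) * (norm z / (1 - ?s)) + ?s * norm w) powr p"
    using assms by (intro powr_mono2) auto
  also have "\<dots> \<le> (1 - ?s) * (norm z / (1 - ?s)) powr p + ?s * norm w powr p"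
    using assms by (intro powr_convex_combination) auto
  also have "(1 - ?s) * (norm z / (1 - ?s)) powr p = (1 - ?s) powr (1 - p) * norm z powr p"
    using assms by (simp add: powr_divide powr_diff)
  finally show ?thesis .
qed

text \<open>If \<open>w\<close> is not in \<open>L\<^sup>p\<close>, then neither is \<open>z + c w\<close> (for \<open>c \<noteq> 0\<close>), so that both integrals of
  \<open>p\<close>-th powers involving \<open>w\<close> are zero by convention.\<close>

lemma integral_add_powr_le:
  fixes z w :: "R2 \<Rightarrow> complex"
  assumes z: "z \<in> borel_measurable borel" "integrable lborel (\<lambda>x. norm (z x) powr p)"
    and w: "w \<in> borel_measurable borel" and c: "norm c < 1" and p: "1 \<le> p"
  shows "(LINT x|lborel. norm (z x + c * w x) powr p)
    \<le> (1 - norm c) powr (1 - p) * (LINT x|lborel. norm (z x) powr p) + norm c * (LINT x|lborel. norm (w x) powr p)"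
proof (cases "integrable lborel (\<lambda>x. norm (w x) powr p)")
  case True
  have "(LINT x|lborel. norm (z x + c * w x) powr p)
    \<le> (LINT x|lborel. (1 - norm c) powr (1 - p) * norm (z x) powr p + norm c * norm (w x) powr p)"
    using True z norm_add_powr_le[OF c p] by (intro integral_mono') auto
  then show ?thesis using True z by simp
next
  case False
  note [measurable] = z(1) w
  have nn: "0 \<le> (1 - norm c) powr (1 - p) * (LINT x|lborel. norm (z x) powr p)"
    by (simp add: integral_nonneg)
  show ?thesis
  proof (cases "c = 0")
    case True
    then show ?thesis by simp
  next
    case c0: False
    have "\<not> integrable lborel (\<lambda>x. norm (z x + c * w x) powr p)"
    proof
      assume int: "integrable lborel (\<lambda>x. norm (z x + c * w x) powr p)"
      have "integrable lborel (\<lambda>x. (1 / norm c) powr p *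
          ((1 - 1/2) powr (1 - p) * norm (z x + c * w x) powr p + 1/2 * (2 powr p * norm (z x) powr p)))"
        using int z(2) by (intro integrable_mult_right Bochner_Integration.integrable_add)
      then have "integrable lborel (\<lambda>x. norm (w x) powr p)"
      proof (rule Bochner_Integration.integrable_bound)
        show "AE x in lborel. norm (norm (w x) powr p) \<le> norm ((1 / norm c) powr p *
          ((1 - 1/2) powr (1 - p) * norm (z x + c * w x) powr p + 1/2 * (2 powr p * norm (z x) powr p)))"
        proof (intro always_eventually allI)
          fix x
          \<comment> \<open>c w is recovered from z + c w by adding (-1/2) (2 z); this coefficient
            has norm below 1, so the pointwise inequality applies once more.\<close>
          have "norm (w x) powr p = (1 / norm c) powr p * norm ((z x + c * w x) + (- 1/2) * (2 * z x)) powr p"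
            using c0 by (simp add: norm_mult flip: powr_mult)
          also have "\<dots> \<le> (1 / norm c) powr p * ((1 - norm (- 1/2 :: complex)) powr (1 - p) * norm (z x + c * w x) powr p
              + norm (- 1/2 :: complex) * norm (2 * z x) powr p)"
            by (intro mult_left_mono norm_add_powr_le p) auto
          also have "\<dots> = (1 / norm c) powr p *
            ((1 - 1/2) powr (1 - p) * norm (z x + c * w x) powr p + 1/2 * (2 powr p * norm (z x) powr p))"
            by (simp add: norm_mult powr_mult)
          finally show "norm (norm (w x) powr p) \<le> norm ((1 / norm c) powr p *
            ((1 - 1/2) powr (1 - p) * norm (z x + c * w x) powr p + 1/2 * (2 powr p * norm (z x) powr p)))"
            by simp
        qed
      qed measurable
      with False show False by simp
    qed
    then show ?thesis using nn by (simp add: not_integrable_integral_eq integral_nonneg)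
  qed
qed

section \<open>The charge and the energy with a singular part\<close>

lemma green_Lp2: "green 1 \<in> Lp 2"
  using is_green_green by (simp add: is_green_def)

text \<open>Two different charges would exhibit the Green's function as a multiple of a difference
  of two \<open>H1\<close> functions, against \<open>green_not_H1\<close>.\<close>

lemma charge_eqI:
  assumes "regular_part q u \<in> H1"
  shows "charge u = q"
  unfolding charge_def
proof (rule the_equality)
  fix q' assume q': "regular_part q' u \<in> H1"
  show "q' = q"
  proof (rule ccontr)
    assume "q' \<noteq> q"
    then have "green 1 = (\<lambda>x. (1 / (q - q')) * (regular_part q' u x + (- 1) * regular_part q u x))"
      by (intro ext) (simp add: regular_part_def field_simps)
    then have "green 1 \<in> H1" using H1_cmult[OF H1_lincomb[OF q' assms, of "- 1"], of "1 / (q - q')"] by simp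
    then show False using green_not_H1[OF is_green_green] by simp
  qed
qed (rule assms)

lemma Dom_regular_part: "u \<in> Dom \<Longrightarrow> regular_part (charge u) u \<in> H1"
  using charge_eqI by (auto simp: Dom_def)

lemma H1_charge:
  assumes "v \<in> H1"
  shows "v \<in> Dom" "charge v = 0" "regular_part 0 v = v"
proof -
  show r: "regular_part 0 v = v" by (rule ext) (simp add: regular_part_def)
  then have "regular_part 0 v \<in> H1" using assms by simp
  then show "v \<in> Dom" "charge v = 0"
    using H1_Lp2[OF assms] charge_eqI by (auto simp: Dom_def)
qed

lemma F_single_H1:
  assumes "v \<in> H1" "p > 0"
  shows "F_single p \<sigma> v = E_fun p v"
  using assms by (simp add: F_single_def E_fun_def H1_charge h1_norm_def lp_norm_powr)

lemma E_fun_zero: "E_fun p (\<lambda>_. 0) = 0"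
  using H1_scale(2)[OF zero_in_H1 zero_less_one, of 0] by (simp add: E_fun_def)

text \<open>\<open>u\<close> and its regular part differ by the charge times the Green's function.
  The convexity inequality therefore compares their masses in both directions and their L^p
  integrals in one, with errors controlled by \<open>s\<close>. The standard bound for the regular
  part is then expressed in the mass of \<open>u\<close> and made linear in it, so that the bounds
  of the two components can be added.\<close>

lemma F_single_lower_bound:
  fixes p \<mu> \<sigma> :: real
  assumes p: "2 < p" "p < 4" and bdd: "bdd_below (E_fun p ` {v \<in> H1. (lp_norm 2 v)\<^sup>2 = 1})"
    and u: "u \<in> Dom" and m: "(lp_norm 2 u)\<^sup>2 \<le> \<mu>" and s: "cmod (charge u) < 1"
    and \<sigma>: "\<sigma> + (euler_mascheroni - ln 2) / (2 * pi) \<ge> 0"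
  defines "s \<equiv> cmod (charge u)" and "N \<equiv> (lp_norm 2 (green 1))\<^sup>2"
    and "P \<equiv> (LINT x|lborel. norm (green 1 x) powr p)" and "\<theta> \<equiv> 2 / (4 - p)"
  shows "F_single p \<sigma> u \<ge> E_inf p 1 * (((1 - s) powr (- p)) powr \<theta> * (\<mu> + s * N) powr (\<theta> - 1)) * ((lp_norm 2 u)\<^sup>2 + s * N)
    - s * (\<mu> + N) / 2 - s * P / p"
proof -
  let ?m = "(lp_norm 2 u)\<^sup>2"
  define \<phi> where "\<phi> = regular_part (charge u) u"
  define f where "f = (lp_norm 2 \<phi>)\<^sup>2"
  \<comment> \<open>\<open>k\<close> is the loss in the L^p comparison;
    \<open>r = k / (1 - s)\<close> also contains the loss in the mass comparison.\<close>
  define k where "k = (1 - s) powr (1 - p)"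
  define r where "r = (1 - s) powr (- p)"
  have s01: "0 \<le> s" "s < 1" using s by (auto simp: s_def)
  have \<phi>: "\<phi> \<in> H1" unfolding \<phi>_def by (rule Dom_regular_part[OF u])
  have u2: "u \<in> Lp 2" using u by (simp add: Dom_def)
  have u_eq: "u x = \<phi> x + charge u * green 1 x" for x by (simp add: \<phi>_def regular_part_def)
  have \<phi>_eq: "\<phi> x = u x + (- charge u) * green 1 x" for x by (simp add: \<phi>_def regular_part_def)
  have gm: "green 1 \<in> borel_measurable borel" and um: "u \<in> borel_measurable borel" and \<phi>m: "\<phi> \<in> borel_measurable borel"
    using green_Lp2 u2 H1_Lp2[OF \<phi>] by measurable
  have sq: "integrable lborel (\<lambda>x. norm (u x) powr 2)" "integrable lborel (\<lambda>x. norm (\<phi> x) powr 2)"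
    using u2 H1_Lp2[OF \<phi>] by (simp_all add: Lp2_iff)
  have N0: "N \<ge> 0" by (simp add: N_def)
  have inv: "1 / (1 - s) = (1 - s) powr (1 - 2)"
    using s01 by (simp add: powr_minus_divide)
  have L: "(lp_norm 2 v)\<^sup>2 = (LINT x|lborel. norm (v x) powr 2)" for v :: "R2 \<Rightarrow> complex"
    by (simp add: lp_norm_sq)
  have c: "cmod (charge u) < 1" "cmod (- charge u) < 1" using s by simp_all
  have p1: "1 \<le> p" using p by simp
  have f_le: "f \<le> 1 / (1 - s) * ?m + s * N"
    using integral_add_powr_le[OF um sq(1) gm c(2) one_le_numeral]
    unfolding f_def N_def L inv norm_minus_cancel \<phi>_eq[symmetric] s_def[symmetric] .
  have m_le: "?m \<le> 1 / (1 - s) * f + s * N"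
    using integral_add_powr_le[OF \<phi>m sq(2) gm c(1) one_le_numeral]
    unfolding f_def N_def L inv u_eq[symmetric] s_def[symmetric] .
  have p_le: "(LINT x|lborel. norm (u x) powr p) \<le> k * (LINT x|lborel. norm (\<phi> x) powr p) + s * P"
    using integral_add_powr_le[OF \<phi>m H1_imp_integrable_powr[OF \<phi> p] gm c(1) p1]
    unfolding k_def P_def u_eq[symmetric] s_def[symmetric] .
  have diff: "f - ?m \<ge> - (s * (\<mu> + N))"
  proof -
    have "(1 - s) * ?m \<le> (1 - s) * (1 / (1 - s) * f + s * N)"
      using m_le s01 by (intro mult_left_mono) auto
    also have "\<dots> = f + (1 - s) * (s * N)" using s01 by (simp add: field_simps)
    also have "\<dots> \<le> f + s * N" using s01 N0 by (intro add_left_mono mult_left_le_one_le) auto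
    finally have "?m - s * ?m \<le> f + s * N" by (simp add: algebra_simps)
    moreover have "s * ?m \<le> s * \<mu>" using m s01 by (intro mult_left_mono) auto
    ultimately show ?thesis by (simp add: algebra_simps)
  qed
  have k: "k > 0" using s01 by (simp add: k_def)
  have r: "r \<ge> 0" by (simp add: r_def)
  have th: "\<theta> > 1" using p by (simp add: \<theta>_def)
  have kr: "k * (1 / (1 - s)) = r" "k \<le> r"
  proof -
    show kr: "k * (1 / (1 - s)) = r"
      using s01 by (simp add: k_def r_def powr_diff powr_minus_divide)
    have "k * 1 \<le> k * (1 / (1 - s))" using s01 k by (intro mult_left_mono) auto
    then show "k \<le> r" unfolding kr by simp
  qed
  have kf: "k * f \<le> r * (?m + s * N)"
  proof -
    have "k * f \<le> k * (1 / (1 - s) * ?m + s * N)" using f_le k by (intro mult_left_mono) auto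
    also have "\<dots> = r * ?m + k * (s * N)"
      unfolding kr(1)[symmetric] by (simp add: algebra_simps)
    also have "\<dots> \<le> r * ?m + r * (s * N)"
      using kr(2) s01 N0 by (intro add_left_mono mult_right_mono) auto
    finally show ?thesis by (simp add: algebra_simps)
  qed
  have E: "E_inf p 1 \<le> 0" using E_inf_neg[OF p zero_less_one bdd] by simp
  have mN: "0 \<le> ?m + s * N" "?m + s * N \<le> \<mu> + s * N" using m s01 N0 by auto
  have "(k * f) powr \<theta> \<le> (r * (?m + s * N)) powr \<theta>"
    using kf k th by (intro powr_mono2) (auto simp: f_def)
  also have "\<dots> = r powr \<theta> * (?m + s * N) powr \<theta>"
    using r mN by (intro powr_mult)
  \<comment> \<open>The chord of the convex power: one factor is kept, and the remaining power
    \<theta> - 1 is bounded by its value at the largest mass.\<close>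
  also have "(?m + s * N) powr \<theta> = (?m + s * N) powr (\<theta> - 1) * (?m + s * N)"
    using mN(1) th by (cases "?m + s * N = 0") (auto simp: powr_diff)
  also have "r powr \<theta> * \<dots> \<le> r powr \<theta> * ((\<mu> + s * N) powr (\<theta> - 1) * (?m + s * N))"
    using mN th by (intro mult_left_mono mult_right_mono powr_mono2) auto
  \<comment> \<open>The level is nonpositive, so an upper bound for the power is a lower bound for
    the energy.\<close>
  finally have "E_inf p 1 * (r powr \<theta> * ((\<mu> + s * N) powr (\<theta> - 1) * (?m + s * N))) \<le> E_inf p 1 * (k * f) powr \<theta>"
    using E by (rule mult_left_mono_neg)
  also have "\<dots> \<le> 1/2 * (grad_norm \<phi>)\<^sup>2 - k / p * (LINT x|lborel. norm (\<phi> x) powr p)"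
    using energy_lower_bound[OF p k \<phi> bdd] by (simp add: f_def \<theta>_def mult.commute)
  finally have main: "E_inf p 1 * (r powr \<theta> * (\<mu> + s * N) powr (\<theta> - 1)) * (?m + s * N)
      \<le> 1/2 * (grad_norm \<phi>)\<^sup>2 - k / p * (LINT x|lborel. norm (\<phi> x) powr p)"
    by (simp add: mult.assoc)
  have "1 / p * (LINT x|lborel. norm (u x) powr p) \<le> 1 / p * (k * (LINT x|lborel. norm (\<phi> x) powr p) + s * P)"
    using p_le p by (intro mult_left_mono) auto
  then have pe: "1 / p * lp_norm p u powr p \<le> k / p * (LINT x|lborel. norm (\<phi> x) powr p) + s * P / p"
    using p by (simp add: lp_norm_powr add_divide_distrib)
  have "F_single p \<sigma> u = 1/2 * ((grad_norm \<phi>)\<^sup>2 + f - ?m) + s\<^sup>2 / 2 * (\<sigma> + (euler_mascheroni - ln 2) / (2 * pi)) - 1/p * lp_norm p u powr p"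
    by (simp add: F_single_def h1_norm_def f_def s_def flip: \<phi>_def)
  also have "\<dots> \<ge> 1/2 * ((grad_norm \<phi>)\<^sup>2 + f - ?m) - 1/p * lp_norm p u powr p"
    using \<sigma> by simp
  finally have "1/2 * ((grad_norm \<phi>)\<^sup>2 + f - ?m) - 1/p * lp_norm p u powr p \<le> F_single p \<sigma> u" .
  moreover have "X - S / 2 - T \<le> F"
    if "1/2 * (G + f - ?m) - L \<le> F" "X \<le> 1/2 * G - I" "L \<le> I + T" "- S \<le> f - ?m" for X S T F G L I :: real
    using that by argo
  ultimately show ?thesis
    using main pe diff unfolding r_def by blast
qed

section \<open>Concentration of the mass\<close>

text \<open>The lower bound exceeds - D1 \<mu> by (D1 - D2) m2 - r. Against the upper bound this
  squeezes m2 between 0 and r / (D1 - D2), and F between - D1 \<mu> - r and - D1 \<mu>.\<close>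

lemma two_mass_limit:
  fixes m1 m2 F r :: "real \<Rightarrow> real"
  assumes mass: "\<And>x. 0 \<le> m1 x" "\<And>x. 0 \<le> m2 x" "\<And>x. m1 x + m2 x = \<mu>"
    and upper: "\<And>x. F x \<le> - D1 * \<mu>"
    and lower: "\<forall>\<^sub>F x in at_top. - D1 * m1 x - D2 * m2 x - r x \<le> F x"
    and r: "(r \<longlongrightarrow> 0) at_top" and D: "D2 < D1"
  shows "(m1 \<longlongrightarrow> \<mu>) at_top \<and> (F \<longlongrightarrow> - D1 * \<mu>) at_top"
proof
  have *: "\<forall>\<^sub>F x in at_top. (D1 - D2) * m2 x \<le> r x \<and> - D1 * \<mu> - r x \<le> F x"
    using lower
  proof eventually_elim
    fix x assume l: "- D1 * m1 x - D2 * m2 x - r x \<le> F x"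
    have m1: "m1 x = \<mu> - m2 x" using mass(3)[of x] by simp
    have "- D1 * m1 x - D2 * m2 x = - D1 * \<mu> + (D1 - D2) * m2 x"
      unfolding m1 by (simp add: algebra_simps)
    moreover have "0 \<le> (D1 - D2) * m2 x" using D mass(2) by simp
    ultimately show "(D1 - D2) * m2 x \<le> r x \<and> - D1 * \<mu> - r x \<le> F x"
      using l upper[of x] by linarith
  qed
  have "(m2 \<longlongrightarrow> 0) at_top"
  proof (rule tendsto_sandwich[OF _ _ tendsto_const])
    show "\<forall>\<^sub>F x in at_top. 0 \<le> m2 x" using mass(2) by simp
    show "\<forall>\<^sub>F x in at_top. m2 x \<le> r x / (D1 - D2)"
      using * by eventually_elim (use D in \<open>simp add: field_simps\<close>)
    show "((\<lambda>x. r x / (D1 - D2)) \<longlongrightarrow> 0) at_top"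
      using tendsto_divide[OF r tendsto_const, of "D1 - D2"] D by simp
  qed
  then have "((\<lambda>x. \<mu> - m2 x) \<longlongrightarrow> \<mu> - 0) at_top" by (intro tendsto_intros)
  moreover have "(\<lambda>x. \<mu> - m2 x) = m1" using mass(3) by (auto simp: algebra_simps)
  ultimately show "(m1 \<longlongrightarrow> \<mu>) at_top" by simp
  show "(F \<longlongrightarrow> - D1 * \<mu>) at_top"
  proof (rule tendsto_sandwich)
    show "\<forall>\<^sub>F x in at_top. - D1 * \<mu> - r x \<le> F x" using * by eventually_elim simp
    show "\<forall>\<^sub>F x in at_top. F x \<le> - D1 * \<mu>" using upper by simp
    show "((\<lambda>x. - D1 * \<mu> - r x) \<longlongrightarrow> - D1 * \<mu>) at_top"
      using tendsto_diff[OF tendsto_const r, of "- D1 * \<mu>"] by simp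
  qed simp
qed

lemma F_single_asymptotic_lower_bound:
  fixes p \<mu> :: real and u :: "real \<Rightarrow> R2 \<Rightarrow> complex"
  assumes p: "2 < p" "p < 4" and bdd: "bdd_below (E_fun p ` {v \<in> H1. (lp_norm 2 v)\<^sup>2 = 1})"
    and \<mu>: "\<mu> > 0" and u: "\<And>\<sigma>. u \<sigma> \<in> Dom" "\<And>\<sigma>. (lp_norm 2 (u \<sigma>))\<^sup>2 \<le> \<mu>"
    and s: "((\<lambda>\<sigma>. cmod (charge (u \<sigma>))) \<longlongrightarrow> 0) at_top"
  obtains r where "(r \<longlongrightarrow> 0) at_top"
    "\<forall>\<^sub>F \<sigma> in at_top. E_inf p 1 * \<mu> powr (2 / (4 - p) - 1) * (lp_norm 2 (u \<sigma>))\<^sup>2 - r \<sigma> \<le> F_single p \<sigma> (u \<sigma>)"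
proof -
  define \<theta> where "\<theta> = 2 / (4 - p)"
  define N where "N = (lp_norm 2 (green 1))\<^sup>2"
  define P where "P = (LINT x|lborel. norm (green 1 x) powr p)"
  define s where "s \<sigma> = cmod (charge (u \<sigma>))" for \<sigma>
  define m where "m \<sigma> = (lp_norm 2 (u \<sigma>))\<^sup>2" for \<sigma>
  define A where "A \<sigma> = ((1 - s \<sigma>) powr (- p)) powr \<theta> * (\<mu> + s \<sigma> * N) powr (\<theta> - 1)" for \<sigma>
  \<comment> \<open>The first summand pays for replacing the slope factor \<open>A\<close> by its
    limit, uniformly in the mass as this is at most \<mu>; the others are the explicit errors of
    \<open>F_single_lower_bound\<close>.\<close>
  define r where "r \<sigma> = \<bar>E_inf p 1\<bar> * \<bar>A \<sigma> - \<mu> powr (\<theta> - 1)\<bar> * \<mu> - E_inf p 1 * A \<sigma> * (s \<sigma> * N) + s \<sigma> * (\<mu> + N) / 2 + s \<sigma> * P / p" for \<sigma>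
  note s0 = assms(7)[folded s_def]
  have A: "(A \<longlongrightarrow> ((1 - 0) powr (- p)) powr \<theta> * (\<mu> + 0 * N) powr (\<theta> - 1)) at_top"
    unfolding A_def using \<mu> by (intro tendsto_intros s0) auto
  then have A: "(A \<longlongrightarrow> \<mu> powr (\<theta> - 1)) at_top" by simp
  have "(r \<longlongrightarrow> \<bar>E_inf p 1\<bar> * \<bar>\<mu> powr (\<theta> - 1) - \<mu> powr (\<theta> - 1)\<bar> * \<mu> - E_inf p 1 * \<mu> powr (\<theta> - 1) * (0 * N) + 0 * (\<mu> + N) / 2 + 0 * P / p) at_top"
    unfolding r_def using p by (intro tendsto_intros s0 A) auto
  then have r: "(r \<longlongrightarrow> 0) at_top" by simp
  have "\<forall>\<^sub>F \<sigma> in at_top. s \<sigma> < 1" using order_tendstoD(2)[OF s0, of 1] by simp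
  moreover have "\<forall>\<^sub>F \<sigma> in at_top. \<sigma> + (euler_mascheroni - ln 2) / (2 * pi) \<ge> 0"
    using eventually_ge_at_top[of "- ((euler_mascheroni - ln 2) / (2 * pi))"] by eventually_elim simp
  ultimately have "\<forall>\<^sub>F \<sigma> in at_top. E_inf p 1 * \<mu> powr (\<theta> - 1) * m \<sigma> - r \<sigma> \<le> F_single p \<sigma> (u \<sigma>)"
  proof eventually_elim
    fix \<sigma> assume a: "s \<sigma> < 1" "\<sigma> + (euler_mascheroni - ln 2) / (2 * pi) \<ge> 0"
    have "E_inf p 1 * A \<sigma> * (m \<sigma> + s \<sigma> * N) - s \<sigma> * (\<mu> + N) / 2 - s \<sigma> * P / p \<le> F_single p \<sigma> (u \<sigma>)"
      using F_single_lower_bound[OF p bdd u _ a(2)] a(1)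
      unfolding A_def s_def N_def P_def \<theta>_def m_def by simp
    moreover have "E_inf p 1 * A \<sigma> * (m \<sigma> + s \<sigma> * N)
      = E_inf p 1 * \<mu> powr (\<theta> - 1) * m \<sigma> + E_inf p 1 * (A \<sigma> - \<mu> powr (\<theta> - 1)) * m \<sigma> + E_inf p 1 * A \<sigma> * (s \<sigma> * N)"
      by (simp add: algebra_simps)
    moreover have "- (\<bar>E_inf p 1\<bar> * \<bar>A \<sigma> - \<mu> powr (\<theta> - 1)\<bar> * \<mu>) \<le> E_inf p 1 * (A \<sigma> - \<mu> powr (\<theta> - 1)) * m \<sigma>"
    proof -
      have "\<bar>E_inf p 1 * (A \<sigma> - \<mu> powr (\<theta> - 1)) * m \<sigma>\<bar> \<le> \<bar>E_inf p 1\<bar> * \<bar>A \<sigma> - \<mu> powr (\<theta> - 1)\<bar> * \<mu>"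
        unfolding abs_mult using u(2)[of \<sigma>] by (intro mult_left_mono) (auto simp: m_def)
      then show ?thesis by linarith
    qed
    ultimately show "E_inf p 1 * \<mu> powr (\<theta> - 1) * m \<sigma> - r \<sigma> \<le> F_single p \<sigma> (u \<sigma>)"
      unfolding r_def by linarith
  qed
  with r that show ?thesis unfolding m_def \<theta>_def by blast
qed

section \<open>The threshold mass and the ground states\<close>

lemma F_single_shift: "F_single p \<sigma> u = F_single p 0 u + \<sigma> / 2 * (cmod (charge u))\<^sup>2"
  by (simp add: F_single_def algebra_simps add_divide_distrib)

text \<open>Divided by \<mu>^(2/(4 - p1) - 1) and by the negative level \<open>E_inf p2 1\<close>,
  the inequality compares \<mu>^d with the quotient of the levels, where \<open>d\<close> is the
  difference of the two exponents. The exponent in \<open>mu_star\<close> is 1/d.\<close>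

lemma mu_star_iff:
  fixes p1 p2 \<mu> :: real
  assumes p: "p1 < p2" "p2 < 4" and \<mu>: "\<mu> > 0" and E: "E_inf p1 1 < 0" "E_inf p2 1 < 0"
  shows "\<mu> < mu_star p1 p2 \<longleftrightarrow> E_inf p1 1 * \<mu> powr (2 / (4 - p1) - 1) < E_inf p2 1 * \<mu> powr (2 / (4 - p2) - 1)"
    and "mu_star p1 p2 < \<mu> \<longleftrightarrow> E_inf p2 1 * \<mu> powr (2 / (4 - p2) - 1) < E_inf p1 1 * \<mu> powr (2 / (4 - p1) - 1)"
proof -
  define d where "d = 2 / (4 - p2) - 2 / (4 - p1)"
  define q where "q = E_inf p1 1 / E_inf p2 1"
  have d: "d = 2 * (p2 - p1) / ((4 - p1) * (4 - p2))" "d > 0"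
  proof -
    show "d = 2 * (p2 - p1) / ((4 - p1) * (4 - p2))" using p by (simp add: d_def field_simps)
    then show "d > 0" using p by simp
  qed
  have q: "q > 0" using E by (simp add: q_def divide_neg_neg)
  have ms: "mu_star p1 p2 = q powr (1 / d)"
    unfolding mu_star_def q_def[symmetric] d(1) by simp
  have cmp: "x < y \<longleftrightarrow> x powr d < y powr d" if "x > 0" "y > 0" for x y
    using that d(2) by (metis less_imp_le linorder_not_le powr_less_mono2 powr_mono2)
  have pow: "(q powr (1 / d)) powr d = q" using d(2) q by (simp add: powr_powr)
  have split: "\<mu> powr (2 / (4 - p2) - 1) = \<mu> powr (2 / (4 - p1) - 1) * \<mu> powr d"
    by (simp add: d_def flip: powr_add)
  define c where "c = \<mu> powr (2 / (4 - p1) - 1)"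
  have c: "c > 0" using \<mu> by (simp add: c_def)
  have E1: "E_inf p1 1 = q * E_inf p2 1" using E by (simp add: q_def)
  have e: "E_inf p1 1 * c = - ((- E_inf p2 1) * c) * q" "E_inf p2 1 * (c * \<mu> powr d) = - ((- E_inf p2 1) * c) * \<mu> powr d"
    unfolding E1 by (simp_all add: algebra_simps)
  have pos: "(- E_inf p2 1) * c > 0" using E c by (simp add: mult_neg_pos)
  have neg: "- a * x < - a * y \<longleftrightarrow> y < x" if "a > 0" for a x y :: real using that by simp
  show "\<mu> < mu_star p1 p2 \<longleftrightarrow> E_inf p1 1 * \<mu> powr (2 / (4 - p1) - 1) < E_inf p2 1 * \<mu> powr (2 / (4 - p2) - 1)"
    unfolding split c_def[symmetric] e neg[OF pos] ms using cmp[OF \<mu>, of "q powr (1 / d)"] q pow by simp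
  show "mu_star p1 p2 < \<mu> \<longleftrightarrow> E_inf p2 1 * \<mu> powr (2 / (4 - p2) - 1) < E_inf p1 1 * \<mu> powr (2 / (4 - p1) - 1)"
    unfolding split c_def[symmetric] e neg[OF pos] ms using cmp[OF _ \<mu>, of "q powr (1 / d)"] q pow by simp
qed

theorem theorem1p6:
  fixes p1 p2 \<beta> \<mu> :: real
    and U :: "real \<Rightarrow> (R2 \<Rightarrow> complex) \<times> (R2 \<Rightarrow> complex)"
  assumes "2 < p1" "p1 < 4" "2 < p2" "p2 < 4" "p1 < p2"
    and "\<beta> \<ge> 0" and "\<mu> > 0"
    and "\<And>\<sigma>. ground_state p1 p2 \<sigma> \<sigma> \<beta> \<mu> (U \<sigma>)"
  shows "(\<mu> < mu_star p1 p2 \<longrightarrow>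
            ((\<lambda>\<sigma>. (lp_norm 2 (fst (U \<sigma>)))\<^sup>2) \<longlongrightarrow> \<mu>) at_top \<and>
            ((\<lambda>\<sigma>. F_pair p1 p2 \<sigma> \<sigma> \<beta> (U \<sigma>)) \<longlongrightarrow> E_inf p1 \<mu>) at_top)
       \<and> (\<mu> > mu_star p1 p2 \<longrightarrow>
            ((\<lambda>\<sigma>. (lp_norm 2 (snd (U \<sigma>)))\<^sup>2) \<longlongrightarrow> \<mu>) at_top \<and>
            ((\<lambda>\<sigma>. F_pair p1 p2 \<sigma> \<sigma> \<beta> (U \<sigma>)) \<longlongrightarrow> E_inf p2 \<mu>) at_top)"
proof -
  note p1 = assms(1,2) and p2 = assms(3,4) and \<mu> = \<open>\<mu> > 0\<close>
  let ?F = "\<lambda>\<sigma> V. F_pair p1 p2 \<sigma> \<sigma> \<beta> V"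
  let ?M = "\<lambda>M. {v \<in> H1. (lp_norm 2 v)\<^sup>2 = M}"
  define u1 u2 where "u1 \<sigma> = fst (U \<sigma>)" and "u2 \<sigma> = snd (U \<sigma>)" for \<sigma>
  define m1 m2 where "m1 \<sigma> = (lp_norm 2 (u1 \<sigma>))\<^sup>2" and "m2 \<sigma> = (lp_norm 2 (u2 \<sigma>))\<^sup>2" for \<sigma>
  define s1 s2 where "s1 \<sigma> = cmod (charge (u1 \<sigma>))" and "s2 \<sigma> = cmod (charge (u2 \<sigma>))" for \<sigma>
  have U: "U \<sigma> \<in> Lam \<mu>" for \<sigma>
    using assms(8)[of \<sigma>] by (simp add: ground_state_def)
  have min: "?F \<sigma> (U \<sigma>) \<le> ?F \<sigma> V" if "V \<in> Lam \<mu>" for \<sigma> V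
  proof -
    have "ereal (?F \<sigma> (U \<sigma>)) = (INF V\<in>Lam \<mu>. ereal (?F \<sigma> V))"
      using assms(8)[of \<sigma>] by (simp add: ground_state_def)
    also have "\<dots> \<le> ereal (?F \<sigma> V)" using that by (rule INF_lower)
    finally show ?thesis by simp
  qed
  have dom: "u1 \<sigma> \<in> Dom" "u2 \<sigma> \<in> Dom" and mass: "m1 \<sigma> + m2 \<sigma> = \<mu>" for \<sigma>
    using U[of \<sigma>] by (auto simp: Lam_def u1_def u2_def m1_def m2_def)
  have m0: "0 \<le> m1 \<sigma>" "0 \<le> m2 \<sigma>" for \<sigma> by (auto simp: m1_def m2_def)
  have m_le: "m1 \<sigma> \<le> \<mu>" "m2 \<sigma> \<le> \<mu>" for \<sigma> using mass[of \<sigma>] m0[of \<sigma>] by auto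
  have lp0: "(lp_norm 2 (\<lambda>_. 0))\<^sup>2 = 0" by (simp add: lp_norm_sq)
  \<comment> \<open>Both charges of this competitor are 0, so its energy depends neither on \<sigma>
    nor on the coupling.\<close>
  have up1: "?F \<sigma> (U \<sigma>) \<le> E_fun p1 v" if "v \<in> ?M \<mu>" for \<sigma> v
    using min[of "(v, \<lambda>_. 0)" \<sigma>] that p1 p2 lp0
    by (simp add: Lam_def F_pair_def H1_charge zero_in_H1 F_single_H1 E_fun_zero)
  have up2: "?F \<sigma> (U \<sigma>) \<le> E_fun p2 v" if "v \<in> ?M \<mu>" for \<sigma> v
    using min[of "(\<lambda>_. 0, v)" \<sigma>] that p1 p2 lp0
    by (simp add: Lam_def F_pair_def H1_charge zero_in_H1 F_single_H1 E_fun_zero)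
  \<comment> \<open>Read from the other side, \<open>up1\<close> and \<open>up2\<close> bound the
    standard energies below by a ground state energy; the choice \<sigma> = 0 is arbitrary.\<close>
  have bdd: "bdd_below (E_fun p1 ` ?M \<mu>)" "bdd_below (E_fun p2 ` ?M \<mu>)"
    by (rule bdd_belowI2[OF up1[of _ 0]], assumption, rule bdd_belowI2[OF up2[of _ 0]], assumption)
  note bdd1 = bdd_below_energy[OF p1 \<mu> zero_less_one bdd(1)] bdd_below_energy[OF p2 \<mu> zero_less_one bdd(2)]
  note neg = E_inf_neg[OF p1 zero_less_one bdd1(1)] E_inf_neg[OF p2 zero_less_one bdd1(2)]
  \<comment> \<open>\<open>D1\<close> and \<open>D2\<close> are minus the standard levels at mass
    \<mu> per unit of mass.\<close>
  define D1 where "D1 = - (E_inf p1 1 * \<mu> powr (2 / (4 - p1) - 1))"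
  define D2 where "D2 = - (E_inf p2 1 * \<mu> powr (2 / (4 - p2) - 1))"
  have pm: "\<mu> powr t = \<mu> powr (t - 1) * \<mu>" for t using \<mu> by (simp add: powr_diff)
  have E: "E_inf p1 \<mu> = - D1 * \<mu>" "E_inf p2 \<mu> = - D2 * \<mu>"
    unfolding E_inf_scale[OF p1 \<mu> bdd(1)] E_inf_scale[OF p2 \<mu> bdd(2)] D1_def D2_def
      pm[of "2 / (4 - p1)"] pm[of "2 / (4 - p2)"] by (simp_all add: mult_ac)
  have upper: "?F \<sigma> (U \<sigma>) \<le> - D1 * \<mu>" "?F \<sigma> (U \<sigma>) \<le> - D2 * \<mu>" for \<sigma>
    unfolding E[symmetric] E_inf_def
    by (rule cINF_greatest[OF _ up1]; use H1_negative_energy[OF p1 \<mu>] in blast)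
      (rule cINF_greatest[OF _ up2]; use H1_negative_energy[OF p2 \<mu>] in blast)
  \<comment> \<open>The least energy at \<sigma> = 0 is - K. It is at most the energy of
    \<open>U \<sigma>\<close> there, which is its nonpositive energy at \<sigma> minus the charge
    term; so K bounds that term.\<close>
  define K where "K = - ?F 0 (U 0)"
  have shift: "?F \<sigma> (U \<sigma>) = ?F 0 (U \<sigma>) + \<sigma> / 2 * ((s1 \<sigma>)\<^sup>2 + (s2 \<sigma>)\<^sup>2)" for \<sigma>
    unfolding F_pair_def s1_def s2_def u1_def u2_def
    by (subst (1 2) F_single_shift) (simp add: algebra_simps)
  have charges: "(s1 \<sigma>)\<^sup>2 \<le> 2 * K / \<sigma>" "(s2 \<sigma>)\<^sup>2 \<le> 2 * K / \<sigma>" if "\<sigma> > 0" for \<sigma>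
  proof -
    have "E_inf p1 \<mu> < 0" by (rule E_inf_neg[OF p1 \<mu> bdd(1)])
    then have "?F \<sigma> (U \<sigma>) \<le> 0" using upper(1)[of \<sigma>] unfolding E by simp
    then have "\<sigma> * ((s1 \<sigma>)\<^sup>2 + (s2 \<sigma>)\<^sup>2) \<le> 2 * K"
      using min[OF U[of \<sigma>], of 0] shift[of \<sigma>] by (simp add: K_def)
    then have "(s1 \<sigma>)\<^sup>2 + (s2 \<sigma>)\<^sup>2 \<le> 2 * K / \<sigma>"
      using that by (simp add: pos_le_divide_eq mult.commute)
    then show "(s1 \<sigma>)\<^sup>2 \<le> 2 * K / \<sigma>" "(s2 \<sigma>)\<^sup>2 \<le> 2 * K / \<sigma>"
      using zero_le_power2[of "s1 \<sigma>"] zero_le_power2[of "s2 \<sigma>"] by linarith+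
  qed
  have "((\<lambda>\<sigma>. 2 * K / \<sigma>) \<longlongrightarrow> 0) at_top"
    by (rule tendsto_divide_0[OF tendsto_const filterlim_at_top_imp_at_infinity[OF filterlim_ident]])
  from tendsto_real_sqrt[OF this] have K0: "((\<lambda>\<sigma>. sqrt (2 * K / \<sigma>)) \<longlongrightarrow> 0) at_top" by simp
  have s_lim: "(s \<longlongrightarrow> 0) at_top" if "\<And>\<sigma>. 0 \<le> s \<sigma>" "\<And>\<sigma>. \<sigma> > 0 \<Longrightarrow> (s \<sigma>)\<^sup>2 \<le> 2 * K / \<sigma>" for s
  proof (rule tendsto_sandwich[OF _ _ tendsto_const K0])
    show "\<forall>\<^sub>F \<sigma> in at_top. s \<sigma> \<le> sqrt (2 * K / \<sigma>)"
      using eventually_gt_at_top[of 0] by eventually_elim (intro real_le_rsqrt that(2))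
  qed (use that in simp)
  have s1: "(s1 \<longlongrightarrow> 0) at_top" and s2: "(s2 \<longlongrightarrow> 0) at_top"
    using charges by (auto intro!: s_lim simp: s1_def s2_def)
  obtain r1 where r1: "(r1 \<longlongrightarrow> 0) at_top" "\<forall>\<^sub>F \<sigma> in at_top. - D1 * m1 \<sigma> - r1 \<sigma> \<le> F_single p1 \<sigma> (u1 \<sigma>)"
    using F_single_asymptotic_lower_bound[OF p1 bdd1(1) \<mu> dom(1) m_le(1)[unfolded m1_def] s1[unfolded s1_def]]
    unfolding D1_def m1_def by auto
  obtain r2 where r2: "(r2 \<longlongrightarrow> 0) at_top" "\<forall>\<^sub>F \<sigma> in at_top. - D2 * m2 \<sigma> - r2 \<sigma> \<le> F_single p2 \<sigma> (u2 \<sigma>)"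
    using F_single_asymptotic_lower_bound[OF p2 bdd1(2) \<mu> dom(2) m_le(2)[unfolded m2_def] s2[unfolded s2_def]]
    unfolding D2_def m2_def by auto
  \<comment> \<open>The coupling is quadratic in the charges and joins the vanishing
    remainder.\<close>
  define r where "r \<sigma> = r1 \<sigma> + r2 \<sigma> + \<beta> * (s1 \<sigma> * s2 \<sigma>)" for \<sigma>
  have "(r \<longlongrightarrow> 0 + 0 + \<beta> * (0 * 0)) at_top"
    unfolding r_def by (intro tendsto_intros r1 r2 s1 s2)
  then have r: "(r \<longlongrightarrow> 0) at_top" by simp
  have lower: "\<forall>\<^sub>F \<sigma> in at_top. - D1 * m1 \<sigma> - D2 * m2 \<sigma> - r \<sigma> \<le> ?F \<sigma> (U \<sigma>)"
    using r1(2) r2(2)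
  proof eventually_elim
    fix \<sigma> assume l: "- D1 * m1 \<sigma> - r1 \<sigma> \<le> F_single p1 \<sigma> (u1 \<sigma>)" "- D2 * m2 \<sigma> - r2 \<sigma> \<le> F_single p2 \<sigma> (u2 \<sigma>)"
    have "Re (charge (u1 \<sigma>) * cnj (charge (u2 \<sigma>))) \<le> s1 \<sigma> * s2 \<sigma>"
      using complex_Re_le_cmod[of "charge (u1 \<sigma>) * cnj (charge (u2 \<sigma>))"] by (simp add: norm_mult s1_def s2_def)
    then have "\<beta> * Re (charge (u1 \<sigma>) * cnj (charge (u2 \<sigma>))) \<le> \<beta> * (s1 \<sigma> * s2 \<sigma>)"
      using \<open>\<beta> \<ge> 0\<close> by (rule mult_left_mono)
    then show "- D1 * m1 \<sigma> - D2 * m2 \<sigma> - r \<sigma> \<le> ?F \<sigma> (U \<sigma>)"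
      using l unfolding F_pair_def r_def u1_def[symmetric] u2_def[symmetric] by linarith
  qed
  \<comment> \<open>\<open>two_mass_limit\<close> concentrates the first mass, so the second case
    uses it with the components exchanged.\<close>
  have mass': "m2 \<sigma> + m1 \<sigma> = \<mu>" for \<sigma> using mass[of \<sigma>] by simp
  have lower': "\<forall>\<^sub>F \<sigma> in at_top. - D2 * m2 \<sigma> - D1 * m1 \<sigma> - r \<sigma> \<le> ?F \<sigma> (U \<sigma>)"
    using lower by eventually_elim linarith
  note \<mu>_iff = mu_star_iff[OF \<open>p1 < p2\<close> \<open>p2 < 4\<close> \<mu> neg]
  show ?thesis
  proof (intro conjI[of "_ \<longrightarrow> _"] impI)
    assume "\<mu> < mu_star p1 p2"
    then have "D2 < D1" unfolding \<mu>_iff D1_def D2_def by simp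
    from two_mass_limit[OF m0 mass upper(1) lower r this]
    show "((\<lambda>\<sigma>. (lp_norm 2 (fst (U \<sigma>)))\<^sup>2) \<longlongrightarrow> \<mu>) at_top \<and>
        ((\<lambda>\<sigma>. ?F \<sigma> (U \<sigma>)) \<longlongrightarrow> E_inf p1 \<mu>) at_top"
      unfolding E by (simp add: m1_def u1_def)
  next
    assume "\<mu> > mu_star p1 p2"
    then have "D1 < D2" unfolding \<mu>_iff D1_def D2_def by simp
    from two_mass_limit[OF m0(2,1) mass' upper(2) lower' r this]
    show "((\<lambda>\<sigma>. (lp_norm 2 (snd (U \<sigma>)))\<^sup>2) \<longlongrightarrow> \<mu>) at_top \<and>
        ((\<lambda>\<sigma>. ?F \<sigma> (U \<sigma>)) \<longlongrightarrow> E_inf p2 \<mu>) at_top"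
      unfolding E by (simp add: m2_def u2_def)
  qed
qed

end
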